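(* Let $X$, $Y$ be bigraphs and $f,g:Y\to X$ bigraph homomorphisms, and suppose that $f$ or $g$ is injective (an inclusion). Let $Z$ be the pullback in the category of graphs of $(e_{-\infty},e_{+\infty}):X^L\to X^{K_2}\times X^{K_2}$ and $(f^{K_2},g^{K_2}):Y^{K_2}\to X^{K_2}\times X^{K_2}$. Then $|C(Z)|$ is a homotopy pullback of $(|f_*|,|g_*|):|B_{/K_2}(Y)|\to|B_{/K_2}(X)|\times|B_{/K_2}(X)|$ and the diagonal $\Delta:|B_{/K_2}(X)|\to|B_{/K_2}(X)|\times|B_{/K_2}(X)|$.
   Context: A graph is a set $V$ with a symmetric relation $E\subset V\times V$ (loops allowed); products are categorical (edges componentwise), and the pullback of $A\to C\leftarrow B$ is the induced subgraph of $A\times B$ on pairs with equal images. $K_2$ has vertices $0,1$ and edges $(0,1),(1,0)$. A bigraph is a graph $X$ with a graph homomorphism $\varepsilon_X:X\to K_2$; $V_i(X)=\varepsilon_X^{-1}(i)$; bigraph homomorphisms commute with colorings. For integers $a\le b$, $L_{a,b}$ is the bigraph with vertices $\{a,\dots,b\}$, edges $\{(s,t):|s-t|=1\}$, coloring $s\mapsto s\bmod2$; $L_{0,1}=K_2$. For bigraphs $A,W$, $W^A$ is the graph whose vertices are maps $h:V(A)\to V(W)$ with $\varepsilon_W\circ h=\varepsilon_A$, with $h,h'$ adjacent iff $(h(s),h'(t))\in E(W)$ for all $(s,t)\in E(A)$; $f^{K_2}:Y^{K_2}\to X^{K_2}$ is $h\mapsto f\circ h$. Let $r_n:L_{-n-1,n+2}\to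 L_{-n,n+1}$ be the retraction fixing $L_{-n,n+1}$ with $-n-1\mapsto-n+1$, $n+2\mapsto n$; $X^L$ is the colimit of $X^{L_{-n,n+1}}$ along $r_n^*(h)=h\circ r_n$. For $k=\pm2n$, $\iota_k:K_2\to L_{-2n,2n+1}$, $\iota_k(i)=k+i$; the maps $h\mapsto h\circ\iota_{\pm 2n}$ induce $e_{-\infty},e_{+\infty}:X^L\to X^{K_2}$. For a graph $G$, $C(G)$ is the poset of finite nonempty $\sigma\subset V(G)$ with $\sigma\times\sigma\subset E(G)$, ordered by inclusion. $B_{/K_2}(X)$ is the poset of pairs $(\sigma,\tau)$, $\sigma\subset V_0(X)$, $\tau\subset V_1(X)$ finite nonempty, $\sigma\times\tau\subset E(X)$, ordered componentwise; $f_*(\sigma,\tau)=(f(\sigma),f(\tau))$. $|\cdot|$ is geometric realization of the order complex. *)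

theory Defs
  imports "HOL-Analysis.Analysis" "HOL-Library.FuncSet"
begin

record 'v graph =
  verts :: "'v set"
  edges :: "('v \<times> 'v) set"

record 'v bigraph = "'v graph" +
  col :: "'v \<Rightarrow> nat"

definition is_graph :: "('v, 'z) graph_scheme \<Rightarrow> bool" where
  "is_graph G \<longleftrightarrow> edges G \<subseteq> verts G \<times> verts G \<and> sym (edges G)"

definition is_bigraph :: "'v bigraph \<Rightarrow> bool" where
  "is_bigraph X \<longleftrightarrow> is_graph X \<and> (\<forall>v\<in>verts X. col X v \<in> {0, 1})
     \<and> (\<forall>(u, v)\<in>edges X. (col X u, col X v) \<in> {(0, 1), (1, 0)})"

definition bigraph_hom :: "'y bigraph \<Rightarrow> 'x bigraph \<Rightarrow> ('y \<Rightarrow> 'x) \<Rightarrow> bool" where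
  "bigraph_hom Y X f \<longleftrightarrow> f ` verts Y \<subseteq> verts X
     \<and> (\<forall>(u, v)\<in>edges Y. (f u, f v) \<in> edges X)
     \<and> (\<forall>v\<in>verts Y. col X (f v) = col Y v)"

definition K2 :: "nat bigraph" where
  "K2 = \<lparr>verts = {0, 1}, edges = {(0, 1), (1, 0)}, col = (\<lambda>i. i)\<rparr>"

definition Lpath :: "int \<Rightarrow> int \<Rightarrow> int bigraph" where
  "Lpath a b = \<lparr>verts = {a..b}, edges = {(s, t). s \<in> {a..b} \<and> t \<in> {a..b} \<and> \<bar>s - t\<bar> = 1},
                col = (\<lambda>s. nat (s mod 2))\<rparr>"

definition prod_graph :: "('a, 'z1) graph_scheme \<Rightarrow> ('b, 'z2) graph_scheme \<Rightarrow> ('a \<times> 'b) graph" where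
  "prod_graph A B = \<lparr>verts = verts A \<times> verts B,
     edges = {((a, b), (a', b')). (a, a') \<in> edges A \<and> (b, b') \<in> edges B}\<rparr>"

definition pullback_graph :: "('a, 'z1) graph_scheme \<Rightarrow> ('b, 'z2) graph_scheme
     \<Rightarrow> ('a \<Rightarrow> 'c) \<Rightarrow> ('b \<Rightarrow> 'c) \<Rightarrow> ('a \<times> 'b) graph" where
  "pullback_graph A B p q =
     (let V = {(a, b) \<in> verts A \<times> verts B. p a = q b} in
      \<lparr>verts = V, edges = edges (prod_graph A B) \<inter> (V \<times> V)\<rparr>)"

definition exp_graph :: "'w bigraph \<Rightarrow> 'a bigraph \<Rightarrow> ('a \<Rightarrow> 'w) graph" where
  "exp_graph W A =
     (let V = {h \<in> verts A \<rightarrow>\<^sub>E verts W. \<forall>s\<in>verts A. col W (h s) = col A s} in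
      \<lparr>verts = V,
       edges = {(h, h'). h \<in> V \<and> h' \<in> V \<and> (\<forall>(s, t)\<in>edges A. (h s, h' t) \<in> edges W)}\<rparr>)"

definition postcomp_K2 :: "('y \<Rightarrow> 'x) \<Rightarrow> (nat \<Rightarrow> 'y) \<Rightarrow> (nat \<Rightarrow> 'x)" where
  "postcomp_K2 f h = restrict (f \<circ> h) {0, 1}"

text \<open>\<open>Rfold n\<close> is the composite retraction \<open>\<int> \<rightarrow> {-n..n+1}\<close> of all \<open>r_m\<close>, \<open>m \<ge> n\<close>
  (so that \<open>r_n \<circ> Rfold (n+1) = Rfold n\<close>); the stage-\<open>n\<close> vertex \<open>h\<close> is
  sent into the colimit as \<open>h \<circ> Rfold n\<close>.\<close>
definition Rfold :: "nat \<Rightarrow> int \<Rightarrow> int" where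
  "Rfold n t =
     (if t > int n + 1 then (if even (t - (int n + 1)) then int n + 1 else int n)
      else if t < - int n then (if even (- int n - t) then - int n else - int n + 1)
      else t)"

definition stage_graph :: "'x bigraph \<Rightarrow> nat \<Rightarrow> (int \<Rightarrow> 'x) graph" where
  "stage_graph X n = exp_graph X (Lpath (- int n) (int n + 1))"

text \<open>Colimit of graphs along the injective maps \<open>r_n^*\<close>: vertex set is the union of the
  (embedded) stages; an edge is an edge at some stage.\<close>
definition XL :: "'x bigraph \<Rightarrow> (int \<Rightarrow> 'x) graph" where
  "XL X = \<lparr>verts = {h \<circ> Rfold n | h n. h \<in> verts (stage_graph X n)},
           edges = {(h \<circ> Rfold n, h' \<circ> Rfold n) | h h' n. (h, h') \<in> edges (stage_graph X n)}\<rparr>"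

definition in_stage :: "'x bigraph \<Rightarrow> nat \<Rightarrow> (int \<Rightarrow> 'x) \<Rightarrow> bool" where
  "in_stage X n H \<longleftrightarrow> (\<exists>h\<in>verts (stage_graph X n). H = h \<circ> Rfold n)"

text \<open>\<open>e_{+\<infinity>}\<close>, \<open>e_{-\<infinity>}\<close>: induced by \<open>h \<mapsto> h \<circ> \<iota>_{\<plusminus>2m}\<close> at stage \<open>2m\<close>.\<close>
definition e_pinf :: "'x bigraph \<Rightarrow> (int \<Rightarrow> 'x) \<Rightarrow> (nat \<Rightarrow> 'x)" where
  "e_pinf X H = (let m = (SOME m. in_stage X (2 * m) H) in
                  restrict (\<lambda>i. H (2 * int m + int i)) {0, 1})"

definition e_minf :: "'x bigraph \<Rightarrow> (int \<Rightarrow> 'x) \<Rightarrow> (nat \<Rightarrow> 'x)" where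
  "e_minf X H = (let m = (SOME m. in_stage X (2 * m) H) in
                  restrict (\<lambda>i. H (- 2 * int m + int i)) {0, 1})"

definition Zgraph :: "'x bigraph \<Rightarrow> 'y bigraph \<Rightarrow> ('y \<Rightarrow> 'x) \<Rightarrow> ('y \<Rightarrow> 'x)
     \<Rightarrow> ((int \<Rightarrow> 'x) \<times> (nat \<Rightarrow> 'y)) graph" where
  "Zgraph X Y f g =
     pullback_graph (XL X) (exp_graph Y K2)
       (\<lambda>H. (e_minf X H, e_pinf X H)) (\<lambda>k. (postcomp_K2 f k, postcomp_K2 g k))"

definition clique_poset :: "('v, 'z) graph_scheme \<Rightarrow> 'v set set" where
  "clique_poset G = {\<sigma>. finite \<sigma> \<and> \<sigma> \<noteq> {} \<and> \<sigma> \<subseteq> verts G \<and> \<sigma> \<times> \<sigma> \<subseteq> edges G}"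

definition bip_poset :: "'v bigraph \<Rightarrow> ('v set \<times> 'v set) set" where
  "bip_poset X = {(\<sigma>, \<tau>). \<sigma> \<subseteq> {v \<in> verts X. col X v = 0} \<and> \<tau> \<subseteq> {v \<in> verts X. col X v = 1}
      \<and> finite \<sigma> \<and> \<sigma> \<noteq> {} \<and> finite \<tau> \<and> \<tau> \<noteq> {} \<and> \<sigma> \<times> \<tau> \<subseteq> edges X}"

definition bip_le :: "('v set \<times> 'v set) \<Rightarrow> ('v set \<times> 'v set) \<Rightarrow> bool" where
  "bip_le p q \<longleftrightarrow> fst p \<subseteq> fst q \<and> snd p \<subseteq> snd q"

definition bip_map :: "('y \<Rightarrow> 'x) \<Rightarrow> ('y set \<times> 'y set) \<Rightarrow> ('x set \<times> 'x set)" where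
  "bip_map f p = (f ` fst p, f ` snd p)"

definition chain_in :: "'p set \<Rightarrow> ('p \<Rightarrow> 'p \<Rightarrow> bool) \<Rightarrow> 'p set \<Rightarrow> bool" where
  "chain_in P le c \<longleftrightarrow> c \<subseteq> P \<and> (\<forall>x\<in>c. \<forall>y\<in>c. le x y \<or> le y x)"

definition realization_points :: "'p set \<Rightarrow> ('p \<Rightarrow> 'p \<Rightarrow> bool) \<Rightarrow> ('p \<Rightarrow> real) set" where
  "realization_points P le =
     {\<alpha>. (\<forall>p. 0 \<le> \<alpha> p) \<and> finite {p. \<alpha> p \<noteq> 0} \<and> chain_in P le {p. \<alpha> p \<noteq> 0}
          \<and> (\<Sum>p\<in>{p. \<alpha> p \<noteq> 0}. \<alpha> p) = 1}"

definition closed_simplex :: "'p set \<Rightarrow> ('p \<Rightarrow> 'p \<Rightarrow> bool) \<Rightarrow> 'p set \<Rightarrow> ('p \<Rightarrow> real) set" where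
  "closed_simplex P le c = {\<alpha> \<in> realization_points P le. {p. \<alpha> p \<noteq> 0} \<subseteq> c}"

text \<open>The CW (weak) topology: a set is open iff its trace on every closed simplex (spanned by a
  finite nonempty chain) is open in the Euclidean topology of that simplex.\<close>
definition realization :: "'p set \<Rightarrow> ('p \<Rightarrow> 'p \<Rightarrow> bool) \<Rightarrow> ('p \<Rightarrow> real) topology" where
  "realization P le = topology (\<lambda>U. U \<subseteq> realization_points P le \<and>
      (\<forall>c. finite c \<and> c \<noteq> {} \<and> chain_in P le c \<longrightarrow>
          openin (subtopology (powertop_real UNIV) (closed_simplex P le c)) (U \<inter> closed_simplex P le c)))"

definition realization_map :: "('p \<Rightarrow> 'q) \<Rightarrow> ('p \<Rightarrow> real) \<Rightarrow> ('q \<Rightarrow> real)" where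
  "realization_map \<phi> \<alpha> = (\<lambda>q. \<Sum>p\<in>{p. \<alpha> p \<noteq> 0 \<and> \<phi> p = q}. \<alpha> p)"

definition cmaps :: "'a topology \<Rightarrow> 'b topology \<Rightarrow> ('a \<Rightarrow> 'b) set" where
  "cmaps S T = {h. continuous_map S T h \<and> (\<forall>x. x \<notin> topspace S \<longrightarrow> h x = undefined)}"

definition compact_open :: "'a topology \<Rightarrow> 'b topology \<Rightarrow> ('a \<Rightarrow> 'b) topology" where
  "compact_open S T = topology_generated_by
     ({cmaps S T} \<union> {{h \<in> cmaps S T. h ` K \<subseteq> U} | K U. compactin S K \<and> openin T U})"

definition unit_interval :: "real topology" where
  "unit_interval = top_of_set {0..1}"

definition hpullback :: "'a topology \<Rightarrow> 'b topology \<Rightarrow> 'c topology \<Rightarrow> ('a \<Rightarrow> 'c) \<Rightarrow> ('b \<Rightarrow> 'c)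
     \<Rightarrow> ('a \<times> 'b \<times> (real \<Rightarrow> 'c)) topology" where
  "hpullback A B C p q = subtopology (prod_topology A (prod_topology B (compact_open unit_interval C)))
     {(a, b, \<gamma>). \<gamma> 0 = p a \<and> \<gamma> 1 = q b}"

text \<open>The closed \<open>n\<close>-disk and its boundary sphere (empty for \<open>n = 0\<close>).\<close>
definition disk :: "nat \<Rightarrow> (nat \<Rightarrow> real) topology" where
  "disk n = subtopology (Euclidean_space n) {x. (\<Sum>i<n. (x i)\<^sup>2) \<le> 1}"

definition disk_boundary :: "nat \<Rightarrow> (nat \<Rightarrow> real) set" where
  "disk_boundary n = {x \<in> topspace (disk n). (\<Sum>i<n. (x i)\<^sup>2) = 1}"

text \<open>Weak homotopy equivalence, via the standard relative lifting characterization
  (equivalent to bijectivity on \<open>\<pi>_0\<close> and on all \<open>\<pi>_n\<close> at all basepoints).\<close>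
definition weak_homotopy_equivalence :: "'a topology \<Rightarrow> 'b topology \<Rightarrow> ('a \<Rightarrow> 'b) \<Rightarrow> bool" where
  "weak_homotopy_equivalence W P \<phi> \<longleftrightarrow> continuous_map W P \<phi> \<and>
     (\<forall>n u v. continuous_map (subtopology (disk n) (disk_boundary n)) W u
        \<and> continuous_map (disk n) P v \<and> (\<forall>x\<in>disk_boundary n. v x = \<phi> (u x)) \<longrightarrow>
        (\<exists>l. continuous_map (disk n) W l \<and> (\<forall>x\<in>disk_boundary n. l x = u x)
             \<and> homotopic_with (\<lambda>h. \<forall>x\<in>disk_boundary n. h x = v x) (disk n) P (\<phi> \<circ> l) v))"

definition is_homotopy_pullback :: "'w topology \<Rightarrow> 'a topology \<Rightarrow> 'b topology \<Rightarrow> 'c topology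
     \<Rightarrow> ('a \<Rightarrow> 'c) \<Rightarrow> ('b \<Rightarrow> 'c) \<Rightarrow> bool" where
  "is_homotopy_pullback W A B C p q \<longleftrightarrow>
     (\<exists>a b H. continuous_map W A a \<and> continuous_map W B b
        \<and> continuous_map (prod_topology W unit_interval) C H
        \<and> (\<forall>w\<in>topspace W. H (w, 0) = p (a w) \<and> H (w, 1) = q (b w))
        \<and> weak_homotopy_equivalence W (hpullback A B C p q)
             (\<lambda>w. (a w, b w, restrict (\<lambda>t. H (w, t)) {0..1})))"

end

theory Submission
  imports Defs
begin

text \<open>
  A point of the realization of a poset of finite sets is encoded by the function \<open>l\<close> sending \<open>v\<close> to
  the total weight of the sets containing \<open>v\<close>: the level sets of \<open>l\<close> form the supporting chain and the
  lengths of the level intervals are the barycentric coordinates. Maps from a compact space into a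
  realization thus become finitely supported families of fuzzy sets, and two such families are
  homotopic as soon as the unions of their supports belong to the poset (contiguity).

  A fuzzy clique of \<open>Z\<close> has as its marginals at consecutive integers a bi-infinite, eventually constant
  path of fuzzy edges of \<open>X\<close> joining the two images of a fuzzy edge of \<open>Y\<close>; this is the comparison map.
  For the relative lifting property one samples a family of paths at the times \<open>i / N\<close> for large \<open>N\<close>.
  Cutting the weights at \<open>1/2\<close> makes consecutive samples completely adjacent, so their product is a
  family of fuzzy cliques of \<open>Z\<close>. On the boundary of the disk the sampled family is contiguous to the
  given one slowed down by a walk on \<open>\<int>\<close> that waits \<open>N - 1\<close> steps at each edge, and this walk is connected
  to the identity by moves that raise a local minimum by 2, each of which is again a contiguity.
\<close>

section \<open>The weak topology of a realization\<close>

text \<open>The lifting property asks for exact agreement with the given map on the boundary, but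
  sampling changes both the weights (they are cut) and the time scale (by the factor
  \<open>N\<close>). So the lift is not corrected; the whole problem is moved instead.
  \<open>lift_transfer\<close> shows that solvability survives a homotopy of the boundary map
  together with one of the map on the disk, provided the two stay connected by a homotopy that is
  stationary at both ends. For contiguous families this connection is given by \<open>hom\<close>,
  and what remains is to show that certain unions of supports are cliques of \<open>Z\<close> or
  members of \<open>SX\<close>.

  The carrier used for this is a star: the values of a clique at three consecutive integers form a
  member of \<open>SX\<close>, because integers of different parity in such a window differ by 1. A
  reparametrization is harmless when all positions involved at one time share a window. The identity
  and the slow walk need not do so, which is why elementary moves between walks are interposed.
  Walks have to keep parity because vertices are coloured, and this is why \<open>N\<close> is
  odd.\<close>

text \<open>\<open>realization\<close> is given through \<open>topology\<close>, so its open sets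
  are only accessible once the defining predicate is known to be closed under intersections and
  unions. Both are checked simplex by simplex.\<close>

lemma openin_realization:
  "openin (realization P le) U \<longleftrightarrow> U \<subseteq> realization_points P le \<and>
      (\<forall>c. finite c \<and> c \<noteq> {} \<and> chain_in P le c \<longrightarrow>
          openin (subtopology (powertop_real UNIV) (closed_simplex P le c)) (U \<inter> closed_simplex P le c))"
proof -
  let ?Q = "\<lambda>U c. openin (subtopology (powertop_real UNIV) (closed_simplex P le c)) (U \<inter> closed_simplex P le c)"
  have "istopology (\<lambda>U. U \<subseteq> realization_points P le \<and>
      (\<forall>c. finite c \<and> c \<noteq> {} \<and> chain_in P le c \<longrightarrow> ?Q U c))"
    unfolding istopology_def
  proof (intro conjI allI impI; (elim conjE)?)
    fix S T c
    assume "\<forall>c. finite c \<and> c \<noteq> {} \<and> chain_in P le c \<longrightarrow> ?Q S c" "\<forall>c. finite c \<and> c \<noteq> {} \<and> chain_in P le c \<longrightarrow> ?Q T c"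
      and "finite c" "c \<noteq> {}" "chain_in P le c"
    then have "?Q S c" "?Q T c" by auto
    then have "openin (subtopology (powertop_real UNIV) (closed_simplex P le c)) ((S \<inter> closed_simplex P le c) \<inter> (T \<inter> closed_simplex P le c))"
      by (rule openin_Int)
    then show "?Q (S \<inter> T) c" by (simp add: Int_ac)
  next
    fix \<K> c
    assume \<K>: "\<forall>K\<in>\<K>. K \<subseteq> realization_points P le \<and> (\<forall>c. finite c \<and> c \<noteq> {} \<and> chain_in P le c \<longrightarrow> ?Q K c)"
      and "finite c" "c \<noteq> {}" "chain_in P le c"
    then have "openin (subtopology (powertop_real UNIV) (closed_simplex P le c)) (\<Union>K\<in>\<K>. K \<inter> closed_simplex P le c)"
      by (intro openin_Union) auto
    moreover have "(\<Union>K\<in>\<K>. K \<inter> closed_simplex P le c) = \<Union> \<K> \<inter> closed_simplex P le c" by auto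
    ultimately show "?Q (\<Union> \<K>) c" by simp
  qed auto
  then show ?thesis
    unfolding realization_def by (simp only: topology_inverse')
qed

lemma topspace_realization [simp]: "topspace (realization P le) = realization_points P le"
proof -
  have "openin (realization P le) (realization_points P le)"
    unfolding openin_realization
  proof (intro conjI allI impI)
    fix c
    have "realization_points P le \<inter> closed_simplex P le c
        = topspace (subtopology (powertop_real UNIV) (closed_simplex P le c))"
      by (auto simp: closed_simplex_def)
    then show "openin (subtopology (powertop_real UNIV) (closed_simplex P le c)) (realization_points P le \<inter> closed_simplex P le c)"
      by (metis openin_topspace)
  qed auto
  then show ?thesis
    by (metis openin_realization openin_subset openin_topspace subset_antisym)
qed

lemma realization_points_support:
  fixes \<alpha> :: "'p \<Rightarrow> real"
  assumes "\<alpha> \<in> realization_points P le"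
  shows "finite {p. \<alpha> p \<noteq> 0}" "{p. \<alpha> p \<noteq> 0} \<noteq> {}" "chain_in P le {p. \<alpha> p \<noteq> 0}"
    "\<alpha> \<in> closed_simplex P le {p. \<alpha> p \<noteq> 0}"
  using assms by (auto simp: realization_points_def closed_simplex_def simp del: Collect_empty_eq)

text \<open>The realization is the colimit of its closed simplices, so continuity out of it is
  tested on each of them, where only finitely many coordinates matter.\<close>

lemma continuous_map_from_realization:
  assumes "\<And>c. finite c \<Longrightarrow> c \<noteq> {} \<Longrightarrow> chain_in P le c \<Longrightarrow>
      continuous_map (subtopology (powertop_real UNIV) (closed_simplex P le c)) T F"
  shows "continuous_map (realization P le) T F"
  unfolding continuous_map_def
proof (intro conjI allI impI)
  show "F \<in> topspace (realization P le) \<rightarrow> topspace T"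
  proof
    fix \<alpha> assume "\<alpha> \<in> topspace (realization P le)"
    then have \<alpha>: "\<alpha> \<in> realization_points P le" by simp
    note s = realization_points_support[OF \<alpha>]
    have "F \<in> topspace (subtopology (powertop_real UNIV) (closed_simplex P le {p. \<alpha> p \<noteq> 0})) \<rightarrow> topspace T"
      using assms[OF s(1-3)] continuous_map_funspace by blast
    then show "F \<alpha> \<in> topspace T"
      using s(4) by auto
  qed
next
  fix U assume U: "openin T U"
  show "openin (realization P le) {x \<in> topspace (realization P le). F x \<in> U}"
    unfolding openin_realization
  proof (intro conjI allI impI)
    fix c assume "finite c \<and> c \<noteq> {} \<and> chain_in P le c"
    then have "continuous_map (subtopology (powertop_real UNIV) (closed_simplex P le c)) T F"
      using assms by blast
    from openin_continuous_map_preimage[OF this U]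
    show "openin (subtopology (powertop_real UNIV) (closed_simplex P le c))
        ({x \<in> topspace (realization P le). F x \<in> U} \<inter> closed_simplex P le c)"
      by (rule back_subst[where P="openin _"]) (auto simp: closed_simplex_def)
  qed auto
qed

lemma continuous_map_powertop_coord:
  "continuous_map (subtopology (powertop_real UNIV) S) euclideanreal (\<lambda>\<alpha>. \<alpha> p)"
  by (intro continuous_map_from_subtopology continuous_map_product_projection) auto

lemma continuous_map_realization_coord:
  "continuous_map (realization P le) euclideanreal (\<lambda>\<alpha>. \<alpha> p)"
  by (intro continuous_map_from_realization continuous_map_powertop_coord)

lemma closed_simplex_eq:
  assumes "finite c" "chain_in P le c"
  shows "closed_simplex P le c = {\<alpha>. (\<forall>p. 0 \<le> \<alpha> p) \<and> (\<forall>p. p \<notin> c \<longrightarrow> \<alpha> p = 0) \<and> (\<Sum>p\<in>c. \<alpha> p) = 1}"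
proof (intro set_eqI iffI)
  fix \<alpha> :: "'a \<Rightarrow> real" assume "\<alpha> \<in> closed_simplex P le c"
  then have *: "\<forall>p. 0 \<le> \<alpha> p" "{p. \<alpha> p \<noteq> 0} \<subseteq> c" "(\<Sum>p\<in>{p. \<alpha> p \<noteq> 0}. \<alpha> p) = 1"
    by (auto simp: closed_simplex_def realization_points_def)
  moreover have "(\<Sum>p\<in>c. \<alpha> p) = (\<Sum>p\<in>{p. \<alpha> p \<noteq> 0}. \<alpha> p)"
    using * assms by (intro sum.mono_neutral_right) auto
  ultimately show "\<alpha> \<in> {\<alpha>. (\<forall>p. 0 \<le> \<alpha> p) \<and> (\<forall>p. p \<notin> c \<longrightarrow> \<alpha> p = 0) \<and> (\<Sum>p\<in>c. \<alpha> p) = 1}"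
    by auto
next
  fix \<alpha> :: "'a \<Rightarrow> real" assume "\<alpha> \<in> {\<alpha>. (\<forall>p. 0 \<le> \<alpha> p) \<and> (\<forall>p. p \<notin> c \<longrightarrow> \<alpha> p = 0) \<and> (\<Sum>p\<in>c. \<alpha> p) = 1}"
  then have *: "\<forall>p. 0 \<le> \<alpha> p" "{p. \<alpha> p \<noteq> 0} \<subseteq> c" "(\<Sum>p\<in>c. \<alpha> p) = 1"
    by auto
  moreover have "(\<Sum>p\<in>c. \<alpha> p) = (\<Sum>p\<in>{p. \<alpha> p \<noteq> 0}. \<alpha> p)"
    using * assms by (intro sum.mono_neutral_right) auto
  moreover have "finite {p. \<alpha> p \<noteq> 0}"
    using * assms finite_subset by blast
  moreover have "chain_in P le {p. \<alpha> p \<noteq> 0}"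
    using assms(2) *(2) unfolding chain_in_def by blast
  ultimately show "\<alpha> \<in> closed_simplex P le c"
    by (auto simp: closed_simplex_def realization_points_def)
qed

lemma closedin_closed_simplex:
  assumes "finite c" "chain_in P le c"
  shows "closedin (powertop_real UNIV) (closed_simplex P le c)"
proof -
  have 1: "closed {\<alpha>::'a \<Rightarrow> real. 0 \<le> \<alpha> p}" for p
    by (intro closed_Collect_le continuous_intros continuous_on_product_coordinates)
  have 2: "closed {\<alpha>::'a \<Rightarrow> real. p \<notin> c \<longrightarrow> \<alpha> p = 0}" for p
    by (cases "p \<in> c") (auto intro!: closed_Collect_eq continuous_intros continuous_on_product_coordinates)
  have 3: "closed {\<alpha>::'a \<Rightarrow> real. (\<Sum>p\<in>c. \<alpha> p) = 1}"
    by (intro closed_Collect_eq continuous_intros continuous_on_product_coordinates)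
  have "closed_simplex P le c = (\<Inter>p. {\<alpha>. 0 \<le> \<alpha> p}) \<inter> (\<Inter>p. {\<alpha>. p \<notin> c \<longrightarrow> \<alpha> p = 0}) \<inter> {\<alpha>. (\<Sum>p\<in>c. \<alpha> p) = 1}"
    unfolding closed_simplex_eq[OF assms] by auto
  then have "closed (closed_simplex P le c)"
    using 1 2 3 by (metis (no_types, lifting) closed_INT closed_Int)
  then show ?thesis
    by (simp add: euclidean_product_topology)
qed

lemma compactin_closed_simplex:
  assumes "finite c" "chain_in P le c"
  shows "compact_space (subtopology (powertop_real UNIV) (closed_simplex P le c))"
proof -
  let ?B = "PiE UNIV (\<lambda>_::'a. {0..1::real})"
  have "compactin (powertop_real UNIV) ?B"
    by (subst compactin_PiE) auto
  moreover have "closed_simplex P le c \<subseteq> ?B"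
  proof
    fix \<alpha> assume "\<alpha> \<in> closed_simplex P le c"
    then have *: "\<forall>p. 0 \<le> \<alpha> p" "\<forall>p. p \<notin> c \<longrightarrow> \<alpha> p = 0" "(\<Sum>p\<in>c. \<alpha> p) = 1"
      by (auto simp: closed_simplex_eq[OF assms])
    have "\<alpha> p \<le> 1" for p
    proof (cases "p \<in> c")
      case True
      then have "\<alpha> p \<le> (\<Sum>p\<in>c. \<alpha> p)"
        using * assms(1) by (intro member_le_sum) auto
      then show ?thesis using * by simp
    qed (use * in auto)
    then show "\<alpha> \<in> ?B" using * by auto
  qed
  ultimately show ?thesis
    using closedin_closed_simplex[OF assms] closed_compactin compact_space_subtopology by blast
qed

text \<open>Continuity of all coordinates does not suffice for the weak topology in general. The
  common finite set \<open>C\<close> confines the image to finitely many simplices, each closed in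
  the product topology, so the preimage of a closed set is a finite union of closed sets.\<close>

lemma continuous_map_into_realization:
  assumes F: "\<And>x. x \<in> topspace K \<Longrightarrow> F x \<in> realization_points P le"
    and C: "finite C" "\<And>x. x \<in> topspace K \<Longrightarrow> {p. F x p \<noteq> 0} \<subseteq> C"
    and cont: "\<And>p. continuous_map K euclideanreal (\<lambda>x. F x p)"
  shows "continuous_map K (realization P le) F"
  unfolding continuous_map_closedin
proof (intro conjI allI impI)
  fix A assume A: "closedin (realization P le) A"
  have c: "continuous_map K (powertop_real UNIV) F"
    using cont by (simp add: continuous_map_componentwise_UNIV)
  let ?\<C> = "{c. c \<subseteq> C \<and> c \<noteq> {} \<and> chain_in P le c}"
  have "closedin K {x \<in> topspace K. F x \<in> A \<inter> closed_simplex P le c}" if c': "c \<in> ?\<C>" for c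
  proof -
    have fc: "finite c" using c' C(1) finite_subset by blast
    let ?S = "subtopology (powertop_real UNIV) (closed_simplex P le c)"
    have op: "openin ?S ((topspace (realization P le) - A) \<inter> closed_simplex P le c)"
      using A c' fc unfolding closedin_def openin_realization[of P le "topspace (realization P le) - A"] by blast
    have "topspace ?S - (topspace (realization P le) - A) \<inter> closed_simplex P le c = A \<inter> closed_simplex P le c"
      using A by (auto simp: closedin_def closed_simplex_def)
    then have "closedin ?S (A \<inter> closed_simplex P le c)"
      using op by (metis closedin_diff closedin_topspace)
    then have "closedin (powertop_real UNIV) (A \<inter> closed_simplex P le c)"
      using c' fc closedin_closed_simplex closedin_closed_subtopology by blast
    then show ?thesis
      using c closedin_continuous_map_preimage by blast
  qed
  moreover have "finite ?\<C>" using C(1) by simp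
  ultimately have "closedin K (\<Union>c\<in>?\<C>. {x \<in> topspace K. F x \<in> A \<inter> closed_simplex P le c})"
    by (intro closedin_Union) auto
  moreover have "(\<Union>c\<in>?\<C>. {x \<in> topspace K. F x \<in> A \<inter> closed_simplex P le c}) = {x \<in> topspace K. F x \<in> A}" (is "?l = ?r")
  proof
    show "?r \<subseteq> ?l"
    proof clarify
      fix x assume x: "x \<in> topspace K" "F x \<in> A"
      note s = realization_points_support[OF F[OF x(1)]]
      show "x \<in> ?l"
        using s C(2)[OF x(1)] x by (intro UN_I[of "{p. F x p \<noteq> 0}"]) auto
    qed
  qed auto
  ultimately show "closedin K {x \<in> topspace K. F x \<in> A}" by simp
qed (use F in auto)

text \<open>Let \<open>A\<close> contain one point for each support that occurs in \<open>S\<close>.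
  A closed simplex has finitely many faces, so it meets every subset of \<open>A\<close> in finitely
  many points, and all these subsets are closed. Removing all points of \<open>A\<close> but one
  gives open sets that cover \<open>S\<close> and contain at most one point of \<open>A\<close>
  each; a finite subcover bounds the number of supports, and each support is finite.\<close>

lemma compactin_realization_finite_support:
  assumes "compactin (realization P le) S"
  shows "finite (\<Union>\<alpha>\<in>S. {p. \<alpha> p \<noteq> 0})"
proof -
  let ?s = "\<lambda>\<alpha>. {p. \<alpha> p \<noteq> (0::real)}"
  have S: "S \<subseteq> realization_points P le"
    using assms compactin_subset_topspace by fastforce
  obtain A where A: "A \<subseteq> S" "inj_on ?s A" "?s ` A = ?s ` S"
    using subset_image_inj[of "?s ` S" ?s S] by auto
  have closed: "openin (realization P le) (realization_points P le - B)" if "B \<subseteq> A" for B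
    unfolding openin_realization
  proof (intro conjI allI impI)
    fix c assume c: "finite c \<and> c \<noteq> {} \<and> chain_in P le c"
    let ?T = "subtopology (powertop_real UNIV) (closed_simplex P le c)"
    have "?s ` (B \<inter> closed_simplex P le c) \<subseteq> Pow c"
      by (auto simp: closed_simplex_def)
    moreover have "inj_on ?s (B \<inter> closed_simplex P le c)"
      using A(2) that by (meson Int_lower1 inj_on_subset)
    ultimately have "finite (B \<inter> closed_simplex P le c)"
      using c by (meson finite_Pow_iff finite_imageD finite_subset)
    moreover have "t1_space ?T"
      by (intro t1_space_subtopology) (intro Hausdorff_imp_t1_space, simp add: Hausdorff_space_product_topology)
    ultimately have "closedin ?T (B \<inter> closed_simplex P le c)"
      by (auto simp: t1_space_closedin_finite)
    then have "openin ?T (topspace ?T - B \<inter> closed_simplex P le c)" by blast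
    moreover have "topspace ?T - B \<inter> closed_simplex P le c = (realization_points P le - B) \<inter> closed_simplex P le c"
      by (auto simp: closed_simplex_def)
    ultimately show "openin ?T ((realization_points P le - B) \<inter> closed_simplex P le c)" by simp
  qed auto
  let ?\<U> = "insert (realization_points P le - A) ((\<lambda>a. realization_points P le - (A - {a})) ` A)"
  have "\<exists>\<F>. finite \<F> \<and> \<F> \<subseteq> ?\<U> \<and> S \<subseteq> \<Union> \<F>"
    using assms closed S A(1) by (intro compactinD[where S=S]) auto
  then obtain \<F> where \<F>: "finite \<F>" "\<F> \<subseteq> ?\<U>" "S \<subseteq> \<Union> \<F>" by blast
  have "A \<subseteq> \<Union> ((\<lambda>U. U \<inter> A) ` \<F>)" using A(1) \<F>(3) by blast
  moreover have "finite (U \<inter> A)" if "U \<in> \<F>" for U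
  proof -
    have "U \<inter> A = {} \<or> (\<exists>a. U \<inter> A \<subseteq> {a})" using that \<F>(2) by auto
    then show ?thesis by (metis finite.emptyI finite.insertI finite_subset)
  qed
  ultimately have "finite A" by (meson \<F>(1) finite_UN finite_subset)
  then have "finite (?s ` S)" using A(3) by (metis finite_imageI)
  moreover have "finite (?s \<alpha>)" if "\<alpha> \<in> S" for \<alpha>
    using that S realization_points_support(1) by blast
  ultimately show ?thesis by blast
qed

section \<open>Exponential law for the unit interval\<close>

lemma topspace_unit_interval [simp]: "topspace unit_interval = {0..1}"
  by (simp add: unit_interval_def)

lemma compact_space_unit_interval [simp]: "compact_space unit_interval"
  by (simp add: unit_interval_def compact_space_subtopology)

lemma topspace_compact_open [simp]: "topspace (compact_open S T) = cmaps S T"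
  unfolding compact_open_def topology_generated_by_topspace by auto

text \<open>For a compact set \<open>L\<close> of times, Wallace's theorem gives a neighbourhood of
  \<open>x\<close> from which all of \<open>L\<close> is still mapped into \<open>U\<close>. The
  restriction to \<open>{0..1}\<close> supplies the value \<open>undefined\<close> that
  \<open>cmaps\<close> demands elsewhere.\<close>

lemma continuous_map_curry:
  assumes H: "continuous_map (prod_topology K unit_interval) C (\<lambda>(x, t). h x t)"
  shows "continuous_map K (compact_open unit_interval C) (\<lambda>x. restrict (h x) {0..1})"
  unfolding compact_open_def
proof (rule continuous_on_generated_topo)
  have "continuous_map unit_interval C (restrict (h x) {0..1})" if "x \<in> topspace K" for x
  proof -
    have "continuous_map unit_interval C ((\<lambda>(x, t). h x t) \<circ> (\<lambda>t. (x, t)))"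
      by (rule continuous_map_compose[OF _ H]) (use that in \<open>auto intro!: continuous_intros\<close>)
    then show ?thesis
      by (rule continuous_map_eq) auto
  qed
  then have cm: "restrict (h x) {0..1} \<in> cmaps unit_interval C" if "x \<in> topspace K" for x
    using that by (auto simp: cmaps_def)
  then show "(\<lambda>x. restrict (h x) {0..1}) ` topspace K \<subseteq> \<Union> ({cmaps unit_interval C} \<union>
      {{h \<in> cmaps unit_interval C. h ` K \<subseteq> U} |K U. compactin unit_interval K \<and> openin C U})"
    by auto
  fix W
  assume W: "W \<in> {cmaps unit_interval C} \<union>
      {{h \<in> cmaps unit_interval C. h ` K \<subseteq> U} |K U. compactin unit_interval K \<and> openin C U}"
  show "openin K ((\<lambda>x. restrict (h x) {0..1}) -` W \<inter> topspace K)"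
  proof (cases "W = cmaps unit_interval C")
    case True
    then have "(\<lambda>x. restrict (h x) {0..1}) -` W \<inter> topspace K = topspace K" using cm by auto
    then show ?thesis by simp
  next
    case False
    then obtain L U where L: "compactin unit_interval L" and U: "openin C U"
      and W: "W = {h \<in> cmaps unit_interval C. h ` L \<subseteq> U}" using W by blast
    have L01: "L \<subseteq> {0..1}" using compactin_subset_topspace[OF L] by simp
    define V where "V = {z \<in> topspace (prod_topology K unit_interval). (\<lambda>(x, t). h x t) z \<in> U}"
    have V: "openin (prod_topology K unit_interval) V"
      unfolding V_def using openin_continuous_map_preimage[OF H U] .
    show ?thesis
    proof (subst openin_subopen, intro ballI)
      fix x assume x: "x \<in> (\<lambda>x. restrict (h x) {0..1}) -` W \<inter> topspace K"
      have sub: "{x} \<times> L \<subseteq> V"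
      proof -
        have "restrict (h x) {0..1} t \<in> U" if "t \<in> L" for t using that x unfolding W by blast
        then have "h x t \<in> U" if "t \<in> L" for t using that L01 by (metis restrict_apply' subset_iff)
        then show ?thesis using L01 x unfolding V_def by auto
      qed
      have "compactin K {x}" using x by simp
      obtain A B where A: "openin K A" and AB: "{x} \<subseteq> A" "L \<subseteq> B" "A \<times> B \<subseteq> V"
        using Wallace_theorem_prod_topology[OF \<open>compactin K {x}\<close> L V sub] by metis
      have hA: "h x' t \<in> U" if "x' \<in> A" "t \<in> L" for x' t
      proof -
        have "(x', t) \<in> V" using AB that by blast
        then show ?thesis by (simp add: V_def)
      qed
      have "A \<subseteq> (\<lambda>x. restrict (h x) {0..1}) -` W \<inter> topspace K"
      proof
        fix x' assume x': "x' \<in> A"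
        then have "x' \<in> topspace K" using openin_subset[OF A] by blast
        moreover have "restrict (h x') {0..1} ` L \<subseteq> U" using hA[OF x'] L01 by auto
        ultimately show "x' \<in> (\<lambda>x. restrict (h x) {0..1}) -` W \<inter> topspace K"
          using cm unfolding W by blast
      qed
      then show "\<exists>T. openin K T \<and> x \<in> T \<and> T \<subseteq> (\<lambda>x. restrict (h x) {0..1}) -` W \<inter> topspace K"
        using A AB(1) by (intro exI[of _ A]) simp
    qed
  qed
qed

text \<open>The interval is locally compact: \<open>t\<close> has a compact neighbourhood
  \<open>L\<close> that \<open>g x\<close> maps into \<open>U\<close>, and the maps sending
  \<open>L\<close> into \<open>U\<close> form an open neighbourhood of \<open>g x\<close>.\<close>

lemma continuous_map_uncurry:
  assumes g: "continuous_map K (compact_open unit_interval C) g"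
  shows "continuous_map (prod_topology K unit_interval) C (\<lambda>(x, t). g x t)"
  unfolding continuous_map_def
proof (intro conjI allI impI)
  have cm: "g x \<in> cmaps unit_interval C" if "x \<in> topspace K" for x
    using continuous_map_funspace[OF g] that by auto
  then have cmx: "continuous_map unit_interval C (g x)" if "x \<in> topspace K" for x
    using that by (auto simp: cmaps_def)
  then show "(\<lambda>(x, t). g x t) \<in> topspace (prod_topology K unit_interval) \<rightarrow> topspace C"
    by (fastforce simp: continuous_map_def)
  fix U assume U: "openin C U"
  show "openin (prod_topology K unit_interval) {z \<in> topspace (prod_topology K unit_interval). (\<lambda>(x, t). g x t) z \<in> U}"
  proof (subst openin_subopen, clarify)
    fix x t assume xt: "(x, t) \<in> topspace (prod_topology K unit_interval)" "g x t \<in> U"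
    then have x: "x \<in> topspace K" and t: "t \<in> {0..1}" by auto
    have "openin (top_of_set {0..1}) {s \<in> {0..1}. g x s \<in> U}"
      using openin_continuous_map_preimage[OF cmx[OF x] U] by (simp add: unit_interval_def)
    then obtain e where e: "e > 0" "\<And>s. s \<in> {0..1} \<Longrightarrow> dist s t < e \<Longrightarrow> g x s \<in> U"
      using t xt(2) unfolding openin_euclidean_subtopology_iff by blast
    define L where "L = {0..1} \<inter> cball t (e/2)"
    have "compact L" unfolding L_def by (intro compact_Int) auto
    then have L: "compactin unit_interval L"
      unfolding unit_interval_def compactin_subtopology L_def by simp
    define B where "B = {0..1} \<inter> ball t (e/2)"
    have B: "openin unit_interval B"
      unfolding unit_interval_def B_def by (simp add: openin_open_Int)
    define W where "W = {h \<in> cmaps unit_interval C. h ` L \<subseteq> U}"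
    have "openin (compact_open unit_interval C) W"
      unfolding compact_open_def W_def
      by (rule topology_generated_by_Basis) (use L U in auto)
    then have A: "openin K {x \<in> topspace K. g x \<in> W}"
      using openin_continuous_map_preimage[OF g] by blast
    have "g x ` L \<subseteq> U" using e unfolding L_def by (force simp: dist_commute)
    then have xA: "x \<in> {x \<in> topspace K. g x \<in> W}" using x cm unfolding W_def by auto
    have "B \<subseteq> L" unfolding B_def L_def by auto
    then have "{x \<in> topspace K. g x \<in> W} \<times> B \<subseteq> {z \<in> topspace (prod_topology K unit_interval). (\<lambda>(x, t). g x t) z \<in> U}"
      unfolding W_def B_def by auto
    moreover have "(x, t) \<in> {x \<in> topspace K. g x \<in> W} \<times> B"
      using xA t e(1) unfolding B_def by auto
    ultimately show "\<exists>T. openin (prod_topology K unit_interval) T \<and> (x, t) \<in> T \<and>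
        T \<subseteq> {z \<in> topspace (prod_topology K unit_interval). (\<lambda>(x, t). g x t) z \<in> U}"
      using A B by (intro exI[of _ "{x \<in> topspace K. g x \<in> W} \<times> B"]) (simp add: openin_prod_Times_iff)
  qed
qed

lemma continuous_map_hpullback_iff:
  "continuous_map K (hpullback A B C p q) \<phi> \<longleftrightarrow>
     continuous_map K A (\<lambda>x. fst (\<phi> x)) \<and> continuous_map K B (\<lambda>x. fst (snd (\<phi> x))) \<and>
     continuous_map K (compact_open unit_interval C) (\<lambda>x. snd (snd (\<phi> x))) \<and>
     (\<forall>x\<in>topspace K. snd (snd (\<phi> x)) 0 = p (fst (\<phi> x)) \<and> snd (snd (\<phi> x)) 1 = q (fst (snd (\<phi> x))))"
  unfolding hpullback_def continuous_map_in_subtopology continuous_map_pairwise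
  by (auto simp: o_def image_subset_iff case_prod_unfold)

text \<open>The two maps and the homotopy that the definition asks for are recovered from the
  continuity of the single map into \<open>hpullback\<close>, the homotopy by uncurrying.\<close>

lemma is_homotopy_pullbackI:
  assumes w: "weak_homotopy_equivalence W (hpullback A B C p q) (\<lambda>x. (a x, b x, restrict (\<gamma> x) {0..1}))"
  shows "is_homotopy_pullback W A B C p q"
proof -
  have c: "continuous_map W A a" "continuous_map W B b"
    "continuous_map W (compact_open unit_interval C) (\<lambda>x. restrict (\<gamma> x) {0..1})"
    "\<forall>x\<in>topspace W. \<gamma> x 0 = p (a x) \<and> \<gamma> x 1 = q (b x)"
    using w unfolding weak_homotopy_equivalence_def continuous_map_hpullback_iff by auto
  have "continuous_map (prod_topology W unit_interval) C (\<lambda>(x, t). \<gamma> x t)"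
    by (rule continuous_map_eq[OF continuous_map_uncurry[OF c(3)]]) auto
  then show ?thesis
    unfolding is_homotopy_pullback_def
    using w c by (intro exI[of _ a] exI[of _ b] exI[of _ "\<lambda>(x, t). \<gamma> x t"]) auto
qed

section \<open>Homotopy invariance of the relative lifting problem\<close>

lemma disk_eq: "disk n = subtopology (powertop_real UNIV) {x. (\<forall>i\<ge>n. x i = 0) \<and> L2_set x {..<n} \<le> 1}"
proof -
  have "(\<Sum>i<n. (x i)\<^sup>2) \<le> 1 \<longleftrightarrow> L2_set x {..<n} \<le> 1" for x :: "nat \<Rightarrow> real"
    by (simp add: L2_set_def)
  then show ?thesis
    by (simp add: disk_def Euclidean_space_def subtopology_subtopology Collect_conj_eq)
qed

lemma topspace_disk: "topspace (disk n) = {x. (\<forall>i\<ge>n. x i = 0) \<and> L2_set x {..<n} \<le> 1}"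
  by (simp add: disk_eq)

lemma disk_boundary_eq: "disk_boundary n = {x \<in> topspace (disk n). L2_set x {..<n} = 1}"
proof -
  have "(\<Sum>i<n. (x i)\<^sup>2) = 1 \<longleftrightarrow> L2_set x {..<n} = 1" for x :: "nat \<Rightarrow> real"
    by (metis L2_set_def real_sqrt_eq_1_iff)
  then show ?thesis by (simp add: disk_boundary_def)
qed

lemma disk_boundary_subset: "disk_boundary n \<subseteq> topspace (disk n)"
  by (auto simp: disk_boundary_def)

lemma continuous_map_into_disk:
  "continuous_map K (disk n) h \<longleftrightarrow> (\<forall>i. continuous_map K euclideanreal (\<lambda>x. h x i)) \<and> h \<in> topspace K \<rightarrow> topspace (disk n)"
  unfolding disk_eq continuous_map_in_subtopology
  by (auto simp: continuous_map_componentwise_UNIV)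

lemma continuous_map_disk_coord: "continuous_map (disk n) euclideanreal (\<lambda>x. x i)"
  unfolding disk_eq by (intro continuous_map_powertop_coord)

lemma continuous_map_L2_set:
  fixes h :: "'a \<Rightarrow> nat \<Rightarrow> real"
  assumes "\<And>i. continuous_map K euclideanreal (\<lambda>x. h x i)"
  shows "continuous_map K euclideanreal (\<lambda>x. L2_set (h x) {..<n})"
proof -
  have "continuous_map K euclideanreal (\<lambda>x. \<Sum>i<n. (h x i)\<^sup>2)"
    by (intro continuous_map_sum continuous_map_real_pow assms finite_lessThan)
  from continuous_map_compose[OF this, of euclideanreal sqrt]
  show ?thesis
    by (simp add: o_def L2_set_def continuous_on_real_sqrt)
qed

lemma closedin_disk: "closedin (powertop_real UNIV) {x::nat \<Rightarrow> real. (\<forall>i\<ge>n. x i = 0) \<and> L2_set x {..<n} \<le> 1}"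
proof -
  have "closed {x::nat \<Rightarrow> real. x i = 0}" for i
    by (intro closed_Collect_eq continuous_intros continuous_on_product_coordinates)
  then have "closed (\<Inter>i\<in>{n..}. {x::nat \<Rightarrow> real. x i = 0})" by blast
  moreover have "closed {x::nat \<Rightarrow> real. L2_set x {..<n} \<le> 1}"
    unfolding L2_set_def
    by (intro closed_Collect_le continuous_intros continuous_on_product_coordinates)
  ultimately have "closed ((\<Inter>i\<in>{n..}. {x::nat \<Rightarrow> real. x i = 0}) \<inter> {x. L2_set x {..<n} \<le> 1})"
    by (rule closed_Int)
  moreover have "(\<Inter>i\<in>{n..}. {x::nat \<Rightarrow> real. x i = 0}) \<inter> {x. L2_set x {..<n} \<le> 1}
      = {x. (\<forall>i\<ge>n. x i = (0::real)) \<and> L2_set x {..<n} \<le> 1}" by auto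
  ultimately show ?thesis by (simp add: euclidean_product_topology)
qed

lemma compact_space_disk: "compact_space (disk n)"
proof -
  let ?B = "PiE UNIV (\<lambda>_::nat. {-1..1::real})"
  have "compactin (powertop_real UNIV) ?B"
    by (subst compactin_PiE) auto
  moreover have "{x. (\<forall>i\<ge>n. x i = 0) \<and> L2_set x {..<n} \<le> 1} \<subseteq> ?B"
  proof clarify
    fix x :: "nat \<Rightarrow> real" assume x: "\<forall>i\<ge>n. x i = 0" "L2_set x {..<n} \<le> 1"
    have "\<bar>x i\<bar> \<le> 1" for i
    proof (cases "i < n")
      case True
      then have "\<bar>x i\<bar> \<le> L2_set (\<lambda>i. \<bar>x i\<bar>) {..<n}"
        by (intro member_le_L2_set) auto
      then have "\<bar>x i\<bar> \<le> L2_set x {..<n}" by (simp add: L2_set_def)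
      then show ?thesis using x by linarith
    qed (use x in auto)
    then show "x \<in> ?B" by (auto simp: abs_le_iff minus_le_iff)
  qed
  ultimately show ?thesis
    unfolding disk_eq
    using closedin_disk closed_compactin compact_space_subtopology by blast
qed

lemma compact_space_disk_boundary: "compact_space (subtopology (disk n) (disk_boundary n))"
proof -
  have "closedin (disk n) {x \<in> topspace (disk n). L2_set x {..<n} \<in> {1}}"
    by (rule closedin_continuous_map_preimage[OF continuous_map_L2_set[OF continuous_map_disk_coord]]) auto
  then have "closedin (disk n) (disk_boundary n)" by (simp add: disk_boundary_eq)
  then show ?thesis
    using compact_space_disk closedin_compact_space compact_space_subtopology by blast
qed

lemma L2_set_scale: "L2_set (\<lambda>i. c * x i) A = \<bar>c\<bar> * L2_set x A"
  by (simp add: L2_set_def power_mult_distrib real_sqrt_mult flip: sum_distrib_left)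

lemma convex_disk:
  assumes "x \<in> topspace (disk n)" "y \<in> topspace (disk n)" "0 \<le> t" "t \<le> 1"
  shows "(\<lambda>i. (1 - t) * x i + t * y i) \<in> topspace (disk n)"
proof -
  have "L2_set (\<lambda>i. (1 - t) * x i + t * y i) {..<n} \<le> L2_set (\<lambda>i. (1 - t) * x i) {..<n} + L2_set (\<lambda>i. t * y i) {..<n}"
    by (rule L2_set_triangle_ineq)
  also have "\<dots> = (1 - t) * L2_set x {..<n} + t * L2_set y {..<n}"
    using assms by (simp add: L2_set_scale)
  also have "\<dots> \<le> (1 - t) * 1 + t * 1"
    using assms by (intro add_mono mult_left_mono) (auto simp: topspace_disk)
  finally show ?thesis using assms by (simp add: topspace_disk)
qed

text \<open>The old lift is shrunk to an inner ball and the homotopy \<open>G\<close> of the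
  boundary map is run on the collar. The image of the result is deformed by \<open>K\<close> inside
  and by \<open>\<Phi>\<close> on the collar; these fit together because \<open>\<Phi>\<close> is
  stationary for \<open>s = 0\<close>, and the boundary does not move because \<open>\<Phi>\<close>
  is stationary for \<open>s = 1\<close>. A straight line then leads from
  \<open>F (\<rho> x, \<sigma> x)\<close> to \<open>F (x, 1)\<close>.\<close>

lemma lift_transfer:
  defines "S \<equiv> \<lambda>n. subtopology (disk n) (disk_boundary n)"
  assumes \<phi>: "continuous_map W P \<phi>"
    and G: "continuous_map (prod_topology (S n) unit_interval) W G"
    and F: "continuous_map (prod_topology (disk n) unit_interval) P F"
    and \<Phi>: "continuous_map (prod_topology (prod_topology (S n) unit_interval) unit_interval) P \<Phi>"
    and \<Phi>0: "\<And>x s. x \<in> disk_boundary n \<Longrightarrow> s \<in> {0..1} \<Longrightarrow> \<Phi> ((x, s), 0) = \<phi> (G (x, s))"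
    and \<Phi>1: "\<And>x s. x \<in> disk_boundary n \<Longrightarrow> s \<in> {0..1} \<Longrightarrow> \<Phi> ((x, s), 1) = F (x, s)"
    and \<Phi>s0: "\<And>x r. x \<in> disk_boundary n \<Longrightarrow> r \<in> {0..1} \<Longrightarrow> \<Phi> ((x, 0), r) = F (x, 0)"
    and \<Phi>s1: "\<And>x r. x \<in> disk_boundary n \<Longrightarrow> r \<in> {0..1} \<Longrightarrow> \<Phi> ((x, 1), r) = F (x, 1)"
    and l0: "continuous_map (disk n) W l0" "\<And>x. x \<in> disk_boundary n \<Longrightarrow> l0 x = G (x, 0)"
      "homotopic_with (\<lambda>h. \<forall>x\<in>disk_boundary n. h x = F (x, 0)) (disk n) P (\<phi> \<circ> l0) (\<lambda>x. F (x, 0))"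
  shows "\<exists>l. continuous_map (disk n) W l \<and> (\<forall>x\<in>disk_boundary n. l x = G (x, 1)) \<and>
      homotopic_with (\<lambda>h. \<forall>x\<in>disk_boundary n. h x = F (x, 1)) (disk n) P (\<phi> \<circ> l) (\<lambda>x. F (x, 1))"
proof -
  obtain K where K: "continuous_map (prod_topology unit_interval (disk n)) P K"
    "\<And>x. K (0, x) = \<phi> (l0 x)" "\<And>x. K (1, x) = F (x, 0)"
    "\<And>t x. t \<in> {0..1} \<Longrightarrow> x \<in> disk_boundary n \<Longrightarrow> K (t, x) = F (x, 0)"
    using l0(3) unfolding homotopic_with_def unit_interval_def by auto
  define nrm where "nrm x = L2_set x {..<n}" for x :: "nat \<Rightarrow> real"
  \<comment> \<open>The ball of radius 1/2 is stretched onto the disk, the collar around it is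
    projected to the sphere, and \<open>\<sigma>\<close> grows from 0 to 1 across the collar. The
    lower bound 1/2 in the denominator also keeps \<open>\<rho>\<close> continuous at the
    centre.\<close>
  define \<rho> where "\<rho> x = (\<lambda>i. x i / max (1/2) (nrm x))" for x :: "nat \<Rightarrow> real"
  define \<sigma> where "\<sigma> x = max 0 (2 * nrm x - 1)" for x
  have nrm0: "nrm x \<ge> 0" for x by (simp add: nrm_def L2_set_nonneg)
  have nrm1: "nrm x \<le> 1" if "x \<in> topspace (disk n)" for x using that by (simp add: nrm_def topspace_disk)
  have bd: "x \<in> disk_boundary n \<longleftrightarrow> x \<in> topspace (disk n) \<and> nrm x = 1" for x
    by (auto simp: disk_boundary_eq nrm_def)
  have nrm\<rho>: "nrm (\<rho> x) = nrm x / max (1/2) (nrm x)" for x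
    using L2_set_scale[of "1 / max (1/2) (nrm x)" x "{..<n}"] by (simp add: nrm_def \<rho>_def)
  have \<rho>D: "\<rho> x \<in> topspace (disk n)" if "x \<in> topspace (disk n)" for x
  proof -
    have "nrm (\<rho> x) \<le> 1" unfolding nrm\<rho> by (simp add: divide_le_eq)
    then show ?thesis using that by (auto simp: topspace_disk nrm_def \<rho>_def)
  qed
  have \<rho>S: "\<rho> x \<in> disk_boundary n" if "x \<in> topspace (disk n)" "nrm x \<ge> 1/2" for x
    using \<rho>D[OF that(1)] that(2) unfolding bd nrm\<rho> by (auto simp: max_def)
  have \<sigma>I: "\<sigma> x \<in> {0..1}" if "x \<in> topspace (disk n)" for x
    using nrm1[OF that] by (auto simp: \<sigma>_def)
  have \<sigma>0: "\<sigma> x = 0" if "nrm x \<le> 1/2" for x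
    using that by (auto simp: \<sigma>_def max_def)
  have \<rho>1: "\<rho> x = x" "\<sigma> x = 1" if "x \<in> disk_boundary n" for x
    using that by (auto simp: \<rho>_def \<sigma>_def bd)
  have cnrm: "continuous_map (disk n) euclideanreal nrm"
    unfolding nrm_def by (intro continuous_map_L2_set continuous_map_disk_coord)
  have c\<rho>: "continuous_map (disk n) (disk n) \<rho>"
    unfolding continuous_map_into_disk \<rho>_def
  proof (intro conjI allI)
    fix i show "continuous_map (disk n) euclideanreal (\<lambda>x. x i / max (1/2) (nrm x))"
      by (intro continuous_map_real_divide continuous_map_real_max cnrm continuous_map_disk_coord) auto
    show "(\<lambda>x i. x i / max (1 / 2) (nrm x)) \<in> topspace (disk n) \<rightarrow> topspace (disk n)"
      using \<rho>D unfolding \<rho>_def by auto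
  qed
  have c\<sigma>: "continuous_map (disk n) unit_interval \<sigma>"
    unfolding unit_interval_def continuous_map_in_subtopology
  proof
    show "continuous_map (disk n) euclideanreal \<sigma>"
      unfolding \<sigma>_def by (intro continuous_map_real_max continuous_map_diff continuous_map_real_mult_left cnrm) auto
  qed (use \<sigma>I in auto)
  define l where "l x = (if nrm x \<le> 1/2 then l0 (\<rho> x) else G (\<rho> x, \<sigma> x))" for x
  have cl: "continuous_map (disk n) W l"
    unfolding l_def
  proof (rule continuous_map_cases_le)
    show "continuous_map (subtopology (disk n) {x \<in> topspace (disk n). nrm x \<le> 1 / 2}) W (\<lambda>x. l0 (\<rho> x))"
      using continuous_map_compose[OF c\<rho> l0(1)] by (auto simp: o_def intro: continuous_map_from_subtopology)
    show "continuous_map (subtopology (disk n) {x \<in> topspace (disk n). 1 / 2 \<le> nrm x}) W (\<lambda>x. G (\<rho> x, \<sigma> x))"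
    proof (rule continuous_map_compose[OF _ G, unfolded o_def])
      show "continuous_map (subtopology (disk n) {x \<in> topspace (disk n). 1 / 2 \<le> nrm x}) (prod_topology (S n) unit_interval) (\<lambda>x. (\<rho> x, \<sigma> x))"
        unfolding continuous_map_pairwise S_def continuous_map_in_subtopology
        using c\<rho> c\<sigma> \<rho>S by (auto simp: o_def intro: continuous_map_from_subtopology)
    qed
    show "l0 (\<rho> x) = G (\<rho> x, \<sigma> x)" if "x \<in> topspace (disk n)" "nrm x = 1/2" for x
      using that \<rho>S[of x] l0(2) \<sigma>0 by simp
  qed (use cnrm in auto)
  let ?Q = "\<lambda>h. \<forall>x\<in>disk_boundary n. h x = F (x, 1)"
  have resp: "?Q h = ?Q k" if "\<And>x. x \<in> topspace (disk n) \<Longrightarrow> h x = k x" for h k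
    using that disk_boundary_subset by (metis subsetD)
  have hw: "homotopic_with ?Q (disk n) P p q \<longleftrightarrow>
      (\<exists>h. continuous_map (prod_topology unit_interval (disk n)) P h \<and> (\<forall>x\<in>topspace (disk n). h (0, x) = p x) \<and>
        (\<forall>x\<in>topspace (disk n). h (1, x) = q x) \<and> (\<forall>t\<in>{0..1}. \<forall>x\<in>disk_boundary n. h (t, x) = F (x, 1)))" for p q
    unfolding unit_interval_def by (rule homotopic_with) (use resp in blast)
  define E where "E z = (if nrm (snd z) \<le> 1/2 then K (fst z, \<rho> (snd z)) else \<Phi> ((\<rho> (snd z), \<sigma> (snd z)), fst z))" for z
  let ?ID = "prod_topology unit_interval (disk n)"
  have c\<rho>': "continuous_map ?ID (disk n) (\<lambda>z. \<rho> (snd z))"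
    using continuous_map_compose[OF continuous_map_snd c\<rho>] by (simp add: o_def)
  have c\<sigma>': "continuous_map ?ID unit_interval (\<lambda>z. \<sigma> (snd z))"
    using continuous_map_compose[OF continuous_map_snd c\<sigma>] by (simp add: o_def)
  have cnrm': "continuous_map ?ID euclideanreal (\<lambda>z. nrm (snd z))"
    using continuous_map_compose[OF continuous_map_snd cnrm] by (simp add: o_def)
  have cE: "continuous_map ?ID P E"
    unfolding E_def
  proof (rule continuous_map_cases_le)
    show "continuous_map (subtopology ?ID {x \<in> topspace ?ID. nrm (snd x) \<le> 1 / 2}) P (\<lambda>z. K (fst z, \<rho> (snd z)))"
    proof (rule continuous_map_compose[OF _ K(1), unfolded o_def])
      show "continuous_map (subtopology ?ID {x \<in> topspace ?ID. nrm (snd x) \<le> 1 / 2}) ?ID (\<lambda>z. (fst z, \<rho> (snd z)))"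
        unfolding continuous_map_pairwise using c\<rho>' continuous_map_fst
        by (auto simp: o_def intro: continuous_map_from_subtopology)
    qed
    show "continuous_map (subtopology ?ID {x \<in> topspace ?ID. 1 / 2 \<le> nrm (snd x)}) P (\<lambda>z. \<Phi> ((\<rho> (snd z), \<sigma> (snd z)), fst z))"
    proof (rule continuous_map_compose[OF _ \<Phi>, unfolded o_def])
      show "continuous_map (subtopology ?ID {x \<in> topspace ?ID. 1 / 2 \<le> nrm (snd x)}) (prod_topology (prod_topology (S n) unit_interval) unit_interval)
           (\<lambda>z. ((\<rho> (snd z), \<sigma> (snd z)), fst z))"
        unfolding continuous_map_pairwise S_def continuous_map_in_subtopology
        using c\<rho>' c\<sigma>' \<rho>S continuous_map_fst by (auto simp: o_def intro: continuous_map_from_subtopology)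
    qed
    show "K (fst z, \<rho> (snd z)) = \<Phi> ((\<rho> (snd z), \<sigma> (snd z)), fst z)" if "z \<in> topspace ?ID" "nrm (snd z) = 1/2" for z
      using that \<rho>S[of "snd z"] K(4)[of "fst z" "\<rho> (snd z)"] \<Phi>s0[of "\<rho> (snd z)" "fst z"] \<sigma>0[of "snd z"] by auto
  qed (use cnrm' in auto)
  have h1: "homotopic_with ?Q (disk n) P (\<phi> \<circ> l) (\<lambda>x. F (\<rho> x, \<sigma> x))"
    unfolding hw
  proof (intro exI[of _ E] conjI cE ballI)
    fix x assume x: "x \<in> topspace (disk n)"
    show "E (0, x) = (\<phi> \<circ> l) x"
      using x \<rho>S[of x] \<sigma>I[OF x] by (auto simp: E_def l_def K(2) \<Phi>0)
    show "E (1, x) = F (\<rho> x, \<sigma> x)"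
      using x \<rho>S[of x] \<sigma>I[OF x] \<sigma>0[of x] by (auto simp: E_def K(3) \<Phi>1)
  next
    fix t :: real and x assume t: "t \<in> {0..1}" and x: "x \<in> disk_boundary n"
    then show "E (t, x) = F (x, 1)"
      using \<rho>1[OF x] \<Phi>s1[OF x t] by (auto simp: E_def bd)
  qed
  \<comment> \<open>Both arguments of \<open>F\<close> move linearly, which convexity of the disk
    permits. On the sphere \<open>\<rho> x = x\<close> and \<open>\<sigma> x = 1\<close>, so nothing
    moves there.\<close>
  define E' where "E' z = F ((\<lambda>i. (1 - fst z) * \<rho> (snd z) i + fst z * snd z i), (1 - fst z) * \<sigma> (snd z) + fst z)" for z
  have cf: "continuous_map ?ID euclideanreal fst"
    unfolding unit_interval_def using continuous_map_fst continuous_map_into_fulltopology by blast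
  have cE': "continuous_map ?ID P E'"
    unfolding E'_def
  proof (rule continuous_map_compose[OF _ F, unfolded o_def])
    have "continuous_map ?ID (disk n) (\<lambda>z i. (1 - fst z) * \<rho> (snd z) i + fst z * snd z i)"
      unfolding continuous_map_into_disk
    proof (intro conjI allI)
      fix i
      have 1: "continuous_map ?ID euclideanreal (\<lambda>z. \<rho> (snd z) i)"
        using c\<rho>' by (simp add: continuous_map_into_disk)
      have 2: "continuous_map ?ID euclideanreal (\<lambda>z. snd z i)"
        using continuous_map_compose[OF continuous_map_snd continuous_map_disk_coord] by (simp add: o_def)
      show "continuous_map ?ID euclideanreal (\<lambda>z. (1 - fst z) * \<rho> (snd z) i + fst z * snd z i)"
        by (intro continuous_map_add continuous_map_real_mult continuous_map_diff 1 2 cf) auto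
    qed (auto intro!: convex_disk \<rho>D)
    moreover have "continuous_map ?ID unit_interval (\<lambda>z. (1 - fst z) * \<sigma> (snd z) + fst z)"
      unfolding unit_interval_def continuous_map_in_subtopology
    proof
      have "continuous_map ?ID euclideanreal (\<lambda>z. \<sigma> (snd z))"
        using c\<sigma>' unfolding unit_interval_def by (rule continuous_map_into_fulltopology)
      then show "continuous_map (prod_topology (top_of_set {0..1}) (disk n)) euclideanreal (\<lambda>z. (1 - fst z) * \<sigma> (snd z) + fst z)"
        using cf unfolding unit_interval_def
        by (intro continuous_map_add continuous_map_real_mult continuous_map_diff) auto
      have "(1 - t) * s + t \<in> {0..1}" if "t \<in> {0..1}" "s \<in> {0..1}" for t s :: real
        using that convex_bound_le[of s 1 1 "1 - t" t] by auto
      then show "(\<lambda>z. (1 - fst z) * \<sigma> (snd z) + fst z) \<in> topspace (prod_topology (top_of_set {0..1}) (disk n)) \<rightarrow> {0..1}"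
        using \<sigma>I by auto
    qed
    ultimately show "continuous_map ?ID (prod_topology (disk n) unit_interval)
        (\<lambda>z. (\<lambda>i. (1 - fst z) * \<rho> (snd z) i + fst z * snd z i, (1 - fst z) * \<sigma> (snd z) + fst z))"
      unfolding continuous_map_pairwise by (simp add: o_def)
  qed
  have h2: "homotopic_with ?Q (disk n) P (\<lambda>x. F (\<rho> x, \<sigma> x)) (\<lambda>x. F (x, 1))"
    unfolding hw
  proof (intro exI[of _ E'] conjI cE' ballI)
    fix t :: real and x assume t: "t \<in> {0..1}" and x: "x \<in> disk_boundary n"
    have "(\<lambda>i. (1 - t) * x i + t * x i) = x" by (auto simp: algebra_simps)
    then show "E' (t, x) = F (x, 1)"
      using \<rho>1[OF x] by (simp add: E'_def)
  qed (auto simp: E'_def)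
  show ?thesis
    using cl h1 h2 \<rho>1 by (intro exI[of _ l]) (auto simp: l_def bd intro: homotopic_with_trans)
qed

section \<open>Points of a realization as fuzzy sets\<close>

text \<open>The set of value 1 is the smallest member of the supporting chain and the support is the
  largest. In a convex family membership of these two forces membership of all level sets between
  them.\<close>

definition fuzzy :: "'v set set \<Rightarrow> ('v \<Rightarrow> real) set" where
  "fuzzy S = {l. (\<forall>v. 0 \<le> l v \<and> l v \<le> 1) \<and> {v. l v = 1} \<in> S \<and> {v. l v \<noteq> 0} \<in> S}"

text \<open>The inserted 0 is the lower end of the range of levels; it also keeps the maximum
  meaningful when \<open>A\<close> is everything. The outer \<open>max 0\<close> gives weight 0 to
  sets that are not level sets.\<close>

definition gap :: "('v \<Rightarrow> real) \<Rightarrow> 'v set \<Rightarrow> real" where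
  "gap l A = max 0 (Min (l ` A) - Max (insert 0 (l ` (- A))))"

text \<open>The common finite support is part of the notion because it is what makes continuity of
  the single weights equivalent, over a compact parameter space, to continuity into the weak
  topology.\<close>

definition fuzzy_map :: "'k topology \<Rightarrow> 'v set set \<Rightarrow> ('k \<Rightarrow> 'v \<Rightarrow> real) \<Rightarrow> bool" where
  "fuzzy_map K S F \<longleftrightarrow> (\<forall>x\<in>topspace K. F x \<in> fuzzy S) \<and>
     (\<exists>V. finite V \<and> (\<forall>x\<in>topspace K. {v. F x v \<noteq> 0} \<subseteq> V)) \<and>
     (\<forall>v. continuous_map K euclideanreal (\<lambda>x. F x v))"

lemma fuzzyD:
  assumes "l \<in> fuzzy S"
  shows "0 \<le> l v" "l v \<le> 1" "{v. l v = 1} \<in> S" "{v. l v \<noteq> 0} \<in> S"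
  using assms by (auto simp: fuzzy_def)

lemma continuous_map_Max:
  assumes "finite A" "A \<noteq> {}" "\<And>a. a \<in> A \<Longrightarrow> continuous_map K euclideanreal (\<lambda>x. f a x)"
  shows "continuous_map K euclideanreal (\<lambda>x. Max ((\<lambda>a. f a x) ` A))"
  using assms by (induction rule: finite_ne_induct) (auto intro!: continuous_map_real_max)

lemma continuous_map_Min:
  assumes "finite A" "A \<noteq> {}" "\<And>a. a \<in> A \<Longrightarrow> continuous_map K euclideanreal (\<lambda>x. f a x)"
  shows "continuous_map K euclideanreal (\<lambda>x. Min ((\<lambda>a. f a x) ` A))"
  using assms by (induction rule: finite_ne_induct) (auto intro!: continuous_map_real_min)

lemma continuous_map_Max_insert:
  assumes "finite A" "\<And>a. a \<in> A \<Longrightarrow> continuous_map K euclideanreal (\<lambda>x. f a x)"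
  shows "continuous_map K euclideanreal (\<lambda>x. Max (insert 0 ((\<lambda>a. f a x) ` A)))"
proof (cases "A = {}")
  case False
  then have "Max (insert 0 ((\<lambda>a. f a x) ` A)) = max 0 (Max ((\<lambda>a. f a x) ` A))" for x
    using assms(1) by simp
  then show ?thesis
    using continuous_map_Max[of A K f] assms False by (simp add: continuous_map_real_max)
qed simp

lemma finite_image_of_support:
  assumes "finite {v. l v \<noteq> (0::real)}"
  shows "finite (l ` A)"
proof -
  have "l ` A \<subseteq> insert 0 (l ` {v. l v \<noteq> 0})" by auto
  then show ?thesis using assms finite_subset by blast
qed

lemma nonempty_if_sum_nonzero: "sum f A \<noteq> 0 \<Longrightarrow> \<exists>a. a \<in> A"
  by (cases "A = {}") auto

text \<open>The encoding \<open>e\<close> lets cliques and pairs be treated alike: it is the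
  identity for cliques and the union of the two parts for pairs. Convexity is what puts the
  intermediate level sets into the poset.\<close>

locale set_poset =
  fixes P :: "'p set" and le :: "'p \<Rightarrow> 'p \<Rightarrow> bool" and e :: "'p \<Rightarrow> 'v set"
  assumes inj: "inj_on e P"
    and le_iff: "p \<in> P \<Longrightarrow> q \<in> P \<Longrightarrow> le p q \<longleftrightarrow> e p \<subseteq> e q"
    and finite_e: "p \<in> P \<Longrightarrow> finite (e p)"
    and e_nonempty: "p \<in> P \<Longrightarrow> e p \<noteq> {}"
    and convex: "A \<in> e ` P \<Longrightarrow> C \<in> e ` P \<Longrightarrow> A \<subseteq> B \<Longrightarrow> B \<subseteq> C \<Longrightarrow> B \<in> e ` P"
begin

definition coord :: "('p \<Rightarrow> real) \<Rightarrow> 'v \<Rightarrow> real" where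
  "coord \<alpha> v = (\<Sum>p\<in>{p. \<alpha> p \<noteq> 0 \<and> v \<in> e p}. \<alpha> p)"

definition uncoord :: "('v \<Rightarrow> real) \<Rightarrow> 'p \<Rightarrow> real" where
  "uncoord l p = (if p \<in> P then gap l (e p) else 0)"

lemma fuzzy_finite_support: "l \<in> fuzzy (e ` P) \<Longrightarrow> finite {v. l v \<noteq> 0}"
  using fuzzyD(4) finite_e by fastforce

lemma level_in:
  assumes "l \<in> fuzzy (e ` P)" "0 < t" "t \<le> 1"
  shows "{v. t \<le> l v} \<in> e ` P"
proof (rule convex[OF fuzzyD(3,4)[OF assms(1)]])
  show "{v. l v = 1} \<subseteq> {v. t \<le> l v}" "{v. t \<le> l v} \<subseteq> {v. l v \<noteq> 0}"
    using assms by auto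
qed

text \<open>The gap of a set is the length of the interval of those levels at which it is cut out.\<close>

lemma gap_interval:
  assumes l: "l \<in> fuzzy (e ` P)" and p: "p \<in> P"
  shows "{t. 0 < t \<and> t \<le> 1 \<and> {v. t \<le> l v} = e p} = {Max (insert 0 (l ` (- e p)))<..Min (l ` e p)}"
    "uncoord l p = measure lborel {t. 0 < t \<and> t \<le> 1 \<and> {v. t \<le> l v} = e p}"
proof -
  have fi: "finite (l ` A)" for A
    using finite_image_of_support[OF fuzzy_finite_support[OF l]] .
  obtain w where w: "w \<in> e p" using e_nonempty[OF p] by auto
  have "0 < t \<and> t \<le> 1 \<and> {v. t \<le> l v} = e p \<longleftrightarrow>
      Max (insert 0 (l ` (- e p))) < t \<and> t \<le> Min (l ` e p)" for t
  proof -
    have "Max (insert 0 (l ` (- e p))) < t \<longleftrightarrow> 0 < t \<and> (\<forall>v. v \<notin> e p \<longrightarrow> l v < t)"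
      using fi by (subst Max_less_iff) auto
    moreover have "t \<le> Min (l ` e p) \<longleftrightarrow> (\<forall>v\<in>e p. t \<le> l v)"
      using fi w by (subst Min_ge_iff) auto
    moreover have "t \<le> 1" if "\<forall>v\<in>e p. t \<le> l v" using that w fuzzyD(2)[OF l, of w] by force
    ultimately show ?thesis by (auto simp: not_le[symmetric])
  qed
  then show eq: "{t. 0 < t \<and> t \<le> 1 \<and> {v. t \<le> l v} = e p} = {Max (insert 0 (l ` (- e p)))<..Min (l ` e p)}"
    by auto
  have "measure lborel {a<..b} = max 0 (b - a)" for a b :: real
    by (cases "a \<le> b") (auto simp: measure_lborel_Ioc)
  then show "uncoord l p = measure lborel {t. 0 < t \<and> t \<le> 1 \<and> {v. t \<le> l v} = e p}"
    using p by (simp add: eq uncoord_def gap_def)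
qed

lemma uncoord_neq_0:
  assumes "l \<in> fuzzy (e ` P)" "uncoord l p \<noteq> 0"
  shows "p \<in> P" "\<exists>t. 0 < t \<and> t \<le> 1 \<and> {v. t \<le> l v} = e p"
proof -
  show "p \<in> P" using assms(2) by (auto simp: uncoord_def split: if_splits)
  then have "measure lborel {t. 0 < t \<and> t \<le> 1 \<and> {v. t \<le> l v} = e p} \<noteq> 0"
    using assms gap_interval(2)[OF assms(1), of p] by simp
  then have "{t. 0 < t \<and> t \<le> 1 \<and> {v. t \<le> l v} = e p} \<noteq> {}" by force
  then show "\<exists>t. 0 < t \<and> t \<le> 1 \<and> {v. t \<le> l v} = e p" by blast
qed

text \<open>The half-open intervals of levels that belong to distinct sets are disjoint and exhaust
  \<open>{0<..c}\<close>, so additivity of Lebesgue measure gives the sum without ordering the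
  chain. \<open>Q\<close> true and \<open>c = 1\<close> give the total weight; membership of
  \<open>v\<close> and \<open>c = l v\<close> give \<open>coord_uncoord\<close>.\<close>

lemma sum_uncoord:
  assumes l: "l \<in> fuzzy (e ` P)" and v: "0 \<le> c" "c \<le> 1"
    and Q: "\<And>p t. p \<in> P \<Longrightarrow> 0 < t \<Longrightarrow> t \<le> 1 \<Longrightarrow> e p = {v. t \<le> l v} \<Longrightarrow> Q p \<longleftrightarrow> t \<le> c"
  shows "finite {p. uncoord l p \<noteq> 0}" "(\<Sum>p\<in>{p. uncoord l p \<noteq> 0 \<and> Q p}. uncoord l p) = c"
proof -
  let ?T = "\<lambda>p. {t. 0 < t \<and> t \<le> 1 \<and> {v. t \<le> l v} = e p}"
  have sub: "e ` {p. uncoord l p \<noteq> 0} \<subseteq> Pow {v. l v \<noteq> 0}"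
  proof clarify
    fix p v assume "uncoord l p \<noteq> 0" "v \<in> e p" "l v = 0"
    then obtain t where "0 < t" "{v. t \<le> l v} = e p" using uncoord_neq_0[OF l] by blast
    then have "t \<le> l v" using \<open>v \<in> e p\<close> by blast
    then show False using \<open>0 < t\<close> \<open>l v = 0\<close> by simp
  qed
  moreover have "inj_on e {p. uncoord l p \<noteq> 0}"
    using inj uncoord_neq_0(1)[OF l] by (auto simp: inj_on_def)
  ultimately show fin: "finite {p. uncoord l p \<noteq> 0}"
    using fuzzy_finite_support[OF l] by (meson finite_Pow_iff finite_imageD finite_subset)
  let ?C = "{p \<in> P. e p \<in> Pow {v. l v \<noteq> 0} \<and> Q p}"
  have "finite (e ` ?C)"
    using fuzzy_finite_support[OF l] by (auto intro: finite_subset[of _ "Pow {v. l v \<noteq> 0}"])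
  then have finC: "finite ?C"
    using inj by (metis (no_types, lifting) finite_imageD inj_on_subset mem_Collect_eq subsetI)
  have "(\<Sum>p\<in>{p. uncoord l p \<noteq> 0 \<and> Q p}. uncoord l p) = (\<Sum>p\<in>?C. uncoord l p)"
    using finC sub uncoord_neq_0(1)[OF l] by (intro sum.mono_neutral_left) auto
  also have "\<dots> = (\<Sum>p\<in>?C. measure lborel (?T p))"
    using gap_interval(2)[OF l] by (intro sum.cong) auto
  also have "\<dots> = measure lborel (\<Union>p\<in>?C. ?T p)"
  proof (rule measure_finite_Union[symmetric, OF finC])
    show "?T ` ?C \<subseteq> sets lborel" using gap_interval(1)[OF l] by auto
    show "disjoint_family_on ?T ?C"
      unfolding disjoint_family_on_def disjoint_iff using inj_onD[OF inj] by fastforce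
    show "emeasure lborel (?T p) \<noteq> \<infinity>" if "p \<in> ?C" for p
    proof -
      have fin: "emeasure lborel {a<..b} \<noteq> \<infinity>" for a b :: real by (cases "a \<le> b") auto
      have "p \<in> P" using that by simp
      show ?thesis unfolding gap_interval(1)[OF l \<open>p \<in> P\<close>] by (rule fin)
    qed
  qed
  also have "(\<Union>p\<in>?C. ?T p) = {0<..c}"
  proof (intro set_eqI iffI)
    fix t assume "t \<in> {0<..c}"
    then have t: "0 < t" "t \<le> c" "t \<le> 1" using v by auto
    then obtain p where "p \<in> P" "e p = {v. t \<le> l v}" using level_in[OF l] by (metis imageE)
    then show "t \<in> (\<Union>p\<in>?C. ?T p)" using t Q by auto
  next
    fix t assume "t \<in> (\<Union>p\<in>?C. ?T p)"
    then show "t \<in> {0<..c}" using Q by auto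
  qed
  finally show "(\<Sum>p\<in>{p. uncoord l p \<noteq> 0 \<and> Q p}. uncoord l p) = c" using v by simp
qed

lemma uncoord_in:
  assumes l: "l \<in> fuzzy (e ` P)"
  shows "uncoord l \<in> realization_points P le"
proof -
  have "chain_in P le {p. uncoord l p \<noteq> 0}"
    unfolding chain_in_def
  proof (intro conjI ballI)
    fix p q assume "p \<in> {p. uncoord l p \<noteq> 0}" "q \<in> {p. uncoord l p \<noteq> 0}"
    then have pq: "uncoord l p \<noteq> 0" "uncoord l q \<noteq> 0" by simp_all
    obtain s t where "{v. s \<le> l v} = e p" "{v. t \<le> l v} = e q"
      using uncoord_neq_0(2)[OF l pq(1)] uncoord_neq_0(2)[OF l pq(2)] by metis
    moreover note uncoord_neq_0(1)[OF l pq(1)] uncoord_neq_0(1)[OF l pq(2)]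
    moreover have "{v. s \<le> l v} \<subseteq> {v. t \<le> l v} \<or> {v. t \<le> l v} \<subseteq> {v. s \<le> l v}"
      by (cases "s \<le> t") auto
    ultimately show "le p q \<or> le q p" using le_iff by simp
  qed (use uncoord_neq_0(1)[OF l] in auto)
  moreover have "0 \<le> uncoord l p" for p by (simp add: uncoord_def gap_def)
  moreover note sum_uncoord[OF l, of 1 "\<lambda>_. True"]
  ultimately show ?thesis by (simp add: realization_points_def)
qed

lemma coord_uncoord:
  assumes l: "l \<in> fuzzy (e ` P)"
  shows "coord (uncoord l) = l"
proof
  fix v show "coord (uncoord l) v = l v"
    unfolding coord_def using fuzzyD(1,2)[OF l] by (intro sum_uncoord(2)[OF l]) auto
qed

lemma realization_pointsD:
  assumes "\<alpha> \<in> realization_points P le"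
  shows "0 \<le> \<alpha> p" "\<alpha> p \<noteq> 0 \<Longrightarrow> p \<in> P" "finite {p. \<alpha> p \<noteq> 0}"
    "\<alpha> p \<noteq> 0 \<Longrightarrow> \<alpha> q \<noteq> 0 \<Longrightarrow> e p \<subseteq> e q \<or> e q \<subseteq> e p" "(\<Sum>p\<in>{p. \<alpha> p \<noteq> 0}. \<alpha> p) = 1"
proof -
  have \<alpha>: "\<forall>p. 0 \<le> \<alpha> p" "finite {p. \<alpha> p \<noteq> 0}" "{p. \<alpha> p \<noteq> 0} \<subseteq> P"
    "\<forall>x\<in>{p. \<alpha> p \<noteq> 0}. \<forall>y\<in>{p. \<alpha> p \<noteq> 0}. le x y \<or> le y x" "(\<Sum>p\<in>{p. \<alpha> p \<noteq> 0}. \<alpha> p) = 1"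
    using assms unfolding realization_points_def chain_in_def by blast+
  then show "0 \<le> \<alpha> p" "\<alpha> p \<noteq> 0 \<Longrightarrow> p \<in> P" "finite {p. \<alpha> p \<noteq> 0}" "(\<Sum>p\<in>{p. \<alpha> p \<noteq> 0}. \<alpha> p) = 1"
    by blast+
  assume "\<alpha> p \<noteq> 0" "\<alpha> q \<noteq> 0"
  then have "p \<in> P" "q \<in> P" "le p q \<or> le q p" using \<alpha>(3,4) by auto
  then show "e p \<subseteq> e q \<or> e q \<subseteq> e p" by (simp add: le_iff)
qed

lemma realization_chain_extremes:
  assumes \<alpha>: "\<alpha> \<in> realization_points P le"
  obtains m M where "\<alpha> m \<noteq> 0" "\<alpha> M \<noteq> 0" "\<And>p. \<alpha> p \<noteq> 0 \<Longrightarrow> e m \<subseteq> e p \<and> e p \<subseteq> e M"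
proof -
  note a = realization_pointsD[OF \<alpha>]
  have ne: "{p. \<alpha> p \<noteq> 0} \<noteq> {}" using realization_points_support(2)[OF \<alpha>] .
  have fin: "finite (e ` {p. \<alpha> p \<noteq> 0})" "e ` {p. \<alpha> p \<noteq> 0} \<noteq> {}" using a(3) ne by auto
  define E where "E = e ` {p. \<alpha> p \<noteq> 0}"
  have E: "finite E" "E \<noteq> {}" using fin by (simp_all add: E_def)
  obtain A where A: "A \<in> E" "\<forall>b\<in>E. b \<subseteq> A \<longrightarrow> A = b"
    using finite_has_minimal[OF E] by blast
  obtain B where B: "B \<in> E" "\<forall>b\<in>E. B \<subseteq> b \<longrightarrow> B = b"
    using finite_has_maximal[OF E] by blast
  obtain m where m: "A = e m" "\<alpha> m \<noteq> 0" using A(1) unfolding E_def by blast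
  obtain M where M: "B = e M" "\<alpha> M \<noteq> 0" using B(1) unfolding E_def by blast
  have "e m \<subseteq> e p \<and> e p \<subseteq> e M" if p: "\<alpha> p \<noteq> 0" for p
  proof -
    have "e p \<in> E" using p by (simp add: E_def)
    then have "e p \<subseteq> e m \<longrightarrow> e m = e p" "e M \<subseteq> e p \<longrightarrow> e M = e p" using A(2) B(2) m M by auto
    then show ?thesis using a(4)[OF p m(2)] a(4)[OF p M(2)] by auto
  qed
  then show ?thesis using that m M by blast
qed

lemma coord_in:
  assumes \<alpha>: "\<alpha> \<in> realization_points P le"
  shows "coord \<alpha> \<in> fuzzy (e ` P)"
proof -
  note a = realization_pointsD[OF \<alpha>]
  obtain m M where m: "\<alpha> m \<noteq> 0" "\<alpha> M \<noteq> 0" "\<And>p. \<alpha> p \<noteq> 0 \<Longrightarrow> e m \<subseteq> e p \<and> e p \<subseteq> e M"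
    using realization_chain_extremes[OF \<alpha>] by metis
  have c0: "0 \<le> coord \<alpha> v" for v unfolding coord_def using a by (intro sum_nonneg) auto
  have c1: "coord \<alpha> v \<le> 1" for v
    unfolding a(5)[symmetric] coord_def using a by (intro sum_mono2) auto
  have one: "{v. coord \<alpha> v = 1} = e m"
  proof (intro set_eqI iffI)
    fix v assume "v \<in> e m"
    then have "{p. \<alpha> p \<noteq> 0 \<and> v \<in> e p} = {p. \<alpha> p \<noteq> 0}" using m(3) by blast
    then show "v \<in> {v. coord \<alpha> v = 1}" using a(5) by (simp add: coord_def)
  next
    fix v assume v: "v \<in> {v. coord \<alpha> v = 1}"
    show "v \<in> e m"
    proof (rule ccontr)
      assume "v \<notin> e m"
      then have "coord \<alpha> v \<le> (\<Sum>p\<in>{p. \<alpha> p \<noteq> 0} - {m}. \<alpha> p)"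
        unfolding coord_def using a by (intro sum_mono2) auto
      also have "\<dots> = 1 - \<alpha> m" using a m by (simp add: sum_diff1)
      finally show False using v m(1) a(1)[of m] by simp
    qed
  qed
  have supp: "{v. coord \<alpha> v \<noteq> 0} = e M"
  proof (intro set_eqI iffI)
    fix v assume "v \<in> e M"
    then have "\<alpha> M \<le> coord \<alpha> v"
      unfolding coord_def using a m(2) by (intro member_le_sum) auto
    then show "v \<in> {v. coord \<alpha> v \<noteq> 0}" using m(2) a(1)[of M] by auto
  next
    fix v assume "v \<in> {v. coord \<alpha> v \<noteq> 0}"
    then have "(\<Sum>p\<in>{p. \<alpha> p \<noteq> 0 \<and> v \<in> e p}. \<alpha> p) \<noteq> 0" by (simp add: coord_def)
    from nonempty_if_sum_nonzero[OF this] obtain p where "\<alpha> p \<noteq> 0" "v \<in> e p" by blast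
    then show "v \<in> e M" using m(3) by blast
  qed
  show ?thesis unfolding fuzzy_def using c0 c1 m a(2) by (auto simp: one supp)
qed

text \<open>One inequality suffices, since both sides have total weight 1. It holds because passing
  from a point outside \<open>e p\<close> to one inside gains at least the summand
  \<open>\<alpha> p\<close>.\<close>

lemma uncoord_coord:
  assumes \<alpha>: "\<alpha> \<in> realization_points P le"
  shows "uncoord (coord \<alpha>) = \<alpha>"
proof -
  note a = realization_pointsD[OF \<alpha>]
  note l = coord_in[OF \<alpha>]
  note b = realization_pointsD[OF uncoord_in[OF l]]
  have fi: "finite (coord \<alpha> ` A)" for A
    using finite_image_of_support[OF fuzzy_finite_support[OF l]] .
  have ge: "\<alpha> p \<le> uncoord (coord \<alpha>) p" for p
  proof (cases "\<alpha> p = 0")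
    case False
    then have p: "p \<in> P" using a by blast
    \<comment> \<open>A member of the chain that contains \<open>w\<close> is not included in
      \<open>e p\<close>, hence includes \<open>e p\<close> and contains \<open>v\<close>.\<close>
    have step: "\<alpha> p + coord \<alpha> w \<le> coord \<alpha> v" if "v \<in> e p" "w \<notin> e p" for v w
    proof -
      have "\<alpha> p + coord \<alpha> w = (\<Sum>q\<in>insert p {q. \<alpha> q \<noteq> 0 \<and> w \<in> e q}. \<alpha> q)"
        unfolding coord_def using that a(3) by (subst sum.insert) auto
      also have "\<dots> \<le> coord \<alpha> v"
        unfolding coord_def using that a(1,3) a(4)[OF False] False by (intro sum_mono2) auto
      finally show ?thesis .
    qed
    have low: "\<alpha> p \<le> coord \<alpha> v" if "v \<in> e p" for v
      unfolding coord_def using that a False by (intro member_le_sum) auto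
    have "Min (coord \<alpha> ` e p) \<in> coord \<alpha> ` e p" "Max (insert 0 (coord \<alpha> ` (- e p))) \<in> insert 0 (coord \<alpha> ` (- e p))"
      using fi e_nonempty[OF p] by (intro Min_in Max_in; simp)+
    then have "\<alpha> p + Max (insert 0 (coord \<alpha> ` (- e p))) \<le> Min (coord \<alpha> ` e p)"
      using step low by (elim imageE insertE; simp)
    then show ?thesis using p by (simp add: uncoord_def gap_def)
  qed (use b in auto)
  define A where "A = {p. \<alpha> p \<noteq> 0} \<union> {p. uncoord (coord \<alpha>) p \<noteq> 0}"
  define h where "h p = uncoord (coord \<alpha>) p - \<alpha> p" for p
  have fin: "finite A" using a b by (simp add: A_def)
  have "(\<Sum>p\<in>A. \<alpha> p) = 1"
    unfolding a(5)[symmetric] using fin by (intro sum.mono_neutral_right) (auto simp: A_def)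
  moreover have "(\<Sum>p\<in>A. uncoord (coord \<alpha>) p) = 1"
    unfolding b(5)[symmetric] using fin by (intro sum.mono_neutral_right) (auto simp: A_def)
  ultimately have "sum h A = 0" by (simp add: h_def sum_subtractf)
  moreover have "0 \<le> h p" for p using ge by (simp add: h_def)
  ultimately have *: "\<forall>p\<in>A. h p = 0" using fin by (simp add: sum_nonneg_eq_0_iff)
  show ?thesis
  proof
    fix p show "uncoord (coord \<alpha>) p = \<alpha> p"
    proof (cases "p \<in> A")
      case True
      then have "h p = 0" using * by blast
      then show ?thesis by (simp add: h_def)
    qed (simp add: A_def)
  qed
qed

lemma continuous_map_uncoord:
  assumes "fuzzy_map K (e ` P) F"
  shows "continuous_map K (realization P le) (\<lambda>x. uncoord (F x))"
proof -
  obtain V where V: "finite V" "\<And>x. x \<in> topspace K \<Longrightarrow> {v. F x v \<noteq> 0} \<subseteq> V"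
    and F: "\<And>x. x \<in> topspace K \<Longrightarrow> F x \<in> fuzzy (e ` P)" "\<And>v. continuous_map K euclideanreal (\<lambda>x. F x v)"
    using assms by (auto simp: fuzzy_map_def)
  show ?thesis
  proof (rule continuous_map_into_realization)
    show "uncoord (F x) \<in> realization_points P le" if "x \<in> topspace K" for x
      using uncoord_in F(1) that by blast
    show "finite (e -` Pow V \<inter> P)"
      using V(1) inj by (intro finite_vimage_IntI) auto
    show "{p. uncoord (F x) p \<noteq> 0} \<subseteq> e -` Pow V \<inter> P" if x: "x \<in> topspace K" for x
    proof
      fix p assume "p \<in> {p. uncoord (F x) p \<noteq> 0}"
      then have "p \<in> P" "\<exists>t. 0 < t \<and> t \<le> 1 \<and> {v. t \<le> F x v} = e p"
        using uncoord_neq_0[OF F(1)[OF x]] by auto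
      then show "p \<in> e -` Pow V \<inter> P" using V(2)[OF x] by force
    qed
    fix p
    show "continuous_map K euclideanreal (\<lambda>x. uncoord (F x) p)"
    proof (cases "p \<in> P")
      case True
      have *: "continuous_map K euclideanreal (\<lambda>x. max 0 (Min (F x ` e p) - Max (insert 0 (F x ` (V - e p)))))"
        using V(1) finite_e[OF True] e_nonempty[OF True] F(2)
        by (intro continuous_map_real_max continuous_map_diff continuous_map_Min continuous_map_Max_insert) auto
      show ?thesis
      proof (rule continuous_map_eq[OF *])
        fix x assume x: "x \<in> topspace K"
        \<comment> \<open>Values off \<open>V\<close> are 0 and covered by the inserted 0, so the
          maximum over the complement becomes one over a finite set that does not depend on
          \<open>x\<close>.\<close>
        have "F x v \<in> insert 0 (F x ` (V - e p))" if "v \<notin> e p" for v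
          using that V(2)[OF x] by (cases "F x v = 0") auto
        then have "insert 0 (F x ` (- e p)) = insert 0 (F x ` (V - e p))" by auto
        then show "max 0 (Min (F x ` e p) - Max (insert 0 (F x ` (V - e p)))) = uncoord (F x) p"
          using True by (simp add: uncoord_def gap_def)
      qed
    qed (simp add: uncoord_def)
  qed
qed

text \<open>Compactness bounds all supports at once, which turns \<open>coord\<close> into one fixed
  finite sum of continuous coordinates.\<close>

lemma fuzzy_map_coord:
  assumes K: "compact_space K" and u: "continuous_map K (realization P le) u"
  shows "fuzzy_map K (e ` P) (\<lambda>x. coord (u x))"
proof -
  have pts: "u x \<in> realization_points P le" if "x \<in> topspace K" for x
    using continuous_map_funspace[OF u] that by auto
  have cp: "continuous_map K euclideanreal (\<lambda>x. u x p)" for p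
    using continuous_map_compose[OF u continuous_map_realization_coord] by (simp add: o_def)
  define C where "C = (\<Union>\<alpha>\<in>u ` topspace K. {p. \<alpha> p \<noteq> 0})"
  have C: "finite C"
    unfolding C_def using K u image_compactin compactin_realization_finite_support
    by (metis compact_space_def)
  have CP: "C \<subseteq> P" using realization_pointsD(2)[OF pts] by (auto simp: C_def)
  have eq: "coord (u x) v = (\<Sum>p\<in>{p\<in>C. v \<in> e p}. u x p)" if x: "x \<in> topspace K" for x v
    unfolding coord_def
  proof (rule sum.mono_neutral_left)
    show "finite {p\<in>C. v \<in> e p}" using C by simp
  qed (use x in \<open>auto simp: C_def\<close>)
  have "continuous_map K euclideanreal (\<lambda>x. coord (u x) v)" for v
  proof (rule continuous_map_eq)
    show "continuous_map K euclideanreal (\<lambda>x. \<Sum>p\<in>{p\<in>C. v \<in> e p}. u x p)"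
      using C by (intro continuous_map_sum cp) simp
    show "(\<Sum>p\<in>{p\<in>C. v \<in> e p}. u x p) = coord (u x) v" if "x \<in> topspace K" for x
      using eq[OF that] by simp
  qed
  moreover have "{v. coord (u x) v \<noteq> 0} \<subseteq> (\<Union>p\<in>C. e p)" if x: "x \<in> topspace K" for x
  proof clarify
    fix v assume "coord (u x) v \<noteq> 0"
    from nonempty_if_sum_nonzero[OF this[unfolded eq[OF x]]] obtain p where "p \<in> C" "v \<in> e p" by blast
    then show "v \<in> (\<Union>p\<in>C. e p)" by blast
  qed
  moreover have "finite (\<Union>p\<in>C. e p)" using C CP finite_e by blast
  ultimately show ?thesis
    unfolding fuzzy_map_def using coord_in[OF pts] by blast
qed

lemma fuzzy_map_simplex:
  assumes "finite c" "chain_in P le c"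
  shows "fuzzy_map (subtopology (powertop_real UNIV) (closed_simplex P le c)) (e ` P) coord"
proof (rule fuzzy_map_coord)
  show "continuous_map (subtopology (powertop_real UNIV) (closed_simplex P le c)) (realization P le) (\<lambda>x. x)"
    using assms(1) by (intro continuous_map_into_realization continuous_map_powertop_coord) (auto simp: closed_simplex_def)
qed (rule compactin_closed_simplex[OF assms])

end

section \<open>Operations on fuzzy sets\<close>

text \<open>Constantly 1 up to 1/2, then falling linearly to 0 at 1. At every time one of
  \<open>cut s\<close> and \<open>cut (1 - s)\<close> equals 1, so one of two superposed fuzzy sets
  is always present uncut.\<close>

definition cut :: "real \<Rightarrow> real" where
  "cut s = max 0 (min 1 (2 - 2 * s))"

text \<open>A path from \<open>l\<close> to \<open>l'\<close> through fuzzy sets that passes through their union at time \<open>1/2\<close>.\<close>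

definition hom :: "real \<Rightarrow> ('v \<Rightarrow> real) \<Rightarrow> ('v \<Rightarrow> real) \<Rightarrow> 'v \<Rightarrow> real" where
  "hom s l l' = (\<lambda>v. max (min (cut s) (l v)) (min (cut (1 - s)) (l' v)))"

lemma cut_bounds: "0 \<le> cut s" "cut s \<le> 1"
  by (auto simp: cut_def)

lemma cut_cases: "cut s = 1 \<or> cut (1 - s) = 1"
  by (auto simp: cut_def max_def min_def)

lemma hom_0: "(\<And>v. 0 \<le> l v \<and> l v \<le> 1) \<Longrightarrow> (\<And>v. 0 \<le> l' v) \<Longrightarrow> hom 0 l l' = l"
  by (auto simp: hom_def cut_def fun_eq_iff min_def max_def intro: antisym)

lemma hom_flip: "hom (1 - s) l' l = hom s l l'"
  by (simp add: hom_def max.commute)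

lemma hom_1: "(\<And>v. 0 \<le> l v) \<Longrightarrow> (\<And>v. 0 \<le> l' v \<and> l' v \<le> 1) \<Longrightarrow> hom 1 l l' = l'"
  using hom_0[of l' l] hom_flip[of 0 l l'] by simp

text \<open>Homotopies built with \<open>hom\<close> stand still wherever the two families already
  agree; everything that is relative to the boundary rests on this.\<close>

lemma hom_same:
  assumes "\<And>v. 0 \<le> l v \<and> l v \<le> 1"
  shows "hom s l l = l"
proof
  fix v
  have "0 \<le> l v" "l v \<le> 1" using assms by auto
  then show "hom s l l v = l v"
    using cut_cases[of s] cut_bounds[of s] cut_bounds[of "1 - s"] unfolding hom_def by (auto simp: min_def max_def)
qed

lemma hom_bounds:
  assumes "0 \<le> l v \<and> l v \<le> 1" "0 \<le> l' v \<and> l' v \<le> 1"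
  shows "0 \<le> hom s l l' v \<and> hom s l l' v \<le> 1"
  using assms cut_bounds unfolding hom_def by (auto simp: le_max_iff_disj min_le_iff_disj)

lemma hom_support: "hom s l l' v \<noteq> 0 \<Longrightarrow> 0 \<le> l v \<Longrightarrow> 0 \<le> l' v \<Longrightarrow> l v \<noteq> 0 \<or> l' v \<noteq> 0"
  using cut_bounds[of s] cut_bounds[of "1 - s"] by (auto simp: hom_def min_def max_def split: if_splits)

lemma hom_ge_iff:
  "t \<le> hom s l l' v \<longleftrightarrow> (t \<le> cut s \<and> t \<le> l v) \<or> (t \<le> cut (1 - s) \<and> t \<le> l' v)"
  by (auto simp: hom_def le_max_iff_disj)

definition convex_sets :: "'v set set \<Rightarrow> bool" where
  "convex_sets S \<longleftrightarrow> (\<forall>A\<in>S. \<forall>C\<in>S. \<forall>B. A \<subseteq> B \<and> B \<subseteq> C \<longrightarrow> B \<in> S) \<and> (\<forall>A\<in>S. finite A \<and> A \<noteq> {})"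

lemma convex_setsD: "convex_sets S \<Longrightarrow> A \<in> S \<Longrightarrow> C \<in> S \<Longrightarrow> A \<subseteq> B \<Longrightarrow> B \<subseteq> C \<Longrightarrow> B \<in> S"
  unfolding convex_sets_def by blast

lemma fuzzy_finite_support': "convex_sets S \<Longrightarrow> l \<in> fuzzy S \<Longrightarrow> finite {v. l v \<noteq> 0}"
  using fuzzyD(4) unfolding convex_sets_def by blast

lemma fuzzy_bounds: "l \<in> fuzzy S \<Longrightarrow> 0 \<le> l v \<and> l v \<le> 1"
  by (simp add: fuzzyD)

text \<open>The set of value 1 includes that of whichever of \<open>l\<close>, \<open>l'\<close> is
  uncut at time \<open>s\<close>, and the support lies in the union of the supports; convexity does
  the rest. No union is asked for at \<open>s = 0\<close> and \<open>s = 1\<close>, where the result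
  is \<open>l\<close> or \<open>l'\<close>: this admits homotopies that are already finished on part
  of the parameter space.\<close>

lemma hom_fuzzy:
  assumes S: "convex_sets S" and l: "l \<in> fuzzy S" "l' \<in> fuzzy S"
    and c: "s = 0 \<or> s = 1 \<or> {v. l v \<noteq> 0} \<union> {v. l' v \<noteq> 0} \<in> S"
  shows "hom s l l' \<in> fuzzy S"
proof -
  note b = fuzzy_bounds[OF l(1)] fuzzy_bounds[OF l(2)]
  consider "s = 0" | "s = 1" | "{v. l v \<noteq> 0} \<union> {v. l' v \<noteq> 0} \<in> S" using c by blast
  then show ?thesis
  proof cases
    case 1
    then have "hom s l l' = l" using b by (simp add: hom_0)
    then show ?thesis using l by simp
  next
    case 2
    then have "hom s l l' = l'" using b by (simp add: hom_1)
    then show ?thesis using l by simp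
  next
    case 3
    have sup: "{v. hom s l l' v \<noteq> 0} \<subseteq> {v. l v \<noteq> 0} \<union> {v. l' v \<noteq> 0}"
      using hom_support[of s l l'] b by blast
    have one: "hom s l l' v = 1 \<longleftrightarrow> 1 \<le> hom s l l' v" for v
      using hom_bounds[of l v l' s, OF b] by auto
    have "{v. l v = 1} \<subseteq> {v. hom s l l' v = 1} \<or> {v. l' v = 1} \<subseteq> {v. hom s l l' v = 1}"
      unfolding one hom_ge_iff using cut_cases[of s] by auto
    then obtain k where k: "k \<in> fuzzy S" "{v. k v = 1} \<subseteq> {v. hom s l l' v = 1}" using l by blast
    have "{v. hom s l l' v = 1} \<subseteq> {v. hom s l l' v \<noteq> 0}" by auto
    then have "{v. hom s l l' v = 1} \<in> S" "{v. hom s l l' v \<noteq> 0} \<in> S"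
      using convex_setsD[OF S fuzzyD(3)[OF k(1)] 3] k(2) sup by (meson subset_trans)+
    then show ?thesis using hom_bounds[of l _ l' s, OF b] by (simp add: fuzzy_def)
  qed
qed

lemma fuzzy_mapD:
  assumes "fuzzy_map K S F"
  shows "x \<in> topspace K \<Longrightarrow> F x \<in> fuzzy S" "continuous_map K euclideanreal (\<lambda>x. F x v)"
    "x \<in> topspace K \<Longrightarrow> 0 \<le> F x v \<and> F x v \<le> 1"
proof -
  show 1: "x \<in> topspace K \<Longrightarrow> F x \<in> fuzzy S" "continuous_map K euclideanreal (\<lambda>x. F x v)"
    using assms by (auto simp: fuzzy_map_def)
  then show "x \<in> topspace K \<Longrightarrow> 0 \<le> F x v \<and> F x v \<le> 1" using fuzzy_bounds by metis
qed

lemma fuzzy_map_support: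
  assumes "fuzzy_map K S F"
  obtains V where "finite V" "\<And>x. x \<in> topspace K \<Longrightarrow> {v. F x v \<noteq> 0} \<subseteq> V"
  using assms by (auto simp: fuzzy_map_def)

lemma fuzzy_map_compose:
  assumes "fuzzy_map K S F" "continuous_map L K g"
  shows "fuzzy_map L S (\<lambda>x. F (g x))"
proof -
  obtain V where "finite V" "\<And>x. x \<in> topspace K \<Longrightarrow> {v. F x v \<noteq> 0} \<subseteq> V"
    using fuzzy_map_support[OF assms(1)] by blast
  moreover have "g x \<in> topspace K" if "x \<in> topspace L" for x
    using continuous_map_funspace[OF assms(2)] that by auto
  moreover have "continuous_map L euclideanreal (\<lambda>x. F (g x) v)" for v
    using continuous_map_compose[OF assms(2) fuzzy_mapD(2)[OF assms(1)]] by (simp add: o_def)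
  ultimately show ?thesis using fuzzy_mapD(1)[OF assms(1)] unfolding fuzzy_map_def by blast
qed

lemma fuzzy_map_cong:
  assumes "fuzzy_map K S F" "\<And>x. x \<in> topspace K \<Longrightarrow> F x = G x"
  shows "fuzzy_map K S G"
proof -
  have "continuous_map K euclideanreal (\<lambda>x. G x v)" for v
    by (rule continuous_map_eq[OF fuzzy_mapD(2)[OF assms(1), of v]]) (simp add: assms(2))
  then show ?thesis using assms unfolding fuzzy_map_def by metis
qed

lemma continuous_map_cut: "continuous_map K euclideanreal s \<Longrightarrow> continuous_map K euclideanreal (\<lambda>x. cut (s x))"
  unfolding cut_def
  by (intro continuous_map_real_max continuous_map_real_min continuous_map_diff continuous_map_real_mult_left) auto

lemma fuzzy_map_hom:
  assumes S: "convex_sets S" and F: "fuzzy_map K S F" "fuzzy_map K S F'" and s: "continuous_map K euclideanreal s"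
    and c: "\<And>x. x \<in> topspace K \<Longrightarrow> s x = 0 \<or> s x = 1 \<or> {v. F x v \<noteq> 0} \<union> {v. F' x v \<noteq> 0} \<in> S"
  shows "fuzzy_map K S (\<lambda>x. hom (s x) (F x) (F' x))"
proof -
  obtain V V' where V: "finite V" "\<And>x. x \<in> topspace K \<Longrightarrow> {v. F x v \<noteq> 0} \<subseteq> V"
    and V': "finite V'" "\<And>x. x \<in> topspace K \<Longrightarrow> {v. F' x v \<noteq> 0} \<subseteq> V'"
    using fuzzy_map_support F by metis
  have "{v. hom (s x) (F x) (F' x) v \<noteq> 0} \<subseteq> V \<union> V'" if x: "x \<in> topspace K" for x
    using hom_support[of "s x" "F x" "F' x"] fuzzy_mapD(3)[OF F(1) x] fuzzy_mapD(3)[OF F(2) x] V(2)[OF x] V'(2)[OF x]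
    by blast
  moreover have "continuous_map K euclideanreal (\<lambda>x. hom (s x) (F x) (F' x) v)" for v
    unfolding hom_def using fuzzy_mapD(2)[OF F(1)] fuzzy_mapD(2)[OF F(2)] s
    by (intro continuous_map_real_max continuous_map_real_min continuous_map_cut continuous_map_diff) auto
  moreover have "hom (s x) (F x) (F' x) \<in> fuzzy S" if x: "x \<in> topspace K" for x
    using hom_fuzzy[OF S fuzzy_mapD(1)[OF F(1) x] fuzzy_mapD(1)[OF F(2) x] c[OF x]] .
  moreover have "finite (V \<union> V')" using V V' by simp
  ultimately show ?thesis unfolding fuzzy_map_def by blast
qed

text \<open>The image of a fuzzy set under a set-valued map. With a supremum, each positive level
  set of the image is the union of \<open>R w\<close> over the corresponding level set of
  \<open>l\<close>, so identities between images can be checked level by level.\<close>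

definition push :: "('w \<Rightarrow> 'v set) \<Rightarrow> ('w \<Rightarrow> real) \<Rightarrow> 'v \<Rightarrow> real" where
  "push R l v = Max (insert 0 (l ` {w. v \<in> R w}))"

lemma push_ge_iff:
  assumes "finite {w. l w \<noteq> 0}" "0 < t"
  shows "t \<le> push R l v \<longleftrightarrow> (\<exists>w. v \<in> R w \<and> t \<le> l w)"
  unfolding push_def using finite_image_of_support[OF assms(1), of "{w. v \<in> R w}"] assms(2)
  by (subst Max_ge_iff) auto

lemma push_nonneg:
  assumes "finite {w. l w \<noteq> 0}"
  shows "0 \<le> push R l v"
  unfolding push_def using finite_image_of_support[OF assms, of "{w. v \<in> R w}"] by (intro Max_ge) auto

lemma eq_if_levels_eq:
  assumes "0 \<le> a" "0 \<le> b" "\<And>t. 0 < t \<Longrightarrow> t \<le> a \<longleftrightarrow> t \<le> (b::real)"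
  shows "a = b"
  using assms by (metis antisym_conv2 not_le order.strict_trans2 order_refl)

lemma push_support:
  assumes "finite {w. l w \<noteq> 0}" "\<And>w. 0 \<le> l w"
  shows "push R l v \<noteq> 0 \<longleftrightarrow> (\<exists>w. v \<in> R w \<and> l w \<noteq> 0)"
proof
  assume "push R l v \<noteq> 0"
  then have "0 < push R l v" using push_nonneg[OF assms(1), of R v] by simp
  then have "\<exists>w. v \<in> R w \<and> push R l v \<le> l w" using push_ge_iff[OF assms(1) \<open>0 < push R l v\<close>, of R v] by simp
  then obtain w where "v \<in> R w" "push R l v \<le> l w" by blast
  then show "\<exists>w. v \<in> R w \<and> l w \<noteq> 0" using \<open>0 < push R l v\<close> by (intro exI[of _ w]) auto
next
  assume "\<exists>w. v \<in> R w \<and> l w \<noteq> 0"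
  then obtain w where w: "v \<in> R w" "l w \<noteq> 0" by blast
  then have "0 < l w" using assms(2)[of w] by simp
  then have "l w \<le> push R l v" using push_ge_iff[OF assms(1) \<open>0 < l w\<close>, of R v] w by auto
  then show "push R l v \<noteq> 0" using \<open>0 < l w\<close> by simp
qed

lemma push_le_1:
  assumes "finite {w. l w \<noteq> 0}" "\<And>w. l w \<le> 1"
  shows "push R l v \<le> 1"
  unfolding push_def using finite_image_of_support[OF assms(1), of "{w. v \<in> R w}"] assms(2)
  by (subst Max_le_iff) auto

lemma push_fuzzy:
  assumes S: "convex_sets S" and R: "\<And>A. A \<in> S \<Longrightarrow> (\<Union>w\<in>A. R w) \<in> S'" and l: "l \<in> fuzzy S"
  shows "push R l \<in> fuzzy S'"
proof -
  note fin = fuzzy_finite_support'[OF S l] and b = fuzzy_bounds[OF l]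
  have bb: "0 \<le> push R l v" "push R l v \<le> 1" for v
    using push_nonneg[OF fin] push_le_1[OF fin] b by auto
  have "push R l v = 1 \<longleftrightarrow> (\<exists>w. v \<in> R w \<and> l w = 1)" for v
  proof -
    have "push R l v = 1 \<longleftrightarrow> 1 \<le> push R l v" using bb[of v] by auto
    also have "\<dots> \<longleftrightarrow> (\<exists>w. v \<in> R w \<and> l w = 1)"
      using push_ge_iff[OF fin, of 1 R v] b by (auto intro: antisym)
    finally show ?thesis .
  qed
  then have "{v. push R l v = 1} = (\<Union>w\<in>{w. l w = 1}. R w)" by auto
  moreover have "{v. push R l v \<noteq> 0} = (\<Union>w\<in>{w. l w \<noteq> 0}. R w)"
  proof -
    have "push R l v \<noteq> 0 \<longleftrightarrow> (\<exists>w. v \<in> R w \<and> l w \<noteq> 0)" for v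
      by (rule push_support[OF fin]) (use b in blast)
    then show ?thesis by blast
  qed
  ultimately show ?thesis
    unfolding fuzzy_def using bb R[OF fuzzyD(3)[OF l]] R[OF fuzzyD(4)[OF l]] by simp
qed

text \<open>Cutting acts on levels and \<open>push\<close> on points, so they commute.\<close>

lemma push_hom:
  assumes l: "finite {w. l w \<noteq> 0}" "\<And>w. 0 \<le> l w" "finite {w. l' w \<noteq> 0}" "\<And>w. 0 \<le> l' w"
  shows "push R (hom s l l') = hom s (push R l) (push R l')"
proof
  fix v
  have "{w. hom s l l' w \<noteq> 0} \<subseteq> {w. l w \<noteq> 0} \<union> {w. l' w \<noteq> 0}"
    using hom_support[of s l l'] l(2,4) by blast
  then have fin: "finite {w. hom s l l' w \<noteq> 0}" using l by (meson finite_UnI finite_subset)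
  show "push R (hom s l l') v = hom s (push R l) (push R l') v"
  proof (rule eq_if_levels_eq)
    show "0 \<le> push R (hom s l l') v" using push_nonneg[OF fin] .
    show "0 \<le> hom s (push R l) (push R l') v"
      using push_nonneg[OF l(1), of R v] cut_bounds[of s] by (simp add: hom_def le_max_iff_disj)
    show "t \<le> push R (hom s l l') v \<longleftrightarrow> t \<le> hom s (push R l) (push R l') v" if "0 < t" for t
      unfolding push_ge_iff[OF fin that] hom_ge_iff push_ge_iff[OF l(1) that] push_ge_iff[OF l(3) that] by blast
  qed
qed

lemma push_push:
  assumes "finite {w. l w \<noteq> 0}" "\<And>w. 0 \<le> l w" "\<And>w. l w \<noteq> 0 \<Longrightarrow> finite (Q w)"
  shows "push R (push Q l) = push (\<lambda>w. \<Union>u\<in>Q w. R u) l"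
proof
  fix v
  have "{u. push Q l u \<noteq> 0} = (\<Union>w\<in>{w. l w \<noteq> 0}. Q w)"
    using push_support[OF assms(1,2), of Q] by auto
  then have fin: "finite {u. push Q l u \<noteq> 0}" using assms(1,3) by auto
  show "push R (push Q l) v = push (\<lambda>w. \<Union>u\<in>Q w. R u) l v"
  proof (rule eq_if_levels_eq)
    show "t \<le> push R (push Q l) v \<longleftrightarrow> t \<le> push (\<lambda>w. \<Union>u\<in>Q w. R u) l v" if "0 < t" for t
      unfolding push_ge_iff[OF fin that] push_ge_iff[OF assms(1) that] by blast
  qed (rule push_nonneg[OF fin], rule push_nonneg[OF assms(1)])
qed

lemma push_cong:
  assumes "finite {w. l w \<noteq> 0}" "\<And>w. 0 \<le> l w" "\<And>w. l w \<noteq> 0 \<Longrightarrow> R w = R' w"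
  shows "push R l = push R' l"
proof
  fix v show "push R l v = push R' l v"
  proof (rule eq_if_levels_eq)
    show "t \<le> push R l v \<longleftrightarrow> t \<le> push R' l v" if "0 < t" for t
      unfolding push_ge_iff[OF assms(1) that] using assms(2,3) that by force
  qed (rule push_nonneg[OF assms(1)])+
qed

lemma fuzzy_map_push:
  assumes S: "convex_sets S" and R: "\<And>A. A \<in> S \<Longrightarrow> (\<Union>w\<in>A. R w) \<in> S'" and F: "fuzzy_map K S F"
    and fR: "\<And>w. finite (R w)"
  shows "fuzzy_map K S' (\<lambda>x. push R (F x))"
proof -
  obtain V where V: "finite V" "\<And>x. x \<in> topspace K \<Longrightarrow> {v. F x v \<noteq> 0} \<subseteq> V"
    using fuzzy_map_support F by metis
  have "{v. push R (F x) v \<noteq> 0} \<subseteq> (\<Union>w\<in>V. R w)" if x: "x \<in> topspace K" for x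
    using push_support[OF fuzzy_finite_support'[OF S fuzzy_mapD(1)[OF F x]], of R] fuzzy_mapD(3)[OF F x] V(2)[OF x] by blast
  moreover have "finite (\<Union>w\<in>V. R w)" using V fR by blast
  moreover have "push R (F x) \<in> fuzzy S'" if x: "x \<in> topspace K" for x
    using push_fuzzy[OF S R fuzzy_mapD(1)[OF F x]] .
  moreover have "continuous_map K euclideanreal (\<lambda>x. push R (F x) v)" for v
  proof (rule continuous_map_eq)
    show "continuous_map K euclideanreal (\<lambda>x. Max (insert 0 (F x ` {w\<in>V. v \<in> R w})))"
      using V fuzzy_mapD(2)[OF F] by (intro continuous_map_Max_insert) auto
    fix x assume x: "x \<in> topspace K"
    have "F x w \<in> insert 0 (F x ` {w\<in>V. v \<in> R w})" if "v \<in> R w" for w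
      using that V(2)[OF x] by (cases "F x w = 0") auto
    then have "insert 0 (F x ` {w. v \<in> R w}) = insert 0 (F x ` {w\<in>V. v \<in> R w})" by auto
    then show "Max (insert 0 (F x ` {w\<in>V. v \<in> R w})) = push R (F x) v" by (simp add: push_def)
  qed
  ultimately show ?thesis unfolding fuzzy_map_def by blast
qed

lemma (in set_poset) convex_sets: "convex_sets (e ` P)"
  unfolding convex_sets_def using convex finite_e e_nonempty by blast

section \<open>Interpolation of sequences of fuzzy sets\<close>

definition interp :: "(int \<Rightarrow> 'v \<Rightarrow> real) \<Rightarrow> real \<Rightarrow> 'v \<Rightarrow> real" where
  "interp N t = hom (t - \<lfloor>t\<rfloor>) (N \<lfloor>t\<rfloor>) (N (\<lfloor>t\<rfloor> + 1))"

text \<open>A unit interval may be run through forwards, backwards (\<open>hom_flip\<close>) or not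
  at all (\<open>hom_same\<close>). This is what turns a walk along the nodes into a
  reparametrization of the interpolated path.\<close>

lemma interp_between:
  assumes N: "\<And>j v. 0 \<le> N j v \<and> N j v \<le> 1" and ab: "\<bar>a - b\<bar> \<le> 1" and s: "0 \<le> s" "s \<le> 1"
  shows "interp N ((1 - s) * real_of_int a + s * real_of_int b) = hom s (N a) (N b)"
proof -
  have int: "interp N (real_of_int j) = N j" for j
    using N by (simp add: interp_def hom_0)
  have up: "interp N (real_of_int a + s) = hom s (N a) (N (a + 1))" if s: "0 \<le> s" "s \<le> 1" for s a
  proof (cases "s = 1")
    case True
    then show ?thesis using int[of "a + 1"] N by (simp add: hom_1)
  next
    case False
    then have "\<lfloor>real_of_int a + s\<rfloor> = a" using s by (simp add: floor_eq_iff)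
    then show ?thesis by (simp add: interp_def)
  qed
  consider "b = a" | "b = a + 1" | "a = b + 1" using ab by linarith
  then show ?thesis
  proof cases
    case 1
    then show ?thesis using N int[of a] by (simp add: hom_same algebra_simps)
  next
    case 2
    then show ?thesis using up[OF s, of a] by (simp add: algebra_simps)
  next
    case 3
    have "interp N (real_of_int b + (1 - s)) = hom (1 - s) (N b) (N (b + 1))" using up[of "1 - s" b] s by simp
    then show ?thesis using 3 hom_flip[of s "N b" "N a"] by (simp add: algebra_simps)
  qed
qed

lemma interp_of_int: "(\<And>j v. 0 \<le> N j v \<and> N j v \<le> 1) \<Longrightarrow> interp N (real_of_int j) = N j"
  using interp_between[of N j j 0] by (simp add: hom_0)

lemma interp_support:
  assumes "interp N t v \<noteq> 0" "\<And>j. 0 \<le> N j v"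
  shows "N \<lfloor>t\<rfloor> v \<noteq> 0 \<or> N (\<lfloor>t\<rfloor> + 1) v \<noteq> 0"
  using hom_support[OF assms(1)[unfolded interp_def]] assms(2) by blast

text \<open>The floor in \<open>interp\<close> hides continuity. Here every node contributes with a
  continuous weight that vanishes at distance 1, so only the two neighbours of \<open>t\<close>
  count. The range reaches \<open>B + 1\<close> because \<open>t = B\<close> also refers to that
  node.\<close>

lemma interp_eq_Max:
  assumes N: "\<And>j. 0 \<le> N j v \<and> N j v \<le> 1" and t: "- real B \<le> t" "t \<le> real B"
  shows "interp N t v = Max (insert 0 ((\<lambda>j. min (cut \<bar>t - real_of_int j\<bar>) (N j v)) ` {- int B..int B + 1}))"
proof (rule Max_eqI[symmetric])
  let ?i = "\<lfloor>t\<rfloor>"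
  have i: "?i \<in> {- int B..int B + 1}" "?i + 1 \<in> {- int B..int B + 1}"
  proof -
    have "- int B \<le> ?i" "?i \<le> int B" using t by (simp_all add: le_floor_iff floor_le_iff)
    then show "?i \<in> {- int B..int B + 1}" "?i + 1 \<in> {- int B..int B + 1}" by auto
  qed
  have f: "real_of_int ?i \<le> t" "t < real_of_int ?i + 1" by linarith+
  have e: "\<bar>t - real_of_int ?i\<bar> = t - real_of_int ?i" "\<bar>t - real_of_int (?i + 1)\<bar> = 1 - (t - real_of_int ?i)"
    using f by auto
  show "y \<le> interp N t v" if y: "y \<in> insert 0 ((\<lambda>j. min (cut \<bar>t - real_of_int j\<bar>) (N j v)) ` {- int B..int B + 1})" for y
  proof -
    have 0: "0 \<le> interp N t v"
      unfolding interp_def using hom_bounds[of "N ?i" v "N (?i + 1)", OF N N] by blast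
    consider "y = 0" | j where "y = min (cut \<bar>t - real_of_int j\<bar>) (N j v)" using y by blast
    then show ?thesis
    proof cases
      case 2
      consider "j = ?i" | "j = ?i + 1" | "\<bar>t - real_of_int j\<bar> \<ge> 1" using f by linarith
      then show ?thesis
      proof cases
        case 1
        then show ?thesis unfolding 2 interp_def hom_def by (simp only: e max.cobounded1)
      next
        case h: 2
        show ?thesis unfolding 2 interp_def hom_def h by (simp only: e max.cobounded2)
      next
        case 3
        then have "cut \<bar>t - real_of_int j\<bar> = 0" by (simp add: cut_def)
        then show ?thesis using 2 0 by simp
      qed
    qed (use 0 in simp)
  qed
  have "interp N t v = min (cut \<bar>t - real_of_int ?i\<bar>) (N ?i v) \<or> interp N t v = min (cut \<bar>t - real_of_int (?i + 1)\<bar>) (N (?i + 1) v)"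
    unfolding e interp_def hom_def by (auto simp: max_def)
  then show "interp N t v \<in> insert 0 ((\<lambda>j. min (cut \<bar>t - real_of_int j\<bar>) (N j v)) ` {- int B..int B + 1})"
    using i by blast
qed simp

lemma interp_clamp:
  assumes N: "\<And>j v. 0 \<le> N j v \<and> N j v \<le> 1"
    and ends: "\<And>j. j \<le> - int B \<Longrightarrow> N j = N (- int B)" "\<And>j. j \<ge> int B \<Longrightarrow> N j = N (int B)"
  shows "t \<le> - real B \<Longrightarrow> interp N t = N (- int B)" "t \<ge> real B \<Longrightarrow> interp N t = N (int B)"
    "interp N (max (- real B) (min (real B) t)) = interp N t"
proof -
  show 1: "interp N t = N (- int B)" if "t \<le> - real B" for t
  proof (cases "t = - real B")
    case True
    then show ?thesis using interp_of_int[of N "- int B", OF N] by simp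
  next
    case False
    then have "\<lfloor>t\<rfloor> \<le> - int B" "\<lfloor>t\<rfloor> + 1 \<le> - int B" using that by (simp_all add: floor_le_iff) linarith+
    then show ?thesis unfolding interp_def using ends(1) N by (metis hom_same)
  qed
  show 2: "interp N t = N (int B)" if "t \<ge> real B" for t
  proof -
    have "\<lfloor>t\<rfloor> \<ge> int B" using that by (simp add: le_floor_iff)
    then have "N \<lfloor>t\<rfloor> = N (int B)" "N (\<lfloor>t\<rfloor> + 1) = N (int B)" by (intro ends(2); simp)+
    then show ?thesis unfolding interp_def using N by (simp add: hom_same)
  qed
  show "interp N (max (- real B) (min (real B) t)) = interp N t"
    using 1[of t] 2[of t] 1[of "- real B"] 2[of "real B"] by (auto simp: max_def min_def)
qed

lemma fuzzy_map_interp: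
  assumes S: "convex_sets S" and N: "\<And>j. fuzzy_map K S (N j)"
    and c: "\<And>x j. x \<in> topspace K \<Longrightarrow> {v. N j x v \<noteq> 0} \<union> {v. N (j + 1) x v \<noteq> 0} \<in> S"
    and ends: "\<And>x j. x \<in> topspace K \<Longrightarrow> j \<le> - int B \<Longrightarrow> N j x = N (- int B) x"
      "\<And>x j. x \<in> topspace K \<Longrightarrow> j \<ge> int B \<Longrightarrow> N j x = N (int B) x"
  shows "fuzzy_map (prod_topology K euclideanreal) S (\<lambda>(x, t). interp (\<lambda>j. N j x) t)"
proof -
  have "\<exists>V. finite V \<and> (\<forall>x\<in>topspace K. {v. N j x v \<noteq> 0} \<subseteq> V)" for j
    using N by (auto simp: fuzzy_map_def)
  then obtain V where V: "\<And>j. finite (V j)" "\<And>j x. x \<in> topspace K \<Longrightarrow> {v. N j x v \<noteq> 0} \<subseteq> V j"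
    by metis
  define U where "U = (\<Union>j\<in>{- int B..int B}. V j)"
  have b: "0 \<le> N j x v \<and> N j x v \<le> 1" if "x \<in> topspace K" for j x v
    using fuzzy_mapD(3)[OF N that] .
  have NU: "v \<in> U" if x: "x \<in> topspace K" and "N j x v \<noteq> 0" for x j v
  proof -
    consider "j \<le> - int B" | "j \<in> {- int B..int B}" | "j \<ge> int B" by force
    then show ?thesis
    proof cases
      case 1
      then have "v \<in> V (- int B)" using ends(1)[OF x 1] that V(2)[OF x, of "- int B"] by auto
      then show ?thesis by (force simp: U_def)
    next
      case 2
      then show ?thesis using V(2)[OF x, of j] that by (force simp: U_def)
    next
      case 3
      then have "v \<in> V (int B)" using ends(2)[OF x 3] that V(2)[OF x, of "int B"] by auto
      then show ?thesis by (force simp: U_def)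
    qed
  qed
  have sup: "v \<in> U" if x: "x \<in> topspace K" and "interp (\<lambda>j. N j x) t v \<noteq> 0" for x t v
    using interp_support[OF that(2)] b[OF x] NU[OF x] by blast
  let ?P = "prod_topology K euclideanreal"
  have "continuous_map ?P euclideanreal (\<lambda>z. interp (\<lambda>j. N j (fst z)) (snd z) v)" for v
  proof (rule continuous_map_eq)
    \<comment> \<open>Clamping the time to \<open>{-B..B}\<close> leaves the path unchanged and
      bounds the number of nodes in the maximum.\<close>
    let ?c = "\<lambda>z::_ \<times> real. max (- real B) (min (real B) (snd z))"
    have c: "continuous_map ?P euclideanreal ?c"
      by (intro continuous_map_real_max continuous_map_real_min continuous_map_snd) auto
    have n: "continuous_map ?P euclideanreal (\<lambda>z. N j (fst z) v)" for j
      using continuous_map_compose[OF continuous_map_fst fuzzy_mapD(2)[OF N]] by (simp add: o_def)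
    show "continuous_map ?P euclideanreal (\<lambda>z. Max (insert 0 ((\<lambda>j. min (cut \<bar>?c z - real_of_int j\<bar>) (N j (fst z) v)) ` {- int B..int B + 1})))"
      by (intro continuous_map_Max_insert continuous_map_real_min continuous_map_cut continuous_map_real_abs continuous_map_diff c n) auto
    fix z assume "z \<in> topspace ?P"
    then have x: "fst z \<in> topspace K" by auto
    have "interp (\<lambda>j. N j (fst z)) (snd z) v = interp (\<lambda>j. N j (fst z)) (?c z) v"
      by (rule fun_cong[OF interp_clamp(3)[symmetric]]) (use b[OF x] ends[OF x] in blast)+
    also have "\<dots> = Max (insert 0 ((\<lambda>j. min (cut \<bar>?c z - real_of_int j\<bar>) (N j (fst z) v)) ` {- int B..int B + 1}))"
      using b[OF x] by (intro interp_eq_Max) auto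
    finally show "Max (insert 0 ((\<lambda>j. min (cut \<bar>?c z - real_of_int j\<bar>) (N j (fst z) v)) ` {- int B..int B + 1})) =
        interp (\<lambda>j. N j (fst z)) (snd z) v" by (rule sym)
  qed
  moreover have "interp (\<lambda>j. N j x) t \<in> fuzzy S" if x: "x \<in> topspace K" for x t
    unfolding interp_def
    using hom_fuzzy[OF S fuzzy_mapD(1)[OF N x] fuzzy_mapD(1)[OF N x]] c[OF x] by blast
  moreover have "finite U" using V(1) by (auto simp: U_def)
  ultimately show ?thesis
    unfolding fuzzy_map_def case_prod_unfold using sup by (intro conjI exI[of _ U]) auto
qed

section \<open>Order preserving maps\<close>

locale set_poset_map = P: set_poset P le e + Q: set_poset Q le' e'
  for P :: "'p set" and le and e :: "'p \<Rightarrow> 'v set" and Q :: "'q set" and le' and e' :: "'q \<Rightarrow> 'w set" +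
  fixes \<phi> :: "'p \<Rightarrow> 'q" and R :: "'v \<Rightarrow> 'w set"
  assumes maps: "p \<in> P \<Longrightarrow> \<phi> p \<in> Q"
    and image: "p \<in> P \<Longrightarrow> e' (\<phi> p) = (\<Union>v\<in>e p. R v)"
begin

text \<open>Among the members of the chain whose image contains \<open>v\<close> there is a smallest
  one, \<open>m\<close>. A point \<open>w\<close> of \<open>e m\<close> with
  \<open>v \<in> R w\<close> lies in all of them, so the weight of \<open>v\<close>, a sum over
  these members, is the weight of \<open>w\<close> and thus a maximum over preimages.\<close>

lemma realization_map_push:
  assumes \<alpha>: "\<alpha> \<in> realization_points P le"
  shows "realization_map \<phi> \<alpha> \<in> realization_points Q le'"
    "Q.coord (realization_map \<phi> \<alpha>) = push R (P.coord \<alpha>)"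
proof -
  note a = P.realization_pointsD[OF \<alpha>]
  let ?A = "{p. \<alpha> p \<noteq> 0}" and ?\<beta> = "realization_map \<phi> \<alpha>"
  have \<beta>: "?\<beta> q = (\<Sum>p\<in>{p\<in>?A. \<phi> p = q}. \<alpha> p)" for q
    by (simp add: realization_map_def)
  have nn: "0 \<le> ?\<beta> q" for q unfolding \<beta> using a by (intro sum_nonneg) auto
  have supp: "{q. ?\<beta> q \<noteq> 0} = \<phi> ` ?A"
  proof (intro set_eqI iffI)
    fix q assume "q \<in> {q. ?\<beta> q \<noteq> 0}"
    then have "(\<Sum>p\<in>{p\<in>?A. \<phi> p = q}. \<alpha> p) \<noteq> 0" by (simp add: \<beta>)
    from nonempty_if_sum_nonzero[OF this] show "q \<in> \<phi> ` ?A" by blast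
  next
    fix q assume "q \<in> \<phi> ` ?A"
    then obtain p where p: "\<alpha> p \<noteq> 0" "q = \<phi> p" by blast
    then have "\<alpha> p \<le> ?\<beta> q" unfolding \<beta> using a by (intro member_le_sum) auto
    then show "q \<in> {q. ?\<beta> q \<noteq> 0}" using p(1) a(1)[of p] by auto
  qed
  have sub: "(\<Sum>q\<in>{q. ?\<beta> q \<noteq> 0 \<and> U q}. ?\<beta> q) = (\<Sum>p\<in>{p\<in>?A. U (\<phi> p)}. \<alpha> p)" for U :: "'q \<Rightarrow> bool"
  proof -
    let ?B = "{p\<in>?A. U (\<phi> p)}"
    have "{q. ?\<beta> q \<noteq> 0 \<and> U q} = {q. ?\<beta> q \<noteq> 0} \<inter> {q. U q}" by blast
    also have "\<dots> = \<phi> ` ?B" unfolding supp by blast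
    finally have "(\<Sum>q\<in>{q. ?\<beta> q \<noteq> 0 \<and> U q}. ?\<beta> q) = (\<Sum>q\<in>\<phi> ` ?B. ?\<beta> q)" by simp
    also have "\<dots> = (\<Sum>q\<in>\<phi> ` ?B. \<Sum>p\<in>{p\<in>?B. \<phi> p = q}. \<alpha> p)"
    proof (rule sum.cong[OF refl])
      fix q assume "q \<in> \<phi> ` ?B"
      then have "U q" by blast
      then have "{p\<in>?A. \<phi> p = q} = {p\<in>?B. \<phi> p = q}" by blast
      then show "?\<beta> q = (\<Sum>p\<in>{p\<in>?B. \<phi> p = q}. \<alpha> p)" unfolding \<beta> by simp
    qed
    also have "\<dots> = (\<Sum>p\<in>?B. \<alpha> p)"
      using a(3) by (intro sum.image_gen[symmetric]) simp
    finally show ?thesis .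
  qed
  have "chain_in Q le' {q. ?\<beta> q \<noteq> 0}"
    unfolding supp chain_in_def
  proof (intro conjI ballI)
    show "\<phi> ` ?A \<subseteq> Q" using a(2) maps by blast
    fix x y assume "x \<in> \<phi> ` ?A" "y \<in> \<phi> ` ?A"
    then obtain p q where pq: "\<alpha> p \<noteq> 0" "\<alpha> q \<noteq> 0" "x = \<phi> p" "y = \<phi> q" by blast
    then have "e p \<subseteq> e q \<or> e q \<subseteq> e p" using a(4) by blast
    then have "(\<Union>v\<in>e p. R v) \<subseteq> (\<Union>v\<in>e q. R v) \<or> (\<Union>v\<in>e q. R v) \<subseteq> (\<Union>v\<in>e p. R v)" by blast
    then show "le' x y \<or> le' y x"
      using pq a(2) Q.le_iff maps by (simp add: image)
  qed
  moreover have "(\<Sum>q\<in>{q. ?\<beta> q \<noteq> 0}. ?\<beta> q) = 1" using sub[of "\<lambda>_. True"] a(5) by simp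
  ultimately show "?\<beta> \<in> realization_points Q le'"
    unfolding realization_points_def using nn supp a(3) by simp
  show "Q.coord ?\<beta> = push R (P.coord \<alpha>)"
  proof
    fix v
    let ?B = "{p\<in>?A. v \<in> e' (\<phi> p)}"
    have cQ: "Q.coord ?\<beta> v = (\<Sum>p\<in>?B. \<alpha> p)"
      unfolding Q.coord_def using sub[of "\<lambda>q. v \<in> e' q"] .
    have fi: "finite (P.coord \<alpha> ` A)" for A
      using finite_image_of_support[OF P.fuzzy_finite_support[OF P.coord_in[OF \<alpha>]]] .
    have le: "P.coord \<alpha> w \<le> (\<Sum>p\<in>?B. \<alpha> p)" if w: "v \<in> R w" for w
      unfolding P.coord_def
    proof (rule sum_mono2)
      show "{p. \<alpha> p \<noteq> 0 \<and> w \<in> e p} \<subseteq> ?B" using a(2) image w by blast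
    qed (use a in auto)
    show "Q.coord ?\<beta> v = push R (P.coord \<alpha>) v"
      unfolding push_def cQ
    proof (rule Max_eqI[symmetric])
      show "finite (insert 0 (P.coord \<alpha> ` {w. v \<in> R w}))" using fi by simp
      show "y \<le> (\<Sum>p\<in>?B. \<alpha> p)" if "y \<in> insert 0 (P.coord \<alpha> ` {w. v \<in> R w})" for y
        using that le a(1) by (auto intro: sum_nonneg)
      show "(\<Sum>p\<in>?B. \<alpha> p) \<in> insert 0 (P.coord \<alpha> ` {w. v \<in> R w})"
      proof (cases "?B = {}")
        case False
        define E where "E = e ` ?B"
        have E: "finite E" "E \<noteq> {}" using a(3) False by (auto simp: E_def)
        obtain A where A: "A \<in> E" "\<forall>b\<in>E. b \<subseteq> A \<longrightarrow> A = b"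
          using finite_has_minimal[OF E] by blast
        obtain m where m: "\<alpha> m \<noteq> 0" "v \<in> e' (\<phi> m)" "A = e m" using A(1) unfolding E_def by blast
        have mp: "m \<in> P" using a(2) m by blast
        then obtain w where w: "w \<in> e m" "v \<in> R w" using m(2) image[OF mp] by blast
        have "w \<in> e p" if p: "p \<in> ?B" for p
        proof -
          have "e p \<in> E" using p unfolding E_def by blast
          then have "e p \<subseteq> e m \<longrightarrow> e m = e p" using A(2) unfolding m(3) by blast
          moreover have "e p \<subseteq> e m \<or> e m \<subseteq> e p" using a(4)[of p m] p m(1) by blast
          ultimately show ?thesis using w(1) by blast
        qed
        then have "?B \<subseteq> {p. \<alpha> p \<noteq> 0 \<and> w \<in> e p}" by blast
        then have "(\<Sum>p\<in>?B. \<alpha> p) \<le> P.coord \<alpha> w"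
          unfolding P.coord_def using a by (intro sum_mono2) auto
        then have "(\<Sum>p\<in>?B. \<alpha> p) = P.coord \<alpha> w" using le[OF w(2)] by simp
        then show ?thesis using w(2) by blast
      next
        case True
        show ?thesis unfolding True by simp
      qed
    qed
  qed
qed

end

section \<open>The posets of the theorem\<close>

text \<open>The unions of the two parts of the elements of \<open>bip_poset\<close>; the colouring
  recovers the parts. In this form the family is visibly convex.\<close>

definition bip_sets :: "'v bigraph \<Rightarrow> 'v set set" where
  "bip_sets X = {L. finite L \<and> L \<subseteq> verts X \<and> (\<exists>v\<in>L. col X v = 0) \<and> (\<exists>v\<in>L. col X v = 1) \<and>
     (\<forall>u\<in>L. \<forall>v\<in>L. col X u \<noteq> col X v \<longrightarrow> (u, v) \<in> edges X)}"

definition bip_union :: "'v set \<times> 'v set \<Rightarrow> 'v set" where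
  "bip_union p = fst p \<union> snd p"

lemma is_bigraphD:
  assumes "is_bigraph X"
  shows "v \<in> verts X \<Longrightarrow> col X v = 0 \<or> col X v = 1" "(u, v) \<in> edges X \<Longrightarrow> (v, u) \<in> edges X"
    "(u, v) \<in> edges X \<Longrightarrow> u \<in> verts X \<and> v \<in> verts X" "(u, v) \<in> edges X \<Longrightarrow> col X u \<noteq> col X v"
  using assms unfolding is_bigraph_def is_graph_def sym_def by fastforce+

lemma bip_union_split:
  assumes "p \<in> bip_poset X"
  shows "fst p = {v \<in> bip_union p. col X v = 0}" "snd p = {v \<in> bip_union p. col X v = 1}"
  using assms unfolding bip_poset_def bip_union_def by (auto simp: split_beta)

lemma bip_union_image:
  assumes X: "is_bigraph X"
  shows "bip_union ` bip_poset X = bip_sets X"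
proof (intro set_eqI iffI)
  fix L assume "L \<in> bip_union ` bip_poset X"
  then obtain \<sigma> \<tau> where "(\<sigma>, \<tau>) \<in> bip_poset X" "L = bip_union (\<sigma>, \<tau>)" by force
  then have L: "L = \<sigma> \<union> \<tau>" and p: "\<sigma> \<subseteq> {v \<in> verts X. col X v = 0}" "\<tau> \<subseteq> {v \<in> verts X. col X v = 1}"
      "finite \<sigma>" "\<sigma> \<noteq> {}" "finite \<tau>" "\<tau> \<noteq> {}" "\<sigma> \<times> \<tau> \<subseteq> edges X"
    by (auto simp: bip_poset_def bip_union_def)
  have c: "\<And>w. w \<in> \<sigma> \<Longrightarrow> col X w = 0" "\<And>w. w \<in> \<tau> \<Longrightarrow> col X w = 1" using p(1,2) by blast+
  have "(u, v) \<in> edges X" if "u \<in> L" "v \<in> L" "col X u \<noteq> col X v" for u v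
  proof (cases "u \<in> \<sigma>")
    case True
    then have "v \<in> \<tau>" using that L c by auto
    then show ?thesis using True p(7) by blast
  next
    case False
    then have "u \<in> \<tau>" "v \<in> \<sigma>" using that L c by auto
    then show ?thesis using is_bigraphD(2)[OF X] p(7) by blast
  qed
  moreover have "\<exists>v\<in>L. col X v = 0" "\<exists>v\<in>L. col X v = 1" using p(1,2,4,6) L by blast+
  moreover have "L \<subseteq> verts X" "finite L" using p L by auto
  ultimately show "L \<in> bip_sets X" by (simp add: bip_sets_def)
next
  fix L assume L: "L \<in> bip_sets X"
  then have v: "L \<subseteq> verts X" "finite L" "\<exists>v\<in>L. col X v = 0" "\<exists>v\<in>L. col X v = 1"
    "\<And>u v. u \<in> L \<Longrightarrow> v \<in> L \<Longrightarrow> col X u \<noteq> col X v \<Longrightarrow> (u, v) \<in> edges X" by (auto simp: bip_sets_def)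
  let ?p = "({v \<in> L. col X v = 0}, {v \<in> L. col X v = 1})"
  have "L = bip_union ?p" using is_bigraphD(1)[OF X] v(1) by (auto simp: bip_union_def)
  moreover have "?p \<in> bip_poset X" using v by (auto simp: bip_poset_def)
  ultimately show "L \<in> bip_union ` bip_poset X" by blast
qed

lemma bip_sets_convex:
  assumes "A \<in> bip_sets X" "C \<in> bip_sets X" "A \<subseteq> B" "B \<subseteq> C"
  shows "B \<in> bip_sets X"
  using assms finite_subset[of B C] unfolding bip_sets_def by blast

lemma set_poset_bip:
  assumes X: "is_bigraph X"
  shows "set_poset (bip_poset X) bip_le bip_union"
proof
  show "inj_on bip_union (bip_poset X)"
  proof (rule inj_onI)
    fix p q assume "p \<in> bip_poset X" "q \<in> bip_poset X" "bip_union p = bip_union q"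
    then show "p = q" using bip_union_split by (metis prod.expand)
  qed
  fix p assume p: "p \<in> bip_poset X"
  show "finite (bip_union p)" "bip_union p \<noteq> {}"
    using p by (auto simp: bip_poset_def bip_union_def)
  fix q assume q: "q \<in> bip_poset X"
  show "bip_le p q \<longleftrightarrow> bip_union p \<subseteq> bip_union q"
  proof
    assume "bip_union p \<subseteq> bip_union q"
    then show "bip_le p q"
      unfolding bip_le_def bip_union_split[OF p] bip_union_split[OF q] by blast
  qed (auto simp: bip_le_def bip_union_def)
next
  fix A B C assume "A \<in> bip_union ` bip_poset X" "C \<in> bip_union ` bip_poset X" "A \<subseteq> B" "B \<subseteq> C"
  then show "B \<in> bip_union ` bip_poset X"
    unfolding bip_union_image[OF X] by (rule bip_sets_convex)
qed

lemma set_poset_clique: "set_poset (clique_poset G) (\<subseteq>) (\<lambda>\<sigma>. \<sigma>)"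
proof
  fix A B C assume "A \<in> (\<lambda>\<sigma>. \<sigma>) ` clique_poset G" "C \<in> (\<lambda>\<sigma>. \<sigma>) ` clique_poset G" "A \<subseteq> B" "B \<subseteq> C"
  then have "A \<noteq> {}" "finite C" "C \<subseteq> verts G" "C \<times> C \<subseteq> edges G" by (auto simp: clique_poset_def)
  moreover have "B \<times> B \<subseteq> C \<times> C" using \<open>B \<subseteq> C\<close> by blast
  ultimately have "B \<in> clique_poset G"
    using \<open>A \<subseteq> B\<close> \<open>B \<subseteq> C\<close> finite_subset[of B C] unfolding clique_poset_def by blast
  then show "B \<in> (\<lambda>\<sigma>. \<sigma>) ` clique_poset G" by simp
qed (auto simp: clique_poset_def)

section \<open>Vertices and edges of the pullback\<close>

definition par :: "int \<Rightarrow> nat" where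
  "par i = nat (i mod 2)"

lemma par_eq_iff: "par i = par j \<longleftrightarrow> even (i - j)"
proof -
  have "i mod 2 \<ge> 0" "j mod 2 \<ge> 0" by simp_all
  then have "par i = par j \<longleftrightarrow> i mod 2 = j mod 2" by (simp add: par_def eq_nat_nat_iff)
  then show ?thesis by (simp add: mod_eq_dvd_iff)
qed

lemma par_cases: "par i = 0 \<or> par i = 1"
proof -
  have "i mod 2 = 0 \<or> i mod 2 = 1" by presburger
  then show ?thesis by (auto simp: par_def)
qed

lemma par_even: "even i \<Longrightarrow> par i = 0" "odd i \<Longrightarrow> par i = 1"
  by (auto simp: par_def odd_iff_mod_2_eq_one)

lemma Rfold_range: "Rfold n i \<in> {- int n..int n + 1}"
  by (auto simp: Rfold_def)

lemma Rfold_id: "i \<in> {- int n..int n + 1} \<Longrightarrow> Rfold n i = i"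
  by (auto simp: Rfold_def)

lemma Rfold_parity: "even (Rfold n i - i)"
  unfolding Rfold_def by (auto split: if_splits)

lemma par_Rfold: "par (Rfold n i) = par i"
  using Rfold_parity[of n i] by (simp add: par_eq_iff)

lemma Rfold_high: "i \<ge> int n \<Longrightarrow> Rfold n i = int n + (if even (i - int n) then 0 else 1)"
  unfolding Rfold_def by (auto split: if_splits) presburger+

lemma Rfold_low: "i \<le> 1 - int n \<Longrightarrow> Rfold n i = - int n + (if even (i + int n) then 0 else 1)"
  unfolding Rfold_def by (auto split: if_splits) presburger+

lemma Rfold_step:
  assumes "\<bar>i - j\<bar> = 1"
  shows "\<bar>Rfold n i - Rfold n j\<bar> = 1"
proof -
  have "j = i + 1 \<or> i = j + 1" using assms by linarith
  moreover have "\<bar>Rfold n i - Rfold n (i + 1)\<bar> = 1" for i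
    unfolding Rfold_def by (auto split: if_splits) presburger+
  ultimately show ?thesis by (metis abs_minus_commute)
qed

lemma Rfold_Rfold: "n \<le> m \<Longrightarrow> Rfold n (Rfold m i) = Rfold n i"
proof -
  assume nm: "n \<le> m"
  have p: "even (Rfold m i - i)" by (rule Rfold_parity)
  consider "i \<in> {- int m..int m + 1}" | "i > int m + 1" | "i < - int m" by fastforce
  then show ?thesis
  proof cases
    case 1
    then show ?thesis by (simp add: Rfold_id)
  next
    case 2
    then have "Rfold m i \<ge> int m" using Rfold_high[of m i] by simp
    then show ?thesis using 2 nm p by (subst (1 3) Rfold_high) auto
  next
    case 3
    then have "Rfold m i \<le> 1 - int m" using Rfold_low[of i m] by simp
    then show ?thesis using 3 nm p by (subst (1 3) Rfold_low) auto
  qed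
qed

text \<open>Invariance under folding replaces the existentially quantified representative: an
  element of the colimit is handled as a coloured function on all integers.\<close>

lemma in_stage_iff:
  "in_stage X n H \<longleftrightarrow> (\<forall>i. H i \<in> verts X \<and> col X (H i) = par i) \<and> (\<forall>i. H (Rfold n i) = H i)"
proof
  assume "in_stage X n H"
  then obtain h where h: "h \<in> verts (stage_graph X n)" and H: "H = h \<circ> Rfold n" by (auto simp: in_stage_def)
  have h': "h s \<in> verts X" "col X (h s) = par s" if "s \<in> {- int n..int n + 1}" for s
    using h that unfolding stage_graph_def exp_graph_def Lpath_def par_def by (auto simp: Let_def)
  show "(\<forall>i. H i \<in> verts X \<and> col X (H i) = par i) \<and> (\<forall>i. H (Rfold n i) = H i)"
    using h'[OF Rfold_range] by (auto simp: H par_Rfold Rfold_Rfold)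
next
  assume H: "(\<forall>i. H i \<in> verts X \<and> col X (H i) = par i) \<and> (\<forall>i. H (Rfold n i) = H i)"
  let ?h = "restrict H {- int n..int n + 1}"
  have "?h \<in> verts (stage_graph X n)"
    unfolding stage_graph_def exp_graph_def Lpath_def using H by (auto simp: Let_def par_def)
  moreover have "H = ?h \<circ> Rfold n" using H Rfold_range[of n] by (auto simp: fun_eq_iff)
  ultimately show "in_stage X n H" by (auto simp: in_stage_def)
qed

lemma in_stage_mono: "in_stage X n H \<Longrightarrow> n \<le> m \<Longrightarrow> in_stage X m H"
  unfolding in_stage_iff using Rfold_Rfold by metis

lemma verts_XL: "H \<in> verts (XL X) \<longleftrightarrow> (\<exists>n. in_stage X n H)"
  by (auto simp: XL_def in_stage_def)

text \<open>Two vertices have a common stage, and folding preserves distance 1, so the edge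
  condition at that stage is the one on all integers.\<close>

lemma edges_XL:
  assumes "H \<in> verts (XL X)" "H' \<in> verts (XL X)"
  shows "(H, H') \<in> edges (XL X) \<longleftrightarrow> (\<forall>i j. \<bar>i - j\<bar> = 1 \<longrightarrow> (H i, H' j) \<in> edges X)"
proof
  assume "(H, H') \<in> edges (XL X)"
  then obtain h h' n where h: "(h, h') \<in> edges (stage_graph X n)" and H: "H = h \<circ> Rfold n" "H' = h' \<circ> Rfold n"
    by (auto simp: XL_def)
  have "(h s, h' t) \<in> edges X" if "s \<in> {- int n..int n + 1}" "t \<in> {- int n..int n + 1}" "\<bar>s - t\<bar> = 1" for s t
    using h that unfolding stage_graph_def exp_graph_def Lpath_def by (auto simp: Let_def)
  then show "\<forall>i j. \<bar>i - j\<bar> = 1 \<longrightarrow> (H i, H' j) \<in> edges X"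
    unfolding H o_def using Rfold_range Rfold_step by blast
next
  assume e: "\<forall>i j. \<bar>i - j\<bar> = 1 \<longrightarrow> (H i, H' j) \<in> edges X"
  obtain n m where nm: "in_stage X n H" "in_stage X m H'" using assms verts_XL by metis
  define N where "N = max n m"
  have st: "in_stage X N H" "in_stage X N H'"
    using nm in_stage_mono unfolding N_def by (metis max.cobounded1 max.cobounded2)+
  let ?h = "restrict H {- int N..int N + 1}" and ?h' = "restrict H' {- int N..int N + 1}"
  have "(?h, ?h') \<in> edges (stage_graph X N)"
    unfolding stage_graph_def exp_graph_def Lpath_def using e st[unfolded in_stage_iff]
    by (auto simp: Let_def par_def)
  moreover have "H = ?h \<circ> Rfold N" "H' = ?h' \<circ> Rfold N"
    using st[unfolded in_stage_iff] Rfold_range[of N] by (auto simp: fun_eq_iff)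
  ultimately show "(H, H') \<in> edges (XL X)" unfolding XL_def by auto
qed

locale bigraph_maps =
  fixes X :: "'x bigraph" and Y :: "'y bigraph" and f g :: "'y \<Rightarrow> 'x"
  assumes X: "is_bigraph X" and Y: "is_bigraph Y" and f: "bigraph_hom Y X f" and g: "bigraph_hom Y X g"
begin

abbreviation "Z \<equiv> Zgraph X Y f g"

text \<open>The asymmetry of \<open>1 - M\<close> and \<open>M\<close> comes from the edges at which
  ends are read: at stage \<open>2m\<close> these are \<open>{-2m, 1 - 2m}\<close> and
  \<open>{2m, 2m + 1}\<close>. The adjacency of consecutive values is absent since a vertex of an
  exponential graph need not be looped.\<close>

definition zvert :: "int \<Rightarrow> (int \<Rightarrow> 'x) \<times> (nat \<Rightarrow> 'y) \<Rightarrow> bool" where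
  "zvert M z \<longleftrightarrow> snd z \<in> verts (exp_graph Y K2) \<and> (\<forall>i. fst z i \<in> verts X \<and> col X (fst z i) = par i) \<and>
     (\<forall>i\<le>1 - M. fst z i = f (snd z (par i))) \<and> (\<forall>i\<ge>M. fst z i = g (snd z (par i)))"

lemma zvert_mono: "zvert M z \<Longrightarrow> M \<le> M' \<Longrightarrow> zvert M' z"
  unfolding zvert_def by auto

lemma verts_exp_K2:
  "k \<in> verts (exp_graph Y K2) \<longleftrightarrow> k \<in> extensional {0, 1} \<and> (\<forall>i\<in>{0, 1}. k i \<in> verts Y \<and> col Y (k i) = i)"
  unfolding exp_graph_def Let_def K2_def by (simp add: PiE_iff) blast

lemma homD:
  assumes "bigraph_hom Y X h"
  shows "v \<in> verts Y \<Longrightarrow> h v \<in> verts X" "v \<in> verts Y \<Longrightarrow> col X (h v) = col Y v"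
    "(u, v) \<in> edges Y \<Longrightarrow> (h u, h v) \<in> edges X"
  using assms by (auto simp: bigraph_hom_def)

text \<open>\<open>e_minf\<close> and \<open>e_pinf\<close> read the ends at some stage picked by
  \<open>SOME\<close>. Folding invariance makes the values found there the eventual ones on either
  side, whatever the choice.\<close>

lemma verts_Z: "z \<in> verts Z \<longleftrightarrow> (\<exists>M. zvert M z)"
proof -
  obtain H k where z: "z = (H, k)" by (cases z)
  have V: "z \<in> verts Z \<longleftrightarrow> H \<in> verts (XL X) \<and> k \<in> verts (exp_graph Y K2) \<and>
      e_minf X H = postcomp_K2 f k \<and> e_pinf X H = postcomp_K2 g k"
    by (auto simp: z Zgraph_def pullback_graph_def Let_def)
  have res: "restrict u {0, 1::nat} = restrict v {0, 1} \<longleftrightarrow> u 0 = v 0 \<and> u 1 = v 1" for u v :: "nat \<Rightarrow> 'x"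
    by (auto simp: fun_eq_iff restrict_def)
  have ends: "e_minf X H = postcomp_K2 f k \<and> e_pinf X H = postcomp_K2 g k \<longleftrightarrow>
      H (- 2 * m) = f (k 0) \<and> H (1 - 2 * m) = f (k 1) \<and> H (2 * m) = g (k 0) \<and> H (1 + 2 * m) = g (k 1)"
    if "m = int (SOME m. in_stage X (2 * m) H)" for m
    unfolding e_minf_def e_pinf_def postcomp_K2_def Let_def res that by (auto simp: add.commute)
  show ?thesis
  proof
    assume "z \<in> verts Z"
    then have v: "H \<in> verts (XL X)" "k \<in> verts (exp_graph Y K2)" "e_minf X H = postcomp_K2 f k" "e_pinf X H = postcomp_K2 g k"
      using V by auto
    obtain n where "in_stage X n H" using v(1) verts_XL by blast
    then have "in_stage X (2 * n) H" using in_stage_mono by force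
    then have st: "in_stage X (2 * (SOME m. in_stage X (2 * m) H)) H" by (rule someI)
    define m where "m = (SOME m. in_stage X (2 * m) H)"
    have H: "\<And>i. H i \<in> verts X \<and> col X (H i) = par i" "\<And>i. H (Rfold (2 * m) i) = H i"
      using st[folded m_def] by (auto simp: in_stage_iff)
    have e: "H (- 2 * int m) = f (k 0)" "H (1 - 2 * int m) = f (k 1)" "H (2 * int m) = g (k 0)" "H (1 + 2 * int m) = g (k 1)"
      using ends[of "int m"] v m_def by auto
    have "H i = f (k (par i))" if "i \<le> 1 - 2 * int m" for i
      using H(2)[of i] Rfold_low[of i "2 * m"] e(1,2) that par_even[of i] by (cases "even i") auto
    moreover have "H i = g (k (par i))" if "i \<ge> 2 * int m" for i
      using H(2)[of i] Rfold_high[of "2 * m" i] e(3,4) that par_even[of i] by (cases "even i") (auto simp: add.commute)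
    ultimately show "\<exists>M. zvert M z" unfolding zvert_def z using v(2) H(1) by auto
  next
    assume "\<exists>M. zvert M z"
    then obtain M where "zvert M z" by blast
    define n where "n = nat \<bar>M\<bar>"
    have zv: "zvert (2 * int n) z" using \<open>zvert M z\<close> by (rule zvert_mono) (simp add: n_def)
    have H: "H i \<in> verts X \<and> col X (H i) = par i" for i using zv by (simp add: zvert_def z)
    have lo: "H i = f (k (par i))" if "i \<le> 1 - 2 * int n" for i using zv that by (simp add: zvert_def z)
    have hi: "H i = g (k (par i))" if "i \<ge> 2 * int n" for i using zv that by (simp add: zvert_def z)
    have "H (Rfold (2 * n) i) = H i" for i
    proof -
      consider "i \<in> {- int (2 * n)..int (2 * n) + 1}" | "i \<ge> int (2 * n)" | "i \<le> 1 - int (2 * n)" by fastforce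
      then show ?thesis
      proof cases
        case 1
        then show ?thesis by (simp only: Rfold_id)
      next
        case 2
        then have "Rfold (2 * n) i \<ge> 2 * int n" using Rfold_high[of "2 * n" i] by simp
        then show ?thesis using hi 2 par_Rfold by simp
      next
        case 3
        then have "Rfold (2 * n) i \<le> 1 - 2 * int n" using Rfold_low[of i "2 * n"] by simp
        then show ?thesis using lo 3 par_Rfold by simp
      qed
    qed
    then have st0: "in_stage X (2 * n) H" using H by (simp add: in_stage_iff)
    then have st: "in_stage X (2 * (SOME m. in_stage X (2 * m) H)) H" by (rule someI)
    define m where "m = (SOME m. in_stage X (2 * m) H)"
    have Hm: "H (Rfold (2 * m) i) = H i" for i
      using st[folded m_def] by (auto simp: in_stage_iff)
    \<comment> \<open>The picked stage \<open>2m\<close> may be smaller than \<open>2n\<close>.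
      Moving outward by the even number \<open>2n\<close> does not change the folded position for
      \<open>2m\<close> and reaches the range where the values are known.\<close>
    have "H (2 * int m) = g (k 0)"
      using Hm[of "2 * int m + 2 * int n"] Rfold_high[of "2 * m" "2 * int m + 2 * int n"] hi[of "2 * int m + 2 * int n"]
      by (simp add: par_even)
    moreover have "H (1 + 2 * int m) = g (k 1)"
      using Hm[of "1 + 2 * int m + 2 * int n"] Rfold_high[of "2 * m" "1 + 2 * int m + 2 * int n"] hi[of "1 + 2 * int m + 2 * int n"]
      by (simp add: par_even add.commute)
    moreover have "H (- 2 * int m) = f (k 0)"
      using Hm[of "- 2 * int m - 2 * int n"] Rfold_low[of "- 2 * int m - 2 * int n" "2 * m"] lo[of "- 2 * int m - 2 * int n"]
      by (simp add: par_even)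
    moreover have "H (1 - 2 * int m) = f (k 1)"
      using Hm[of "1 - 2 * int m - 2 * int n"] Rfold_low[of "1 - 2 * int m - 2 * int n" "2 * m"] lo[of "1 - 2 * int m - 2 * int n"]
      by (simp add: par_even)
    ultimately have "e_minf X H = postcomp_K2 f k \<and> e_pinf X H = postcomp_K2 g k"
      using ends[of "int m"] m_def by simp
    then show "z \<in> verts Z" unfolding V using st0 verts_XL zv by (auto simp: zvert_def z)
  qed
qed

lemma edges_Z:
  assumes z: "z \<in> verts Z" "z' \<in> verts Z"
  shows "(z, z') \<in> edges Z \<longleftrightarrow> (\<forall>i j. \<bar>i - j\<bar> = 1 \<longrightarrow> (fst z i, fst z' j) \<in> edges X) \<and>
     (snd z 0, snd z' 1) \<in> edges Y \<and> (snd z 1, snd z' 0) \<in> edges Y"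
proof -
  have v: "fst z \<in> verts (XL X)" "fst z' \<in> verts (XL X)" "snd z \<in> verts (exp_graph Y K2)" "snd z' \<in> verts (exp_graph Y K2)"
    using z by (auto simp: Zgraph_def pullback_graph_def Let_def)
  have "(z, z') \<in> edges Z \<longleftrightarrow> (fst z, fst z') \<in> edges (XL X) \<and> (snd z, snd z') \<in> edges (exp_graph Y K2)"
    using z by (auto simp: Zgraph_def pullback_graph_def prod_graph_def Let_def)
  moreover have "(snd z, snd z') \<in> edges (exp_graph Y K2) \<longleftrightarrow> (snd z 0, snd z' 1) \<in> edges Y \<and> (snd z 1, snd z' 0) \<in> edges Y"
    using v(3,4) by (auto simp: exp_graph_def Let_def K2_def)
  ultimately show ?thesis using edges_XL[OF v(1,2)] by simp
qed

abbreviation "cliques \<equiv> clique_poset Z"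

lemma cliqueD:
  assumes "A \<in> cliques"
  shows "finite A" "A \<noteq> {}" "z \<in> A \<Longrightarrow> z \<in> verts Z"
    "z \<in> A \<Longrightarrow> z' \<in> A \<Longrightarrow> \<bar>i - j\<bar> = 1 \<Longrightarrow> (fst z i, fst z' j) \<in> edges X"
    "z \<in> A \<Longrightarrow> z' \<in> A \<Longrightarrow> a \<noteq> b \<Longrightarrow> a \<in> {0, 1} \<Longrightarrow> b \<in> {0, 1} \<Longrightarrow> (snd z a, snd z' b) \<in> edges Y"
proof -
  have A: "finite A" "A \<noteq> {}" "A \<subseteq> verts Z" "A \<times> A \<subseteq> edges Z" using assms by (auto simp: clique_poset_def)
  then show "finite A" "A \<noteq> {}" "z \<in> A \<Longrightarrow> z \<in> verts Z" by auto
  assume zz: "z \<in> A" "z' \<in> A"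
  then have "(z, z') \<in> edges Z" using A by blast
  then have e: "(\<forall>i j. \<bar>i - j\<bar> = 1 \<longrightarrow> (fst z i, fst z' j) \<in> edges X)"
     "(snd z 0, snd z' 1) \<in> edges Y" "(snd z 1, snd z' 0) \<in> edges Y"
    using edges_Z[of z z'] zz A(3) by auto
  then show "\<bar>i - j\<bar> = 1 \<Longrightarrow> (fst z i, fst z' j) \<in> edges X" by blast
  show "a \<noteq> b \<Longrightarrow> a \<in> {0, 1} \<Longrightarrow> b \<in> {0, 1} \<Longrightarrow> (snd z a, snd z' b) \<in> edges Y" using e by auto
qed

lemma Z_colour: "z \<in> verts Z \<Longrightarrow> fst z i \<in> verts X \<and> col X (fst z i) = par i"
  by (auto simp: verts_Z zvert_def)

text \<open>Two integers of different parity in a window of length 2 differ by exactly 1, so values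
  of different colours taken from it are adjacent. A longer window would fail here, and this is the
  source of the width of stars. The pair \<open>{i, i + 1}\<close> provides both colours.\<close>

lemma clique_window:
  assumes A: "A \<in> cliques" and J: "J \<subseteq> {j..j + 2}" "{i, i + 1} \<subseteq> J"
  shows "(\<Union>z\<in>A. fst z ` J) \<in> bip_sets X"
proof -
  let ?T = "\<Union>z\<in>A. fst z ` J"
  have "finite J" using J finite_subset by blast
  then have fin: "finite ?T" using cliqueD(1)[OF A] by blast
  have sub: "?T \<subseteq> verts X" using Z_colour cliqueD(3)[OF A] by blast
  obtain z where z: "z \<in> A" using cliqueD(2)[OF A] by blast
  have "\<exists>v\<in>?T. col X v = c" if "c = 0 \<or> c = 1" for c
  proof -
    have "par i = c \<or> par (i + 1) = c" using that par_even[of i] par_even[of "i + 1"] by (cases "even i") auto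
    then show ?thesis using z J(2) Z_colour[OF cliqueD(3)[OF A z]] by blast
  qed
  moreover have "(u, v) \<in> edges X" if uv: "u \<in> ?T" "v \<in> ?T" "col X u \<noteq> col X v" for u v
  proof -
    obtain z l z' l' where *: "z \<in> A" "l \<in> J" "u = fst z l" "z' \<in> A" "l' \<in> J" "v = fst z' l'" using uv by blast
    then have "par l \<noteq> par l'" using uv Z_colour cliqueD(3)[OF A] by metis
    then have "odd (l - l')" by (simp add: par_eq_iff)
    moreover have "j \<le> l" "l \<le> j + 2" "j \<le> l'" "l' \<le> j + 2" using * J by auto
    ultimately have "\<bar>l - l'\<bar> = 1" by presburger
    then show ?thesis using cliqueD(4)[OF A] * by blast
  qed
  ultimately show ?thesis using fin sub by (simp add: bip_sets_def)
qed

lemma clique_Y: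
  assumes A: "A \<in> cliques"
  shows "(\<Union>z\<in>A. snd z ` {0, 1}) \<in> bip_sets Y"
proof -
  let ?T = "\<Union>z\<in>A. snd z ` {0, 1}"
  have c: "snd z i \<in> verts Y" "col Y (snd z i) = i" if zi: "z \<in> A" "i \<in> {0, 1}" for z i
  proof -
    obtain M where "zvert M z" using cliqueD(3)[OF A zi(1)] verts_Z by blast
    then have "\<forall>i\<in>{0, 1}. snd z i \<in> verts Y \<and> col Y (snd z i) = i" unfolding zvert_def verts_exp_K2 by (elim conjE)
    from bspec[OF this zi(2)] have *: "snd z i \<in> verts Y \<and> col Y (snd z i) = i" .
    show "snd z i \<in> verts Y" "col Y (snd z i) = i" by (rule conjunct1[OF *], rule conjunct2[OF *])
  qed
  obtain z where z: "z \<in> A" using cliqueD(2)[OF A] by blast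
  have "\<exists>v\<in>?T. col Y v = 0" "\<exists>v\<in>?T. col Y v = 1" using z c[OF z] by auto
  moreover have "(u, v) \<in> edges Y" if uv: "u \<in> ?T" "v \<in> ?T" "col Y u \<noteq> col Y v" for u v
  proof -
    obtain z l z' l' where *: "z \<in> A" "l \<in> {0, 1}" "u = snd z l" "z' \<in> A" "l' \<in> {0, 1}" "v = snd z' l'" using uv by blast
    then have "l \<noteq> l'" using uv c by metis
    then show ?thesis using cliqueD(5)[OF A] * by blast
  qed
  moreover have "finite ?T" using cliqueD(1)[OF A] by blast
  moreover have "?T \<subseteq> verts Y" using c by blast
  ultimately show ?thesis by (simp add: bip_sets_def)
qed

lemma bip_sets_image:
  assumes h: "bigraph_hom Y X h" and A: "A \<in> bip_sets Y"
  shows "(\<Union>y\<in>A. {h y}) \<in> bip_sets X"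
proof -
  have A': "finite A" "A \<subseteq> verts Y" "\<exists>v\<in>A. col Y v = 0" "\<exists>v\<in>A. col Y v = 1"
    "\<And>u v. u \<in> A \<Longrightarrow> v \<in> A \<Longrightarrow> col Y u \<noteq> col Y v \<Longrightarrow> (u, v) \<in> edges Y"
    using A by (auto simp: bip_sets_def)
  have c: "col X (h y) = col Y y" "h y \<in> verts X" if "y \<in> A" for y using homD[OF h] A'(2) that by auto
  have "(u, v) \<in> edges X" if uv: "u \<in> (\<Union>y\<in>A. {h y})" "v \<in> (\<Union>y\<in>A. {h y})" "col X u \<noteq> col X v" for u v
  proof -
    obtain a b where "a \<in> A" "b \<in> A" "u = h a" "v = h b" using uv by blast
    then show ?thesis using A'(5)[of a b] uv(3) c homD(3)[OF h] by simp
  qed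
  moreover have "\<exists>v\<in>(\<Union>y\<in>A. {h y}). col X v = 0" "\<exists>v\<in>(\<Union>y\<in>A. {h y}). col X v = 1"
    using A'(3,4) c(1) by auto
  moreover have "finite (\<Union>y\<in>A. {h y})" "(\<Union>y\<in>A. {h y}) \<subseteq> verts X" using A'(1) c(2) by auto
  ultimately show ?thesis by (simp add: bip_sets_def)
qed

lemma bip_sets_convex_sets: "is_bigraph G \<Longrightarrow> convex_sets (bip_sets G)"
  using set_poset.convex_sets[OF set_poset_bip, of G] bip_union_image[of G] by simp

lemma clique_convex_sets: "convex_sets cliques"
  using set_poset.convex_sets[OF set_poset_clique, of Z] by simp

end

context bigraph_maps
begin

section \<open>Points of the homotopy pullback as paths of fuzzy sets\<close>

sublocale PX: set_poset "bip_poset X" bip_le bip_union by (rule set_poset_bip[OF X])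
sublocale PY: set_poset "bip_poset Y" bip_le bip_union by (rule set_poset_bip[OF Y])
sublocale PZ: set_poset cliques "(\<subseteq>)" "\<lambda>\<sigma>. \<sigma>" by (rule set_poset_clique)

abbreviation "BX \<equiv> realization (bip_poset X) bip_le"
abbreviation "BY \<equiv> realization (bip_poset Y) bip_le"
abbreviation "W \<equiv> realization cliques (\<subseteq>)"
abbreviation "ends \<alpha> \<equiv> (realization_map (bip_map f) \<alpha>, realization_map (bip_map g) \<alpha>)"
abbreviation "Hp \<equiv> hpullback BY BX (prod_topology BX BX) ends (\<lambda>\<beta>. (\<beta>, \<beta>))"
abbreviation "SX \<equiv> bip_sets X"
abbreviation "SY \<equiv> bip_sets Y"
abbreviation "pushv h \<equiv> push (\<lambda>y. {h y})"

lemmas convSX = bip_sets_convex_sets[OF X] and convSY = bip_sets_convex_sets[OF Y]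
lemmas unionX = bip_union_image[OF X] and unionY = bip_union_image[OF Y]
lemmas uncoordX = PX.continuous_map_uncoord[unfolded unionX] and uncoordY = PY.continuous_map_uncoord[unfolded unionY]
lemmas uncoordZ = PZ.continuous_map_uncoord[unfolded image_ident]
lemmas coordX = PX.fuzzy_map_coord[unfolded unionX] and coordY = PY.fuzzy_map_coord[unfolded unionY]
lemmas coordZ = PZ.fuzzy_map_coord[unfolded image_ident]
lemmas coord_uncoordX = PX.coord_uncoord[unfolded unionX] and coord_uncoordY = PY.coord_uncoord[unfolded unionY]
lemmas coord_uncoordZ = PZ.coord_uncoord[unfolded image_ident]

lemma realization_map_uncoord:
  assumes h: "bigraph_hom Y X h" and y: "y \<in> fuzzy SY"
  shows "realization_map (bip_map h) (PY.uncoord y) = PX.uncoord (pushv h y)"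
proof -
  interpret H: set_poset_map "bip_poset Y" bip_le bip_union "bip_poset X" bip_le bip_union "bip_map h" "\<lambda>y. {h y}"
  proof
    fix p assume p: "p \<in> bip_poset Y"
    show "bip_union (bip_map h p) = (\<Union>v\<in>bip_union p. {h v})"
      by (auto simp: bip_union_def bip_map_def)
    have s: "fst p \<times> snd p \<subseteq> edges Y" "fst p \<subseteq> {v \<in> verts Y. col Y v = 0}" "snd p \<subseteq> {v \<in> verts Y. col Y v = 1}"
      "finite (fst p)" "fst p \<noteq> {}" "finite (snd p)" "snd p \<noteq> {}"
      using p unfolding bip_poset_def by (simp_all add: split_beta)
    have "(a, b) \<in> edges X" if "a \<in> h ` fst p" "b \<in> h ` snd p" for a b
      using that s(1) homD(3)[OF h] by blast
    moreover have "h ` fst p \<subseteq> {v \<in> verts X. col X v = 0}" "h ` snd p \<subseteq> {v \<in> verts X. col X v = 1}"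
      using s(2,3) homD(1,2)[OF h] by fastforce+
    ultimately show "bip_map h p \<in> bip_poset X"
      using s(4-7) by (auto simp: bip_poset_def bip_map_def)
  qed
  have y': "y \<in> fuzzy (bip_union ` bip_poset Y)" using y by (simp add: unionY)
  note u = PY.uncoord_in[OF y']
  have "PX.uncoord (PX.coord (realization_map (bip_map h) (PY.uncoord y))) = realization_map (bip_map h) (PY.uncoord y)"
    by (rule PX.uncoord_coord[OF H.realization_map_push(1)[OF u]])
  then show ?thesis
    unfolding H.realization_map_push(2)[OF u] PY.coord_uncoord[OF y'] by simp
qed

lemma pushv_fuzzy: "bigraph_hom Y X h \<Longrightarrow> y \<in> fuzzy SY \<Longrightarrow> pushv h y \<in> fuzzy SX"
  by (rule push_fuzzy[OF convSY bip_sets_image])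

text \<open>A path in the product from the two images of \<open>y\<close> to the diagonal is one
  path in \<open>X\<close> cut at its middle: the halves are run inwards simultaneously. The
  substitution of \<open>1 - 1 / s\<close> and \<open>1 / s - 1\<close> puts the middle
  \<open>V 0\<close> at \<open>s = 1\<close> and the two infinite ends at
  \<open>s = 0\<close>.\<close>

definition mkP :: "('y \<Rightarrow> real) \<Rightarrow> (real \<Rightarrow> 'x \<Rightarrow> real) \<Rightarrow> _" where
  "mkP y V = (PY.uncoord y, PX.uncoord (V 0),
     restrict (\<lambda>s. if s = 0 then (PX.uncoord (pushv f y), PX.uncoord (pushv g y))
       else (PX.uncoord (V (1 - 1 / s)), PX.uncoord (V (1 / s - 1)))) {0..1})"

text \<open>A family of points \<open>y\<close> of \<open>Y\<close> with paths \<open>V\<close>, parametrized by the real line and constant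
  outside \<open>{-M..M}\<close>, from the image under \<open>f\<close> to the image under \<open>g\<close>.\<close>

definition pdat :: "'k topology \<Rightarrow> real \<Rightarrow> ('k \<Rightarrow> 'y \<Rightarrow> real) \<Rightarrow> ('k \<Rightarrow> real \<Rightarrow> 'x \<Rightarrow> real) \<Rightarrow> bool" where
  "pdat K M y V \<longleftrightarrow> fuzzy_map K SY y \<and> fuzzy_map (prod_topology K euclideanreal) SX (\<lambda>(x, t). V x t) \<and>
     (\<forall>x\<in>topspace K. (\<forall>t\<le>- M. V x t = pushv f (y x)) \<and> (\<forall>t\<ge>M. V x t = pushv g (y x)))"

lemma pdatD:
  assumes "pdat K M y V"
  shows "fuzzy_map K SY y" "fuzzy_map (prod_topology K euclideanreal) SX (\<lambda>(x, t). V x t)"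
    "x \<in> topspace K \<Longrightarrow> t \<le> - M \<Longrightarrow> V x t = pushv f (y x)"
    "x \<in> topspace K \<Longrightarrow> t \<ge> M \<Longrightarrow> V x t = pushv g (y x)"
    "x \<in> topspace K \<Longrightarrow> y x \<in> fuzzy SY" "x \<in> topspace K \<Longrightarrow> V x t \<in> fuzzy SX"
  using assms fuzzy_mapD(1)[of K SY y x] fuzzy_mapD(1)[of "prod_topology K euclideanreal" SX "\<lambda>(x, t). V x t" "(x, t)"]
  by (auto simp: pdat_def)

lemma pdat_mono: "pdat K M y V \<Longrightarrow> M \<le> M' \<Longrightarrow> pdat K M' y V"
  unfolding pdat_def by (auto intro: order_trans)

lemma pdat_reparam:
  assumes p: "pdat K M y V" and c: "continuous_map L K c"
    and \<tau>: "continuous_map (prod_topology L euclideanreal) euclideanreal (\<lambda>(x, t). \<tau> x t)"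
    and b: "\<And>x t. x \<in> topspace L \<Longrightarrow> t \<le> - M' \<Longrightarrow> \<tau> x t \<le> - M" "\<And>x t. x \<in> topspace L \<Longrightarrow> t \<ge> M' \<Longrightarrow> \<tau> x t \<ge> M"
  shows "pdat L M' (\<lambda>x. y (c x)) (\<lambda>x t. V (c x) (\<tau> x t))"
  unfolding pdat_def
proof (intro conjI ballI allI impI)
  show "fuzzy_map L SY (\<lambda>x. y (c x))" by (rule fuzzy_map_compose[OF pdatD(1)[OF p] c])
  have "continuous_map (prod_topology L euclideanreal) K (\<lambda>z. c (fst z))"
    using continuous_map_compose[OF continuous_map_fst c] by (simp add: o_def)
  then have "continuous_map (prod_topology L euclideanreal) (prod_topology K euclideanreal) (\<lambda>z. (c (fst z), \<tau> (fst z) (snd z)))"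
    using \<tau> by (simp add: continuous_map_pairwise o_def case_prod_unfold)
  from fuzzy_map_compose[OF pdatD(2)[OF p] this]
  show "fuzzy_map (prod_topology L euclideanreal) SX (\<lambda>(x, t). V (c x) (\<tau> x t))"
    by (simp add: case_prod_unfold)
  fix x assume x: "x \<in> topspace L"
  then have cx: "c x \<in> topspace K" using continuous_map_funspace[OF c] by auto
  show "V (c x) (\<tau> x t) = pushv f (y (c x))" if "t \<le> - M'" for t using pdatD(3)[OF p cx] b(1)[OF x that] by blast
  show "V (c x) (\<tau> x t) = pushv g (y (c x))" if "t \<ge> M'" for t using pdatD(4)[OF p cx] b(2)[OF x that] by blast
qed

lemma pdat_compose:
  assumes p: "pdat K M y V" and c: "continuous_map L K c"
  shows "pdat L M (\<lambda>x. y (c x)) (\<lambda>x. V (c x))"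
  using pdat_reparam[OF p c, of "\<lambda>x t. t" M] continuous_map_snd[of L euclideanreal] by (simp add: case_prod_unfold)

text \<open>Since \<open>push\<close> commutes with \<open>hom\<close>, the interpolated paths end
  at the images of the interpolated points of \<open>Y\<close>.\<close>

lemma pdat_hom:
  assumes p: "pdat K M y V" "pdat K M y' V'" and r: "continuous_map K euclideanreal r"
    and c: "\<And>x. x \<in> topspace K \<Longrightarrow> r x = 0 \<or> r x = 1 \<or> {v. y x v \<noteq> 0} \<union> {v. y' x v \<noteq> 0} \<in> SY"
      "\<And>x t. x \<in> topspace K \<Longrightarrow> r x = 0 \<or> r x = 1 \<or> {v. V x t v \<noteq> 0} \<union> {v. V' x t v \<noteq> 0} \<in> SX"
  shows "pdat K M (\<lambda>x. hom (r x) (y x) (y' x)) (\<lambda>x t. hom (r x) (V x t) (V' x t))"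
  unfolding pdat_def
proof (intro conjI ballI allI impI)
  show "fuzzy_map K SY (\<lambda>x. hom (r x) (y x) (y' x))"
    by (rule fuzzy_map_hom[OF convSY pdatD(1)[OF p(1)] pdatD(1)[OF p(2)] r c(1)])
  have r': "continuous_map (prod_topology K euclideanreal) euclideanreal (\<lambda>z. r (fst z))"
    using continuous_map_compose[OF continuous_map_fst r] by (simp add: o_def)
  have "fuzzy_map (prod_topology K euclideanreal) SX
      (\<lambda>z. hom (r (fst z)) ((\<lambda>(x, t). V x t) z) ((\<lambda>(x, t). V' x t) z))"
  proof (rule fuzzy_map_hom[OF convSX pdatD(2)[OF p(1)] pdatD(2)[OF p(2)] r'])
    fix z assume "z \<in> topspace (prod_topology K euclideanreal)"
    then have "fst z \<in> topspace K" by auto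
    from c(2)[OF this, of "snd z"]
    show "r (fst z) = 0 \<or> r (fst z) = 1 \<or>
        {v. (\<lambda>(x, t). V x t) z v \<noteq> 0} \<union> {v. (\<lambda>(x, t). V' x t) z v \<noteq> 0} \<in> SX"
      by (simp add: case_prod_unfold)
  qed
  then show "fuzzy_map (prod_topology K euclideanreal) SX (\<lambda>(x, t). hom (r x) (V x t) (V' x t))"
    by (simp add: case_prod_unfold)
  fix x assume x: "x \<in> topspace K"
  note fin = fuzzy_finite_support'[OF convSY pdatD(5)[OF p(1) x]] fuzzy_finite_support'[OF convSY pdatD(5)[OF p(2) x]]
  note nn = fuzzyD(1)[OF pdatD(5)[OF p(1) x]] fuzzyD(1)[OF pdatD(5)[OF p(2) x]]
  show "hom (r x) (V x t) (V' x t) = pushv f (hom (r x) (y x) (y' x))" if "t \<le> - M" for t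
    by (simp only: pdatD(3)[OF p(1) x that] pdatD(3)[OF p(2) x that] push_hom[OF fin(1) nn(1) fin(2) nn(2)])
  show "hom (r x) (V x t) (V' x t) = pushv g (hom (r x) (y x) (y' x))" if "t \<ge> M" for t
    by (simp only: pdatD(4)[OF p(1) x that] pdatD(4)[OF p(2) x that] push_hom[OF fin(1) nn(1) fin(2) nn(2)])
qed

lemma continuous_map_mkP:
  fixes K :: "'k topology"
  assumes p: "pdat K M y V" and M: "0 \<le> M"
  shows "continuous_map K Hp (\<lambda>x. mkP (y x) (V x))"
  unfolding continuous_map_hpullback_iff
proof (intro conjI ballI)
  show "continuous_map K BY (\<lambda>x. fst (mkP (y x) (V x)))"
    using uncoordY[OF pdatD(1)[OF p]] by (simp add: mkP_def)
  have V: "continuous_map L BX (\<lambda>z. PX.uncoord (V (c z) (\<tau> z)))"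
    if "continuous_map L K c" "continuous_map L euclideanreal \<tau>" for L c \<tau>
  proof (rule uncoordX)
    have "continuous_map L (prod_topology K euclideanreal) (\<lambda>z. (c z, \<tau> z))"
      using that by (simp add: continuous_map_pairwise o_def)
    from fuzzy_map_compose[OF pdatD(2)[OF p] this] show "fuzzy_map L SX (\<lambda>z. V (c z) (\<tau> z))" by simp
  qed
  show "continuous_map K BX (\<lambda>x. fst (snd (mkP (y x) (V x))))"
    using V[of K "\<lambda>x. x" "\<lambda>x. 0"] by (simp add: mkP_def)
  \<comment> \<open>The parameter \<open>1 / (M + 1)\<close> corresponds to the times
    \<open>-M\<close> and \<open>M\<close>, beyond which the path is constant. Replacing smaller
    \<open>s\<close> by it removes the singularity at 0 without changing a value.\<close>
  let ?e = "\<lambda>s::real. max s (1 / (M + 1))"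
  let ?h = "\<lambda>x s. (PX.uncoord (V x (1 - 1 / ?e s)), PX.uncoord (V x (1 / ?e s - 1)))"
  have e0: "?e s > 0" for s using M by (simp add: less_max_iff_disj)
  have cs: "continuous_map (prod_topology K unit_interval) euclideanreal snd"
    unfolding unit_interval_def using continuous_map_snd continuous_map_into_fulltopology by blast
  have ce: "continuous_map (prod_topology K unit_interval) euclideanreal (\<lambda>z. 1 / ?e (snd z))"
  proof (rule continuous_map_real_divide)
    show "continuous_map (prod_topology K unit_interval) euclideanreal (\<lambda>z. ?e (snd z))"
      by (rule continuous_map_real_max[OF cs]) simp
    show "?e (snd z) \<noteq> 0" for z :: "'k \<times> real" using e0[of "snd z"] by linarith
  qed simp
  have "continuous_map (prod_topology K unit_interval) (prod_topology BX BX) (\<lambda>z. ?h (fst z) (snd z))"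
    unfolding continuous_map_pairwise o_def fst_conv snd_conv
    by (intro conjI V continuous_map_fst continuous_map_diff ce) auto
  then have c3: "continuous_map K (compact_open unit_interval (prod_topology BX BX)) (\<lambda>x. restrict (?h x) {0..1})"
    by (intro continuous_map_curry) (simp add: case_prod_unfold)
  show "continuous_map K (compact_open unit_interval (prod_topology BX BX)) (\<lambda>x. snd (snd (mkP (y x) (V x))))"
  proof (rule continuous_map_eq[OF c3])
    fix x assume x: "x \<in> topspace K"
    have "?h x s = (if s = 0 then (PX.uncoord (pushv f (y x)), PX.uncoord (pushv g (y x)))
       else (PX.uncoord (V x (1 - 1 / s)), PX.uncoord (V x (1 / s - 1))))" if s: "s \<in> {0..1}" for s
    proof (cases "s \<ge> 1 / (M + 1)")
      case True
      then have "s \<noteq> 0" "?e s = s" using M by (auto simp: max_def field_simps)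
      then show ?thesis by simp
    next
      case False
      then have e: "?e s = 1 / (M + 1)" by simp
      have V1: "V x (1 - 1 / ?e s) = pushv f (y x)" "V x (1 / ?e s - 1) = pushv g (y x)"
        unfolding e using pdatD(3,4)[OF p x] by simp_all
      have "V x (1 - 1 / s) = pushv f (y x)" "V x (1 / s - 1) = pushv g (y x)" if "s \<noteq> 0"
      proof -
        have "s > 0" using s that by simp
        then have "1 / s \<ge> M + 1" using False M by (simp add: field_simps)
        then show "V x (1 - 1 / s) = pushv f (y x)" "V x (1 / s - 1) = pushv g (y x)"
          using pdatD(3,4)[OF p x] by simp_all
      qed
      then show ?thesis using V1 by simp
    qed
    then show "restrict (?h x) {0..1} = snd (snd (mkP (y x) (V x)))"
      unfolding mkP_def snd_conv by (intro restrict_ext) blast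
  qed
  fix x assume x: "x \<in> topspace K"
  show "snd (snd (mkP (y x) (V x))) 0 = ends (fst (mkP (y x) (V x)))"
    using realization_map_uncoord[OF f pdatD(5)[OF p x]] realization_map_uncoord[OF g pdatD(5)[OF p x]]
    by (simp add: mkP_def)
  show "snd (snd (mkP (y x) (V x))) 1 = (fst (snd (mkP (y x) (V x))), fst (snd (mkP (y x) (V x))))"
    by (simp add: mkP_def)
qed

section \<open>The comparison map\<close>

definition node :: "((int \<Rightarrow> 'x) \<times> (nat \<Rightarrow> 'y) \<Rightarrow> real) \<Rightarrow> int \<Rightarrow> 'x \<Rightarrow> real" where
  "node \<zeta> j = push (\<lambda>z. fst z ` {j, j + 1}) \<zeta>"

definition yof :: "((int \<Rightarrow> 'x) \<times> (nat \<Rightarrow> 'y) \<Rightarrow> real) \<Rightarrow> 'y \<Rightarrow> real" where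
  "yof \<zeta> = push (\<lambda>z. snd z ` {0, 1}) \<zeta>"

definition path_of :: "((int \<Rightarrow> 'x) \<times> (nat \<Rightarrow> 'y) \<Rightarrow> real) \<Rightarrow> real \<Rightarrow> 'x \<Rightarrow> real" where
  "path_of \<zeta> = interp (node \<zeta>)"

definition compare :: "_ \<Rightarrow> _" where
  "compare \<alpha> = mkP (yof (PZ.coord \<alpha>)) (path_of (PZ.coord \<alpha>))"

definition stage :: "int \<Rightarrow> ((int \<Rightarrow> 'x) \<times> (nat \<Rightarrow> 'y) \<Rightarrow> real) \<Rightarrow> bool" where
  "stage M \<zeta> \<longleftrightarrow> (\<forall>z. \<zeta> z \<noteq> 0 \<longrightarrow> zvert M z)"

abbreviation "FZ \<equiv> fuzzy cliques"

lemma FZ: 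
  assumes "\<zeta> \<in> FZ"
  shows "finite {z. \<zeta> z \<noteq> 0}" "0 \<le> \<zeta> z" "\<zeta> z \<le> 1" "{z. \<zeta> z \<noteq> 0} \<in> cliques"
  using fuzzy_finite_support'[OF clique_convex_sets assms] fuzzyD[OF assms] by auto

lemma push_supportZ:
  assumes "\<zeta> \<in> FZ"
  shows "{v. push R \<zeta> v \<noteq> 0} = (\<Union>z\<in>{z. \<zeta> z \<noteq> 0}. R z)"
  unfolding push_support[OF FZ(1,2)[OF assms]] by blast

lemma node_fuzzy: "\<zeta> \<in> FZ \<Longrightarrow> node \<zeta> j \<in> fuzzy SX"
  unfolding node_def by (rule push_fuzzy[OF clique_convex_sets clique_window[of _ "{j, j + 1}" j j]]) auto

lemma node_bounds: "\<zeta> \<in> FZ \<Longrightarrow> 0 \<le> node \<zeta> j v \<and> node \<zeta> j v \<le> 1"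
  by (rule fuzzy_bounds[OF node_fuzzy])

lemma yof_fuzzy: "\<zeta> \<in> FZ \<Longrightarrow> yof \<zeta> \<in> fuzzy SY"
  unfolding yof_def by (rule push_fuzzy[OF clique_convex_sets clique_Y])

lemma zvert_ends:
  assumes "zvert M z"
  shows "j \<le> - M \<Longrightarrow> fst z ` {j, j + 1} = f ` snd z ` {0, 1}" "j \<ge> M \<Longrightarrow> fst z ` {j, j + 1} = g ` snd z ` {0, 1}"
proof -
  have par: "{par j, par (j + 1)} = {0, 1}" using par_even[of j] par_even[of "j + 1"] by (cases "even j") auto
  have "fst z ` {j, j + 1} = h ` snd z ` {par j, par (j + 1)}" if "\<And>i. i \<in> {j, j + 1} \<Longrightarrow> fst z i = h (snd z (par i))" for h
    using that by auto
  moreover have "fst z i = f (snd z (par i))" if "j \<le> - M" "i \<in> {j, j + 1}" for i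
    using assms that by (auto simp: zvert_def)
  moreover have "fst z i = g (snd z (par i))" if "j \<ge> M" "i \<in> {j, j + 1}" for i
    using assms that by (auto simp: zvert_def)
  ultimately show "j \<le> - M \<Longrightarrow> fst z ` {j, j + 1} = f ` snd z ` {0, 1}" "j \<ge> M \<Longrightarrow> fst z ` {j, j + 1} = g ` snd z ` {0, 1}"
    unfolding par by blast+
qed

lemma node_ends:
  assumes \<zeta>: "\<zeta> \<in> FZ" and M: "stage M \<zeta>"
  shows "j \<le> - M \<Longrightarrow> node \<zeta> j = pushv f (yof \<zeta>)" "j \<ge> M \<Longrightarrow> node \<zeta> j = pushv g (yof \<zeta>)"
proof -
  have "pushv h (yof \<zeta>) = push (\<lambda>z. h ` snd z ` {0, 1}) \<zeta>" for h :: "'y \<Rightarrow> 'x"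
  proof -
    have "pushv h (yof \<zeta>) = push (\<lambda>z. \<Union>y\<in>snd z ` {0, 1}. {h y}) \<zeta>"
      unfolding yof_def by (rule push_push[OF FZ(1,2)[OF \<zeta>]]) simp
    also have "(\<lambda>z. \<Union>y\<in>snd z ` {0, 1}. {h y}) = (\<lambda>z::(int \<Rightarrow> 'x) \<times> (nat \<Rightarrow> 'y). h ` snd z ` {0, 1})"
      by (rule ext) blast
    finally show ?thesis .
  qed
  note y = this
  have n: "node \<zeta> j = push (\<lambda>z. h ` snd z ` {0, 1}) \<zeta>"
    if "\<And>z. zvert M z \<Longrightarrow> fst z ` {j, j + 1} = h ` snd z ` {0, 1}" for h :: "'y \<Rightarrow> 'x"
    unfolding node_def
  proof (rule push_cong[OF FZ(1,2)[OF \<zeta>]])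
    fix w assume "\<zeta> w \<noteq> 0"
    then have "zvert M w" using M unfolding stage_def by blast
    then show "fst w ` {j, j + 1} = h ` snd w ` {0, 1}" by (rule that)
  qed
  show "node \<zeta> j = pushv f (yof \<zeta>)" if "j \<le> - M"
    unfolding y by (rule n) (rule zvert_ends(1)[OF _ that])
  show "node \<zeta> j = pushv g (yof \<zeta>)" if "j \<ge> M"
    unfolding y by (rule n) (rule zvert_ends(2)[OF _ that])
qed

text \<open>Three integers span the two edges \<open>{j, j + 1}\<close> and
  \<open>{j + 1, j + 2}\<close>, so the star carries the path on the whole unit interval from node
  \<open>j\<close> to node \<open>j + 1\<close>. Being a member of \<open>SX\<close>, it makes fuzzy
  sets supported in it contiguous to each other.\<close>

definition star :: "((int \<Rightarrow> 'x) \<times> (nat \<Rightarrow> 'y) \<Rightarrow> real) \<Rightarrow> int \<Rightarrow> 'x set" where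
  "star \<zeta> j = (\<Union>z\<in>{z. \<zeta> z \<noteq> 0}. fst z ` {j..j + 2})"

lemma star_in: "\<zeta> \<in> FZ \<Longrightarrow> star \<zeta> j \<in> SX"
  unfolding star_def by (rule clique_window[OF FZ(4), where j = j and i = j]) auto

lemma star_contiguous:
  assumes \<zeta>: "\<zeta> \<in> FZ" and l: "l \<in> fuzzy SX" "{v. l v \<noteq> 0} \<subseteq> star \<zeta> j" "A \<subseteq> star \<zeta> j"
  shows "A \<union> {v. l v \<noteq> 0} \<in> SX"
  by (rule bip_sets_convex[OF fuzzyD(4)[OF l(1)] star_in[OF \<zeta>]]) (use l in auto)

lemma node_support: "\<zeta> \<in> FZ \<Longrightarrow> {v. node \<zeta> i v \<noteq> 0} = (\<Union>z\<in>{z. \<zeta> z \<noteq> 0}. fst z ` {i, i + 1})"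
  unfolding node_def by (rule push_supportZ)

lemma node_star: "\<zeta> \<in> FZ \<Longrightarrow> i = j \<or> i = j + 1 \<Longrightarrow> {v. node \<zeta> i v \<noteq> 0} \<subseteq> star \<zeta> j"
  unfolding star_def node_support by (intro UN_mono image_mono) auto

lemma path_of_support:
  assumes "\<zeta> \<in> FZ"
  shows "{v. path_of \<zeta> t v \<noteq> 0} \<subseteq> (\<Union>z\<in>{z. \<zeta> z \<noteq> 0}. fst z ` {\<lfloor>t\<rfloor>..\<lfloor>t\<rfloor> + 2})"
proof -
  have "{v. path_of \<zeta> t v \<noteq> 0} \<subseteq> {v. node \<zeta> \<lfloor>t\<rfloor> v \<noteq> 0} \<union> {v. node \<zeta> (\<lfloor>t\<rfloor> + 1) v \<noteq> 0}"
  proof clarify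
    fix v assume "path_of \<zeta> t v \<noteq> 0" and "node \<zeta> (\<lfloor>t\<rfloor> + 1) v = 0"
    then show "node \<zeta> \<lfloor>t\<rfloor> v = 0 \<Longrightarrow> False"
      using interp_support[of "node \<zeta>" t v] node_bounds[OF assms] by (simp add: path_of_def)
  qed
  then show ?thesis using node_star[OF assms, of "\<lfloor>t\<rfloor>" "\<lfloor>t\<rfloor>"] node_star[OF assms, of "\<lfloor>t\<rfloor> + 1" "\<lfloor>t\<rfloor>"]
    unfolding star_def by blast
qed

text \<open>The right end is included: the floor jumps at \<open>t = j + 1\<close>, but there the
  path is the single node \<open>j + 1\<close>, which still lies in the star.\<close>

lemma path_of_star:
  assumes \<zeta>: "\<zeta> \<in> FZ" and t: "real_of_int j \<le> t" "t \<le> real_of_int j + 1"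
  shows "{v. path_of \<zeta> t v \<noteq> 0} \<subseteq> star \<zeta> j"
proof (cases "t = real_of_int j + 1")
  case True
  then have "path_of \<zeta> t = node \<zeta> (j + 1)"
    unfolding path_of_def using interp_of_int[of "node \<zeta>" "j + 1", OF node_bounds[OF \<zeta>]] by simp
  then show ?thesis using node_star[OF \<zeta>, of "j + 1" j] by simp
next
  case False
  then have "\<lfloor>t\<rfloor> = j" using t by (simp add: floor_eq_iff)
  then show ?thesis using path_of_support[OF \<zeta>, of t] by (simp add: star_def)
qed

lemma pdat_path_of:
  assumes \<zeta>: "fuzzy_map K cliques \<zeta>" and M: "\<And>x. x \<in> topspace K \<Longrightarrow> stage (int M) (\<zeta> x)"
  shows "pdat K (real M) (\<lambda>x. yof (\<zeta> x)) (\<lambda>x. path_of (\<zeta> x))"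
  unfolding pdat_def
proof (intro conjI ballI allI impI)
  show "fuzzy_map K SY (\<lambda>x. yof (\<zeta> x))"
    unfolding yof_def by (rule fuzzy_map_push[OF clique_convex_sets clique_Y \<zeta>]) auto
  have z: "\<zeta> x \<in> FZ" if "x \<in> topspace K" for x using fuzzy_mapD(1)[OF \<zeta> that] .
  have nm: "fuzzy_map K SX (\<lambda>x. node (\<zeta> x) j)" for j
    unfolding node_def by (rule fuzzy_map_push[OF clique_convex_sets clique_window[of _ "{j, j + 1}" j j] \<zeta>]) auto
  show "fuzzy_map (prod_topology K euclideanreal) SX (\<lambda>(x, t). path_of (\<zeta> x) t)"
    unfolding path_of_def
  proof (rule fuzzy_map_interp[OF convSX nm, where B = M])
    fix x j assume x: "x \<in> topspace K"
    show "{v. node (\<zeta> x) j v \<noteq> 0} \<union> {v. node (\<zeta> x) (j + 1) v \<noteq> 0} \<in> SX"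
      by (rule star_contiguous[OF z[OF x], of _ j]) (use z[OF x] node_fuzzy node_star in auto)
    show "j \<le> - int M \<Longrightarrow> node (\<zeta> x) j = node (\<zeta> x) (- int M)"
      using node_ends(1)[OF z[OF x] M[OF x]] by simp
    show "j \<ge> int M \<Longrightarrow> node (\<zeta> x) j = node (\<zeta> x) (int M)"
      using node_ends(2)[OF z[OF x] M[OF x]] by simp
  qed
  fix x assume x: "x \<in> topspace K"
  have e: "node (\<zeta> x) j = node (\<zeta> x) (- int M)" if "j \<le> - int M" for j
    using node_ends(1)[OF z[OF x] M[OF x]] that by simp
  have e': "node (\<zeta> x) j = node (\<zeta> x) (int M)" if "j \<ge> int M" for j
    using node_ends(2)[OF z[OF x] M[OF x]] that by simp
  show "path_of (\<zeta> x) t = pushv f (yof (\<zeta> x))" if "t \<le> - real M" for t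
    using interp_clamp(1)[of "node (\<zeta> x)" M t, OF node_bounds[OF z[OF x]] e e' that] node_ends(1)[OF z[OF x] M[OF x], of "- int M"]
    by (simp add: path_of_def)
  show "path_of (\<zeta> x) t = pushv g (yof (\<zeta> x))" if "t \<ge> real M" for t
    using interp_clamp(2)[of "node (\<zeta> x)" M t, OF node_bounds[OF z[OF x]] e e' that] node_ends(2)[OF z[OF x] M[OF x], of "int M"]
    by (simp add: path_of_def)
qed

text \<open>Each vertex has a bound of its own; the finite common support makes it uniform.\<close>

lemma stage_exists:
  assumes \<zeta>: "fuzzy_map K cliques \<zeta>"
  obtains M :: nat where "\<And>x. x \<in> topspace K \<Longrightarrow> stage (int M) (\<zeta> x)"
proof -
  obtain V where V: "finite V" "\<And>x. x \<in> topspace K \<Longrightarrow> {z. \<zeta> x z \<noteq> 0} \<subseteq> V"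
    using fuzzy_map_support[OF \<zeta>] by blast
  define m where "m z = (SOME M. zvert M z)" for z
  have m: "zvert (m z) z" if "z \<in> verts Z" for z
    unfolding m_def using that verts_Z someI_ex[of "\<lambda>M. zvert M z"] by blast
  define M where "M = nat (Max (insert 0 (m ` V)))"
  have le: "m z \<le> int M" if "z \<in> V" for z
  proof -
    have "m z \<le> Max (insert 0 (m ` V))" "0 \<le> Max (insert 0 (m ` V))" using V(1) that by (auto intro: Max_ge)
    then show ?thesis by (simp add: M_def)
  qed
  have "stage (int M) (\<zeta> x)" if x: "x \<in> topspace K" for x
    unfolding stage_def
  proof (intro allI impI)
    fix z assume z: "\<zeta> x z \<noteq> 0"
    have "z \<in> verts Z" using cliqueD(3)[OF FZ(4)[OF fuzzy_mapD(1)[OF \<zeta> x]]] z by simp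
    moreover have "z \<in> V" using V(2)[OF x] z by blast
    ultimately show "zvert (int M) z" using m le zvert_mono by blast
  qed
  then show ?thesis using that by blast
qed

text \<open>A uniform stage exists on each closed simplex but in general not on the whole
  realization, so continuity is proved on simplices.\<close>

lemma continuous_map_compare: "continuous_map W Hp compare"
proof (rule continuous_map_from_realization)
  fix c :: "((int \<Rightarrow> 'x) \<times> (nat \<Rightarrow> 'y)) set set"
  assume c: "finite c" "c \<noteq> {}" "chain_in cliques (\<subseteq>) c"
  let ?K = "subtopology (powertop_real UNIV) (closed_simplex cliques (\<subseteq>) c)"
  have \<zeta>: "fuzzy_map ?K cliques PZ.coord" using PZ.fuzzy_map_simplex[OF c(1,3)] by simp
  obtain M :: nat where "\<And>x. x \<in> topspace ?K \<Longrightarrow> stage (int M) (PZ.coord x)" using stage_exists[OF \<zeta>] by blast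
  from continuous_map_mkP[OF pdat_path_of[OF \<zeta> this]]
  show "continuous_map ?K Hp compare" unfolding compare_def by simp
qed

lemma compare_uncoord: "\<zeta> \<in> FZ \<Longrightarrow> compare (PZ.uncoord \<zeta>) = mkP (yof \<zeta>) (path_of \<zeta>)"
  by (simp add: compare_def coord_uncoordZ)

definition solvable :: "nat \<Rightarrow> (_ \<Rightarrow> _) \<Rightarrow> (_ \<Rightarrow> _) \<Rightarrow> bool" where
  "solvable n u v \<longleftrightarrow> (\<exists>l. continuous_map (disk n) W l \<and> (\<forall>x\<in>disk_boundary n. l x = u x) \<and>
     homotopic_with (\<lambda>h. \<forall>x\<in>disk_boundary n. h x = v x) (disk n) Hp (compare \<circ> l) v)"

abbreviation "Sph n \<equiv> subtopology (disk n) (disk_boundary n)"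

lemma topspace_Sph [simp]: "topspace (Sph n) = disk_boundary n"
  using disk_boundary_subset by auto

text \<open>The required homotopy between \<open>compare \<circ> G\<close> and the family \<open>(y, V)\<close> on the boundary exists
  because the two families are contiguous.\<close>

lemma solvable_transfer:
  assumes G: "fuzzy_map (prod_topology (Sph n) unit_interval) cliques (\<lambda>(x, s). G x s)"
    and stG: "\<And>x s. x \<in> disk_boundary n \<Longrightarrow> s \<in> {0..1} \<Longrightarrow> stage (int M) (G x s)"
    and p: "pdat (prod_topology (disk n) unit_interval) (real M) (\<lambda>(x, s). y x s) (\<lambda>(x, s). V x s)"
    and cy: "\<And>x s. x \<in> disk_boundary n \<Longrightarrow> s \<in> {0..1} \<Longrightarrow> {v. yof (G x s) v \<noteq> 0} \<union> {v. y x s v \<noteq> 0} \<in> SY"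
    and cV: "\<And>x s t. x \<in> disk_boundary n \<Longrightarrow> s \<in> {0..1} \<Longrightarrow> {v. path_of (G x s) t v \<noteq> 0} \<union> {v. V x s t v \<noteq> 0} \<in> SX"
    and eq: "\<And>x s. x \<in> disk_boundary n \<Longrightarrow> s \<in> {0, 1} \<Longrightarrow> yof (G x s) = y x s"
      "\<And>x s t. x \<in> disk_boundary n \<Longrightarrow> s \<in> {0, 1} \<Longrightarrow> path_of (G x s) t = V x s t"
    and sol: "solvable n (\<lambda>x. PZ.uncoord (G x 0)) (\<lambda>x. mkP (y x 0) (V x 0))"
  shows "solvable n (\<lambda>x. PZ.uncoord (G x 1)) (\<lambda>x. mkP (y x 1) (V x 1))"
proof -
  let ?SI = "prod_topology (Sph n) unit_interval"
  let ?SII = "prod_topology ?SI unit_interval"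
  have GF: "G x s \<in> FZ" if "x \<in> disk_boundary n" "s \<in> {0..1}" for x s
    using fuzzy_mapD(1)[OF G, of "(x, s)"] that disk_boundary_subset by auto
  have pG: "pdat ?SI (real M) (\<lambda>z. yof (G (fst z) (snd z))) (\<lambda>z. path_of (G (fst z) (snd z)))"
  proof (rule pdat_path_of)
    show "fuzzy_map ?SI cliques (\<lambda>z. G (fst z) (snd z))" using G by (simp add: case_prod_unfold)
  qed (use stG in auto)
  have c1: "continuous_map ?SII ?SI fst" by (rule continuous_map_fst)
  have "continuous_map ?SI (prod_topology (disk n) unit_interval) (\<lambda>z. (fst z, snd z))"
    unfolding continuous_map_pairwise o_def fst_conv snd_conv
    using continuous_map_fst[of "Sph n" unit_interval] continuous_map_snd[of "Sph n" unit_interval]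
    by (auto intro: continuous_map_into_fulltopology)
  then have c2: "continuous_map ?SII (prod_topology (disk n) unit_interval) fst"
    using continuous_map_compose[OF c1, of "prod_topology (disk n) unit_interval" "\<lambda>z. z"] by (simp add: o_def)
  have r: "continuous_map ?SII euclideanreal snd"
    unfolding unit_interval_def using continuous_map_snd continuous_map_into_fulltopology by blast
  have p\<Phi>: "pdat ?SII (real M) (\<lambda>z. hom (snd z) (yof (G (fst (fst z)) (snd (fst z)))) ((\<lambda>(x, s). y x s) (fst z)))
     (\<lambda>z t. hom (snd z) (path_of (G (fst (fst z)) (snd (fst z))) t) ((\<lambda>(x, s). V x s) (fst z) t))"
    by (rule pdat_hom[OF pdat_compose[OF pG c1] pdat_compose[OF p c2] r]) (use cy cV in auto)
  have GF': "PZ.uncoord (G x s) \<in> topspace W" if "x \<in> disk_boundary n" "s \<in> {0..1}" for x s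
    using PZ.uncoord_in GF[OF that] by simp
  define yb where "yb = (\<lambda>z r. hom r (yof (G (fst z) (snd z))) (y (fst z) (snd z)))"
  define Vb where "Vb = (\<lambda>z r t. hom r (path_of (G (fst z) (snd z)) t) (V (fst z) (snd z) t))"
  define \<Phi> where "\<Phi> z = mkP (yb (fst z) (snd z)) (Vb (fst z) (snd z))" for z
  have bnd: "0 \<le> yof (G x s) v \<and> yof (G x s) v \<le> 1" "0 \<le> y x s v \<and> y x s v \<le> 1"
    "0 \<le> path_of (G x s) t w \<and> path_of (G x s) t w \<le> 1" "0 \<le> V x s t w \<and> V x s t w \<le> 1"
    if "x \<in> disk_boundary n" "s \<in> {0..1}" for x s v t w
  proof -
    have x: "(x, s) \<in> topspace ?SI" "(x, s) \<in> topspace (prod_topology (disk n) unit_interval)"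
      using that disk_boundary_subset by auto
    have "yof (G x s) \<in> fuzzy SY" "path_of (G x s) t \<in> fuzzy SX"
      using pdatD(5,6)[OF pG x(1)] by simp_all
    moreover have "y x s \<in> fuzzy SY" "V x s t \<in> fuzzy SX"
      using pdatD(5,6)[OF p x(2)] by simp_all
    ultimately show "0 \<le> yof (G x s) v \<and> yof (G x s) v \<le> 1" "0 \<le> y x s v \<and> y x s v \<le> 1"
      "0 \<le> path_of (G x s) t w \<and> path_of (G x s) t w \<le> 1" "0 \<le> V x s t w \<and> V x s t w \<le> 1"
      by (simp_all add: fuzzy_bounds)
  qed
  have "\<exists>l. continuous_map (disk n) W l \<and> (\<forall>x\<in>disk_boundary n. l x = (\<lambda>(x, s). PZ.uncoord (G x s)) (x, 1)) \<and>
      homotopic_with (\<lambda>h. \<forall>x\<in>disk_boundary n. h x = (\<lambda>(x, s). mkP (y x s) (V x s)) (x, 1)) (disk n) Hp (compare \<circ> l)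
        (\<lambda>x. (\<lambda>(x, s). mkP (y x s) (V x s)) (x, 1))"
  proof -
    from sol[unfolded solvable_def]
    obtain l0 where l0: "continuous_map (disk n) W l0 \<and> (\<forall>x\<in>disk_boundary n. l0 x = PZ.uncoord (G x 0)) \<and>
      homotopic_with (\<lambda>h. \<forall>x\<in>disk_boundary n. h x = mkP (y x 0) (V x 0)) (disk n) Hp (compare \<circ> l0) (\<lambda>x. mkP (y x 0) (V x 0))"
      by (rule exE)
    show ?thesis
    proof (rule lift_transfer[OF continuous_map_compare, where \<Phi> = \<Phi> and ?l0.0 = l0])
      show "continuous_map ?SI W (\<lambda>(x, s). PZ.uncoord (G x s))"
        using uncoordZ[OF G] by (simp add: case_prod_unfold)
      show "continuous_map (prod_topology (disk n) unit_interval) Hp (\<lambda>(x, s). mkP (y x s) (V x s))"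
        using continuous_map_mkP[OF p] by (simp add: case_prod_unfold)
      show "continuous_map ?SII Hp \<Phi>"
        unfolding \<Phi>_def yb_def Vb_def using continuous_map_mkP[OF p\<Phi>] by (simp add: case_prod_unfold)
      fix x s assume x: "x \<in> disk_boundary n" and s: "s \<in> {0..1::real}"
      have "yb (x, s) 0 = yof (G x s)" "Vb (x, s) 0 = path_of (G x s)"
        unfolding yb_def Vb_def using bnd[OF x s] by (auto simp: hom_0)
      then show "\<Phi> ((x, s), 0) = compare ((\<lambda>(x, s). PZ.uncoord (G x s)) (x, s))"
        using compare_uncoord[OF GF[OF x s]] by (simp add: \<Phi>_def)
      have "yb (x, s) 1 = y x s" "Vb (x, s) 1 = V x s"
        unfolding yb_def Vb_def using bnd[OF x s] by (auto simp: hom_1)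
      then show "\<Phi> ((x, s), 1) = (\<lambda>(x, s). mkP (y x s) (V x s)) (x, s)" by (simp add: \<Phi>_def)
      \<comment> \<open>The two families agree at both ends, so \<open>hom\<close> is constant in
        its parameter: the stationarity required by \<open>lift_transfer\<close>.\<close>
      have e: "\<Phi> ((x, a), s) = mkP (y x a) (V x a)" if "a \<in> {0, 1}" for a
      proof -
        have a: "a \<in> {0..1}" using that by auto
        have "yb (x, a) s = y x a" "Vb (x, a) s = V x a"
          unfolding yb_def Vb_def using bnd[OF x a] eq(1)[OF x that] eq(2)[OF x that] by (auto simp: hom_same)
        then show ?thesis by (simp add: \<Phi>_def)
      qed
      show "\<Phi> ((x, 0), s) = (\<lambda>(x, s). mkP (y x s) (V x s)) (x, 0)" using e[of 0] by simp
      show "\<Phi> ((x, 1), s) = (\<lambda>(x, s). mkP (y x s) (V x s)) (x, 1)" using e[of 1] by simp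
    qed (use l0 in auto)
  qed
  then show ?thesis unfolding solvable_def by simp
qed

end

section \<open>Walks on the integers\<close>

text \<open>Precomposition with such a map turns vertices of stage \<open>M\<close> into vertices of
  stage \<open>B\<close>: parity keeps the colours, and the last two conditions send the outer range
  of \<open>B\<close> into that of \<open>M\<close> on the same side. Unit steps make it a graph
  map.\<close>

definition walk :: "int \<Rightarrow> int \<Rightarrow> (int \<Rightarrow> int) \<Rightarrow> bool" where
  "walk M B \<kappa> \<longleftrightarrow> (\<forall>i. \<bar>\<kappa> (i + 1) - \<kappa> i\<bar> = 1) \<and> (\<forall>i. even (\<kappa> i - i)) \<and>
     (\<forall>i\<le>1 - B. \<kappa> i \<le> 1 - M) \<and> (\<forall>i\<ge>B. \<kappa> i \<ge> M)"

text \<open>Adjacency in the exponential graph of maps of the infinite path to itself. It makes the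
  two reparametrizations of a clique, taken together, a clique again.\<close>

definition adj :: "(int \<Rightarrow> int) \<Rightarrow> (int \<Rightarrow> int) \<Rightarrow> bool" where
  "adj \<kappa> \<kappa>' \<longleftrightarrow> (\<forall>i j. \<bar>i - j\<bar> = 1 \<longrightarrow> \<bar>\<kappa> i - \<kappa>' j\<bar> = 1)"

definition edge :: "(int \<Rightarrow> int) \<Rightarrow> int \<Rightarrow> int" where
  "edge \<kappa> i = min (\<kappa> i) (\<kappa> (i + 1))"

text \<open>The piecewise linear motion of a walk along its edges, the edge \<open>{e, e + 1}\<close> being at position \<open>e\<close>.\<close>

definition pos :: "(int \<Rightarrow> int) \<Rightarrow> real \<Rightarrow> real" where
  "pos \<kappa> t = (1 - (t - \<lfloor>t\<rfloor>)) * real_of_int (edge \<kappa> \<lfloor>t\<rfloor>) + (t - \<lfloor>t\<rfloor>) * real_of_int (edge \<kappa> (\<lfloor>t\<rfloor> + 1))"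

lemma walkD:
  assumes "walk M B \<kappa>"
  shows "\<bar>\<kappa> (i + 1) - \<kappa> i\<bar> = 1" "even (\<kappa> i - i)" "i \<le> 1 - B \<Longrightarrow> \<kappa> i \<le> 1 - M" "i \<ge> B \<Longrightarrow> \<kappa> i \<ge> M"
  using assms by (auto simp: walk_def)

lemma adj_sym: "adj \<kappa> \<kappa>' \<Longrightarrow> adj \<kappa>' \<kappa>"
  unfolding adj_def by (metis abs_minus_commute)

lemma walk_adj: "walk M B \<kappa> \<Longrightarrow> adj \<kappa> \<kappa>"
  unfolding adj_def
proof (intro allI impI)
  fix i j :: int assume w: "walk M B \<kappa>" and ij: "\<bar>i - j\<bar> = 1"
  then have "i = j + 1 \<or> j = i + 1" by linarith
  then show "\<bar>\<kappa> i - \<kappa> j\<bar> = 1" using walkD(1)[OF w, of i] walkD(1)[OF w, of j] by auto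
qed

lemma edge_pair: "walk M B \<kappa> \<Longrightarrow> {\<kappa> i, \<kappa> (i + 1)} = {edge \<kappa> i, edge \<kappa> i + 1}"
  using walkD(1)[of M B \<kappa> i] by (auto simp: edge_def min_def abs_if split: if_splits)

lemma edge_step: "walk M B \<kappa> \<Longrightarrow> \<bar>edge \<kappa> i - edge \<kappa> (i + 1)\<bar> \<le> 1"
  using walkD(1)[of M B \<kappa> i] walkD(1)[of M B \<kappa> "i + 1"] by (simp add: edge_def)

lemma frac_bounds: "0 \<le> t - real_of_int \<lfloor>t\<rfloor>" "t - real_of_int \<lfloor>t\<rfloor> \<le> 1"
  by linarith+

lemma pos_ends:
  assumes w: "walk M B \<kappa>"
  shows "t \<le> - real_of_int (B + 1) \<Longrightarrow> pos \<kappa> t \<le> - real_of_int M" "t \<ge> real_of_int B \<Longrightarrow> pos \<kappa> t \<ge> real_of_int M"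
proof -
  assume t: "t \<le> - real_of_int (B + 1)"
  have "edge \<kappa> i \<le> - M" if "i \<le> - B" for i
    using walkD(3)[OF w, of i] walkD(3)[OF w, of "i + 1"] walkD(1)[OF w, of i] that by (auto simp: edge_def)
  \<comment> \<open>\<open>pos\<close> also reads the edge after \<open>\<lfloor>t\<rfloor>\<close>,
    and both have to lie at or below \<open>-B\<close>. Hence \<open>B + 1\<close> on this side, and
    in all later bounds.\<close>
  moreover have "\<lfloor>t\<rfloor> \<le> - B - 1" using t by linarith
  ultimately have "edge \<kappa> \<lfloor>t\<rfloor> \<le> - M" "edge \<kappa> (\<lfloor>t\<rfloor> + 1) \<le> - M" by auto
  then have "real_of_int (edge \<kappa> \<lfloor>t\<rfloor>) \<le> - real_of_int M" "real_of_int (edge \<kappa> (\<lfloor>t\<rfloor> + 1)) \<le> - real_of_int M" by linarith+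
  then show "pos \<kappa> t \<le> - real_of_int M"
    unfolding pos_def using frac_bounds[of t] by (intro convex_bound_le) auto
next
  assume t: "t \<ge> real_of_int B"
  have "edge \<kappa> i \<ge> M" if "i \<ge> B" for i
    using walkD(4)[OF w, of i] walkD(4)[OF w, of "i + 1"] that by (auto simp: edge_def)
  moreover have "\<lfloor>t\<rfloor> \<ge> B" using t by linarith
  ultimately have "edge \<kappa> \<lfloor>t\<rfloor> \<ge> M" "edge \<kappa> (\<lfloor>t\<rfloor> + 1) \<ge> M" by auto
  then have "- real_of_int (edge \<kappa> \<lfloor>t\<rfloor>) \<le> - real_of_int M" "- real_of_int (edge \<kappa> (\<lfloor>t\<rfloor> + 1)) \<le> - real_of_int M" by linarith+
  then have "(1 - (t - \<lfloor>t\<rfloor>)) * (- real_of_int (edge \<kappa> \<lfloor>t\<rfloor>)) + (t - \<lfloor>t\<rfloor>) * (- real_of_int (edge \<kappa> (\<lfloor>t\<rfloor> + 1))) \<le> - real_of_int M"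
    using frac_bounds[of t] by (intro convex_bound_le) auto
  then show "pos \<kappa> t \<ge> real_of_int M" unfolding pos_def by (simp add: algebra_simps)
qed

text \<open>With hat functions centred at the integers the floor disappears, which gives continuity
  on every bounded interval.\<close>

lemma pos_sum:
  assumes "- real C \<le> t" "t \<le> real C"
  shows "pos \<kappa> t = (\<Sum>j\<in>{- int C..int C + 1}. real_of_int (edge \<kappa> j) * max 0 (1 - \<bar>t - real_of_int j\<bar>))"
proof -
  let ?i = "\<lfloor>t\<rfloor>"
  have i: "- int C \<le> ?i" "?i \<le> int C" using assms by (simp_all add: le_floor_iff floor_le_iff)
  have f: "real_of_int ?i \<le> t" "t < real_of_int ?i + 1" by linarith+
  have "(\<Sum>j\<in>{- int C..int C + 1}. real_of_int (edge \<kappa> j) * max 0 (1 - \<bar>t - real_of_int j\<bar>)) =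
      (\<Sum>j\<in>{?i, ?i + 1}. real_of_int (edge \<kappa> j) * max 0 (1 - \<bar>t - real_of_int j\<bar>))"
  proof (rule sum.mono_neutral_right)
    show "\<forall>j\<in>{- int C..int C + 1} - {?i, ?i + 1}. real_of_int (edge \<kappa> j) * max 0 (1 - \<bar>t - real_of_int j\<bar>) = 0"
    proof
      fix j assume "j \<in> {- int C..int C + 1} - {?i, ?i + 1}"
      then have "j \<noteq> ?i" "j \<noteq> ?i + 1" by auto
      then have "\<bar>t - real_of_int j\<bar> \<ge> 1" using f by linarith
      then show "real_of_int (edge \<kappa> j) * max 0 (1 - \<bar>t - real_of_int j\<bar>) = 0" by simp
    qed
  qed (use i in auto)
  also have "\<dots> = real_of_int (edge \<kappa> ?i) * (1 - (t - ?i)) + real_of_int (edge \<kappa> (?i + 1)) * (t - ?i)"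
  proof -
    have two: "(\<Sum>j\<in>{?i, ?i + 1}. h j) = h ?i + h (?i + 1)" for h :: "int \<Rightarrow> real" by simp
    have "max 0 (1 - \<bar>t - real_of_int ?i\<bar>) = 1 - (t - real_of_int ?i)" "max 0 (1 - \<bar>t - real_of_int (?i + 1)\<bar>) = t - real_of_int ?i"
      using f by linarith+
    then show ?thesis by (simp only: two)
  qed
  finally show ?thesis by (simp add: pos_def algebra_simps)
qed

lemma continuous_on_pos: "continuous_on UNIV (pos \<kappa>)"
proof -
  have "continuous_on {- real C<..<real C} (pos \<kappa>)" for C
  proof (rule continuous_on_eq)
    show "continuous_on {- real C<..<real C} (\<lambda>t. \<Sum>j\<in>{- int C..int C + 1}. real_of_int (edge \<kappa> j) * max 0 (1 - \<bar>t - real_of_int j\<bar>))"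
      by (intro continuous_intros)
    show "(\<Sum>j\<in>{- int C..int C + 1}. real_of_int (edge \<kappa> j) * max 0 (1 - \<bar>t - real_of_int j\<bar>)) = pos \<kappa> t"
      if "t \<in> {- real C<..<real C}" for t
      by (rule pos_sum[symmetric]) (use that in auto)
  qed
  then have "continuous_on (\<Union>C. {- real C<..<real C}) (pos \<kappa>)"
    by (intro continuous_on_open_UN) auto
  moreover have "(\<Union>C. {- real C<..<real C}) = UNIV"
  proof -
    have "\<exists>C. t \<in> {- real C<..<real C}" for t
      using reals_Archimedean2[of "\<bar>t\<bar>"] by (auto simp: abs_less_iff) (metis minus_less_iff)
    then show ?thesis by auto
  qed
  ultimately show ?thesis by simp
qed

text \<open>If the middle values agree, all four neighbouring values are within 1 of it. Otherwise
  the middle values differ by 2 and the neighbouring values of both walks are the integer between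
  them.\<close>

lemma walk_window:
  assumes w: "walk M B \<kappa>" "walk M B \<kappa>'" and a: "adj \<kappa> \<kappa>'"
  obtains j where "\<And>l. l \<in> {i..i + 2} \<Longrightarrow> \<kappa> l \<in> {j..j + 2} \<and> \<kappa>' l \<in> {j..j + 2}"
proof -
  have s: "\<bar>\<kappa> (i + 1) - \<kappa> i\<bar> = 1" "\<bar>\<kappa> (i + 2) - \<kappa> (i + 1)\<bar> = 1" "\<bar>\<kappa>' (i + 1) - \<kappa>' i\<bar> = 1" "\<bar>\<kappa>' (i + 2) - \<kappa>' (i + 1)\<bar> = 1"
    using walkD(1)[OF w(1), of i] walkD(1)[OF w(1), of "i + 1"] walkD(1)[OF w(2), of i] walkD(1)[OF w(2), of "i + 1"]
    by (simp_all add: add.assoc)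
  have c: "\<bar>\<kappa> i - \<kappa>' (i + 1)\<bar> = 1" "\<bar>\<kappa> (i + 1) - \<kappa>' i\<bar> = 1" "\<bar>\<kappa> (i + 2) - \<kappa>' (i + 1)\<bar> = 1" "\<bar>\<kappa> (i + 1) - \<kappa>' (i + 2)\<bar> = 1"
    using a unfolding adj_def by auto
  define j where "j = (if \<kappa> (i + 1) = \<kappa>' (i + 1) then \<kappa> (i + 1) - 1 else min (\<kappa> (i + 1)) (\<kappa>' (i + 1)))"
  have "\<kappa> l \<in> {j..j + 2} \<and> \<kappa>' l \<in> {j..j + 2}" if "l \<in> {i, i + 1, i + 2}" for l
    using that s c unfolding j_def by (elim insertE) (auto simp: abs_if split: if_splits)
  moreover have "{i..i + 2} = {i, i + 1, i + 2}" by auto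
  ultimately show ?thesis using that by auto
qed

lemma pos_window:
  assumes w: "walk M B \<kappa>" and j: "\<And>l. l \<in> {\<lfloor>t\<rfloor>..\<lfloor>t\<rfloor> + 2} \<Longrightarrow> \<kappa> l \<in> {j..j + 2}"
  shows "real_of_int j \<le> pos \<kappa> t" "pos \<kappa> t \<le> real_of_int j + 1"
proof -
  have "edge \<kappa> l \<in> {j..j + 1}" if "l \<in> {\<lfloor>t\<rfloor>, \<lfloor>t\<rfloor> + 1}" for l
    using j[of l] j[of "l + 1"] that walkD(1)[OF w, of l] by (auto simp: edge_def)
  then have e: "edge \<kappa> \<lfloor>t\<rfloor> \<in> {j..j + 1}" "edge \<kappa> (\<lfloor>t\<rfloor> + 1) \<in> {j..j + 1}" by auto
  then show "pos \<kappa> t \<le> real_of_int j + 1"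
    unfolding pos_def using frac_bounds[of t] by (intro convex_bound_le) auto
  have "(1 - (t - \<lfloor>t\<rfloor>)) * (- real_of_int (edge \<kappa> \<lfloor>t\<rfloor>)) + (t - \<lfloor>t\<rfloor>) * (- real_of_int (edge \<kappa> (\<lfloor>t\<rfloor> + 1))) \<le> - real_of_int j"
    using e frac_bounds[of t] by (intro convex_bound_le) auto
  then show "real_of_int j \<le> pos \<kappa> t" unfolding pos_def by (simp add: algebra_simps)
qed

text \<open>Raising a local minimum of the lower walk by 2 brings it closer to the upper one.\<close>

lemma walk_induct_le:
  assumes step: "\<And>\<kappa> \<kappa>'. walk M B \<kappa> \<Longrightarrow> walk M B \<kappa>' \<Longrightarrow> adj \<kappa> \<kappa>' \<Longrightarrow> P \<kappa> \<Longrightarrow> P \<kappa>'"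
    and "walk M B \<kappa>" "walk M B \<kappa>'" "\<And>i. \<kappa> i \<le> \<kappa>' i" "\<And>i. i \<notin> {- C..C} \<Longrightarrow> \<kappa> i = \<kappa>' i" "P \<kappa>"
  shows "P \<kappa>'"
  using assms(2-)
proof (induction "nat (\<Sum>i\<in>{- C..C}. \<kappa>' i - \<kappa> i)" arbitrary: \<kappa> rule: less_induct)
  case less
  note w = less.prems(1) and w' = less.prems(2) and le = less.prems(3) and out = less.prems(4)
  define D where "D = {i. \<kappa> i \<noteq> \<kappa>' i}"
  have DC: "D \<subseteq> {- C..C}" using out unfolding D_def by blast
  show ?case
  proof (cases "D = {}")
    case True
    then have "\<kappa> = \<kappa>'" by (auto simp: D_def)
    then show ?thesis using less.prems(5) by simp
  next
    case False
    have "finite D" using DC finite_subset by blast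
    then have "Min (\<kappa> ` D) \<in> \<kappa> ` D" using False by simp
    then obtain i where i: "i \<in> D" "\<kappa> i = Min (\<kappa> ` D)" by auto
    have min: "\<kappa> i \<le> \<kappa> j" if "j \<in> D" for j using i(2) that \<open>finite D\<close> by simp
    have lt: "\<kappa> i + 2 \<le> \<kappa>' i"
    proof -
      have "\<kappa> i < \<kappa>' i" using i(1) le[of i] by (simp add: D_def)
      moreover have "even (\<kappa>' i - \<kappa> i)" using walkD(2)[OF w, of i] walkD(2)[OF w', of i] by presburger
      ultimately show ?thesis by presburger
    qed
    \<comment> \<open>Choosing the lowest place of disagreement makes \<open>i\<close> a local
      minimum: a neighbour at height \<open>\<kappa> i - 1\<close> would lie strictly below
      \<open>\<kappa>'\<close>, which is at least \<open>\<kappa> i + 1\<close> there, and would be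
      a lower place of disagreement.\<close>
    have nb: "\<kappa> j = \<kappa> i + 1" if "\<bar>i - j\<bar> = 1" for j
    proof -
      have a: "\<bar>\<kappa> i - \<kappa> j\<bar> = 1" "\<bar>\<kappa>' i - \<kappa>' j\<bar> = 1"
        using walk_adj[OF w] walk_adj[OF w'] that unfolding adj_def by blast+
      show ?thesis
      proof (rule ccontr)
        assume "\<kappa> j \<noteq> \<kappa> i + 1"
        then have "\<kappa> j = \<kappa> i - 1" "\<kappa> j < \<kappa>' j" using a lt by linarith+
        then show False using min[of j] by (simp add: D_def)
      qed
    qed
    define \<mu> where "\<mu> = \<kappa>(i := \<kappa> i + 2)"
    have wm: "walk M B \<mu>"
      unfolding walk_def
    proof (intro conjI allI impI)
      show "\<bar>\<mu> (k + 1) - \<mu> k\<bar> = 1" for k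
        using nb[of "i + 1"] nb[of "i - 1"] walkD(1)[OF w, of k] by (auto simp: \<mu>_def)
      show "even (\<mu> k - k)" for k using walkD(2)[OF w, of k] by (auto simp: \<mu>_def)
      show "\<mu> k \<le> 1 - M" if "k \<le> 1 - B" for k
        using walkD(3)[OF w that] walkD(3)[OF w' that] lt by (auto simp: \<mu>_def)
      show "\<mu> k \<ge> M" if "k \<ge> B" for k
        using walkD(4)[OF w that] by (auto simp: \<mu>_def)
    qed
    have am: "adj \<kappa> \<mu>"
      unfolding adj_def
    proof (intro allI impI)
      fix a b :: int assume ab: "\<bar>a - b\<bar> = 1"
      show "\<bar>\<kappa> a - \<mu> b\<bar> = 1"
      proof (cases "b = i")
        case True
        then show ?thesis using nb[of a] ab by (simp add: \<mu>_def)
      next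
        case False
        then show ?thesis using walk_adj[OF w] ab by (simp add: \<mu>_def adj_def)
      qed
    qed
    have "(\<Sum>k\<in>{- C..C}. \<kappa>' k - \<mu> k) < (\<Sum>k\<in>{- C..C}. \<kappa>' k - \<kappa> k)"
    proof (rule sum_strict_mono_ex1)
      show "\<exists>k\<in>{- C..C}. \<kappa>' k - \<mu> k < \<kappa>' k - \<kappa> k"
        using i(1) DC by (intro bexI[of _ i]) (auto simp: \<mu>_def)
    qed (auto simp: \<mu>_def)
    moreover have "0 \<le> (\<Sum>k\<in>{- C..C}. \<kappa>' k - \<mu> k)"
      using le lt by (intro sum_nonneg) (auto simp: \<mu>_def)
    ultimately have "nat (\<Sum>k\<in>{- C..C}. \<kappa>' k - \<mu> k) < nat (\<Sum>k\<in>{- C..C}. \<kappa>' k - \<kappa> k)" by simp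
    moreover have "\<mu> k \<le> \<kappa>' k" for k using le lt by (simp add: \<mu>_def)
    moreover have "\<mu> k = \<kappa>' k" if "k \<notin> {- C..C}" for k using out[OF that] i(1) DC that by (auto simp: \<mu>_def)
    ultimately show ?thesis using less.hyps[of \<mu>] wm w' step[OF w wm am less.prems(5)] by blast
  qed
qed

lemma walk_min:
  assumes w: "walk M B \<kappa>" "walk M B \<kappa>'"
  shows "walk M B (\<lambda>i. min (\<kappa> i) (\<kappa>' i))"
  unfolding walk_def
proof (intro conjI allI impI)
  fix i
  have "even (\<kappa>' i - \<kappa> i)" "even (\<kappa>' (i + 1) - \<kappa> (i + 1))"
    using walkD(2)[OF w(1), of i] walkD(2)[OF w(2), of i] walkD(2)[OF w(1), of "i + 1"] walkD(2)[OF w(2), of "i + 1"] by presburger+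
  moreover have "\<bar>\<kappa> (i + 1) - \<kappa> i\<bar> = 1" "\<bar>\<kappa>' (i + 1) - \<kappa>' i\<bar> = 1" using walkD(1) w by blast+
  ultimately show "\<bar>min (\<kappa> (i + 1)) (\<kappa>' (i + 1)) - min (\<kappa> i) (\<kappa>' i)\<bar> = 1" by presburger
  show "even (min (\<kappa> i) (\<kappa>' i) - i)" using walkD(2) w by (simp add: min_def)
next
  show "min (\<kappa> i) (\<kappa>' i) \<le> 1 - M" if "i \<le> 1 - B" for i using walkD(3)[OF w(1) that] by simp
  show "min (\<kappa> i) (\<kappa>' i) \<ge> M" if "i \<ge> B" for i using walkD(4)[OF w(1) that] walkD(4)[OF w(2) that] by simp
qed

text \<open>Neither walk need lie below the other, so the route leads through their minimum. Moves
  only go upwards in \<open>walk_induct_le\<close>; the descent from \<open>\<kappa>\<close> to the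
  minimum is its contrapositive, applied to the negation of \<open>P\<close>, and is legitimate
  because \<open>adj\<close> is symmetric.\<close>

lemma walk_induct:
  assumes step: "\<And>\<kappa> \<kappa>'. walk M B \<kappa> \<Longrightarrow> walk M B \<kappa>' \<Longrightarrow> adj \<kappa> \<kappa>' \<Longrightarrow> P \<kappa> \<Longrightarrow> P \<kappa>'"
    and w: "walk M B \<kappa>" "walk M B \<kappa>'" and out: "\<And>i. i \<notin> {- C..C} \<Longrightarrow> \<kappa> i = \<kappa>' i" and P: "P \<kappa>"
  shows "P \<kappa>'"
proof -
  let ?m = "\<lambda>i. min (\<kappa> i) (\<kappa>' i)"
  note wm = walk_min[OF w]
  have "P ?m"
  proof (rule ccontr)
    assume "\<not> P ?m"
    have "\<not> P \<kappa>"
    proof (rule walk_induct_le[where P = "\<lambda>k. \<not> P k" and M = M and B = B and C = C and \<kappa> = ?m])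
      show "\<not> P k'" if "walk M B k" "walk M B k'" "adj k k'" "\<not> P k" for k k'
        using step[OF that(2,1) adj_sym[OF that(3)]] that(4) by blast
    qed (use wm w out \<open>\<not> P ?m\<close> in auto)
    then show False using P by blast
  qed
  then show ?thesis
  proof (intro walk_induct_le[where P = P and M = M and B = B and C = C and \<kappa> = ?m and \<kappa>' = \<kappa>'])
    show "P k'" if "walk M B k" "walk M B k'" "adj k k'" "P k" for k k' using step that by blast
  qed (use wm w out in auto)
qed

lemma walk_Rfold:
  assumes w: "walk (int M) B \<kappa>"
  shows "walk (int M) B (\<lambda>i. Rfold M (\<kappa> i))"
  unfolding walk_def
proof (intro conjI allI impI)
  show "\<bar>Rfold M (\<kappa> (i + 1)) - Rfold M (\<kappa> i)\<bar> = 1" for i by (rule Rfold_step[OF walkD(1)[OF w]])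
  show "even (Rfold M (\<kappa> i) - i)" for i using Rfold_parity[of M "\<kappa> i"] walkD(2)[OF w, of i] by presburger
  show "Rfold M (\<kappa> i) \<le> 1 - int M" if "i \<le> 1 - B" for i using Rfold_low[OF walkD(3)[OF w that]] by simp
  show "Rfold M (\<kappa> i) \<ge> int M" if "i \<ge> B" for i using Rfold_high[OF walkD(4)[OF w that]] by simp
qed

text \<open>Beyond \<open>B\<close> a folded walk has only two consecutive integers to choose from,
  and its parity decides between them.\<close>

lemma walk_eq_outside:
  assumes w: "walk (int M) B \<kappa>" "walk (int M) B \<kappa>'" and r: "\<And>i. \<kappa> i \<in> {- int M..int M + 1}" "\<And>i. \<kappa>' i \<in> {- int M..int M + 1}"
    and i: "i \<notin> {- B..B}"
  shows "\<kappa> i = \<kappa>' i"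
proof -
  have e: "even (\<kappa> i - \<kappa>' i)" using walkD(2)[OF w(1), of i] walkD(2)[OF w(2), of i] by presburger
  have "i \<le> 1 - B \<or> i \<ge> B" using i by auto
  then have "\<bar>\<kappa> i - \<kappa>' i\<bar> \<le> 1"
    using walkD(3,4)[OF w(1), of i] walkD(3,4)[OF w(2), of i] r[of i] by auto
  then show ?thesis using e by presburger
qed

text \<open>Folding a walk bounces it on the outermost edges, and in terms of edges this is clamping
  to \<open>{-M..M}\<close>. Since \<open>M\<close> is an integer, clamping is affine on every
  interval between consecutive integers and so commutes with the interpolation.\<close>

lemma pos_Rfold:
  assumes w: "walk (int M) B \<kappa>"
  shows "pos (\<lambda>i. Rfold M (\<kappa> i)) t = max (- real M) (min (real M) (pos \<kappa> t))"
proof -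
  have e: "edge (\<lambda>i. Rfold M (\<kappa> i)) i = max (- int M) (min (int M) (edge \<kappa> i))" for i
  proof -
    have "\<kappa> (i + 1) = \<kappa> i + 1 \<or> \<kappa> (i + 1) = \<kappa> i - 1" using walkD(1)[OF w, of i] by linarith
    moreover have R: "min (Rfold M a) (Rfold M (a + 1)) = max (- int M) (min (int M) a)" for a
      unfolding Rfold_def by (auto split: if_splits simp: min_def max_def)
    moreover note R[of "\<kappa> i"] R[of "\<kappa> i - 1"]
    ultimately show ?thesis by (auto simp: edge_def min.commute)
  qed
  let ?s = "t - real_of_int \<lfloor>t\<rfloor>" and ?a = "edge \<kappa> \<lfloor>t\<rfloor>" and ?b = "edge \<kappa> (\<lfloor>t\<rfloor> + 1)"
  let ?c = "\<lambda>x::real. max (- real M) (min (real M) x)"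
  have s: "0 \<le> ?s" "?s \<le> 1" by (rule frac_bounds)+
  have r: "real_of_int (max (- int M) (min (int M) a)) = ?c (real_of_int a)" for a
    by (simp add: of_int_max of_int_min)
  have lin: "(1 - s) * ?c (real_of_int a) + s * ?c (real_of_int a + 1) = ?c (real_of_int a + s)"
    if s: "0 \<le> s" "s \<le> 1" for a :: int and s :: real
  proof -
    consider "a \<ge> int M" | "a + 1 \<le> - int M" | "- int M \<le> a" "a + 1 \<le> int M" by linarith
    then show ?thesis
    proof cases
      case 1
      then have "real_of_int a \<ge> real M" by linarith
      then show ?thesis using s by (simp add: algebra_simps)
    next
      case 2
      then have "real_of_int a + 1 \<le> - real M" by linarith
      then show ?thesis using s by (simp add: algebra_simps)
    next
      case 3
      then have "- real M \<le> real_of_int a" "real_of_int a + 1 \<le> real M" by linarith+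
      then show ?thesis using s by (simp add: algebra_simps)
    qed
  qed
  have "\<bar>?a - ?b\<bar> \<le> 1" using edge_step[OF w] .
  then consider "?b = ?a" | "?b = ?a + 1" | "?a = ?b + 1" by linarith
  then have "(1 - ?s) * ?c (real_of_int ?a) + ?s * ?c (real_of_int ?b) = ?c ((1 - ?s) * real_of_int ?a + ?s * real_of_int ?b)"
  proof cases
    case 1
    then show ?thesis by (simp add: algebra_simps)
  next
    case 2
    have "(1 - ?s) * real_of_int ?a + ?s * real_of_int ?b = real_of_int ?a + ?s" unfolding 2 by (simp add: algebra_simps)
    then show ?thesis using lin[OF s, of ?a] 2 by simp
  next
    case 3
    have "(1 - ?s) * real_of_int ?a + ?s * real_of_int ?b = real_of_int ?b + (1 - ?s)" unfolding 3 by (simp add: algebra_simps)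
    moreover have "(1 - ?s) * ?c (real_of_int ?b + 1) + ?s * ?c (real_of_int ?b) = ?c (real_of_int ?b + (1 - ?s))"
      using lin[of "1 - ?s" ?b] s by simp
    ultimately show ?thesis using 3 by simp
  qed
  then show ?thesis unfolding pos_def e r .
qed

section \<open>The action of walks on the pullback and on lifting problems\<close>

context bigraph_maps
begin

definition T :: "(int \<Rightarrow> int) \<Rightarrow> (int \<Rightarrow> 'x) \<times> (nat \<Rightarrow> 'y) \<Rightarrow> (int \<Rightarrow> 'x) \<times> (nat \<Rightarrow> 'y)" where
  "T \<kappa> z = (fst z \<circ> \<kappa>, snd z)"

abbreviation "Tz \<kappa> \<equiv> push (\<lambda>z. {T \<kappa> z})"

lemma zvert_T:
  assumes w: "walk M B \<kappa>" and z: "zvert M z"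
  shows "zvert B (T \<kappa> z)"
proof -
  have p: "par (\<kappa> i) = par i" for i using walkD(2)[OF w] by (simp add: par_eq_iff)
  have "fst z (\<kappa> i) = f (snd z (par i))" if "i \<le> 1 - B" for i
    using z walkD(3)[OF w that] p[of i] by (simp add: zvert_def)
  moreover have "fst z (\<kappa> i) = g (snd z (par i))" if "i \<ge> B" for i
    using z walkD(4)[OF w that] p[of i] by (simp add: zvert_def)
  ultimately show ?thesis using z p unfolding zvert_def T_def by simp
qed

text \<open>Values at distance 1 of members of a clique are adjacent, and adjacent walks keep
  distance 1 across each other. Equal walks are allowed, which shows that a single walk preserves
  cliques of bounded stage.\<close>

lemma clique_T:
  assumes w: "walk M B \<kappa>" "walk M B \<kappa>'" and a: "adj \<kappa> \<kappa>'" and A: "A \<in> cliques" "\<And>z. z \<in> A \<Longrightarrow> zvert M z"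
  shows "T \<kappa> ` A \<union> T \<kappa>' ` A \<in> cliques"
proof -
  have v: "T k z \<in> verts Z" if "z \<in> A" "k \<in> {\<kappa>, \<kappa>'}" for z k
    using zvert_T[of M B k z] w A(2)[OF that(1)] that(2) verts_Z by blast
  have ad: "adj k k'" if "k \<in> {\<kappa>, \<kappa>'}" "k' \<in> {\<kappa>, \<kappa>'}" for k k'
    using that walk_adj[OF w(1)] walk_adj[OF w(2)] a adj_sym[OF a] by blast
  have e: "(T k z, T k' z') \<in> edges Z" if z: "z \<in> A" "z' \<in> A" and k: "k \<in> {\<kappa>, \<kappa>'}" "k' \<in> {\<kappa>, \<kappa>'}" for z z' k k'
    unfolding edges_Z[OF v[OF z(1) k(1)] v[OF z(2) k(2)]]
  proof (intro conjI allI impI)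
    fix i j :: int assume "\<bar>i - j\<bar> = 1"
    then have "\<bar>k i - k' j\<bar> = 1" using ad[OF k] by (simp add: adj_def)
    from cliqueD(4)[OF A(1) z this] show "(fst (T k z) i, fst (T k' z') j) \<in> edges X" by (simp add: T_def)
  next
    show "(snd (T k z) 0, snd (T k' z') 1) \<in> edges Y" "(snd (T k z) 1, snd (T k' z') 0) \<in> edges Y"
      unfolding T_def snd_conv by (rule cliqueD(5)[OF A(1) z]; simp)+
  qed
  let ?U = "\<Union>k\<in>{\<kappa>, \<kappa>'}. T k ` A"
  have "finite ?U" "?U \<noteq> {}" using cliqueD(1,2)[OF A(1)] by auto
  moreover have "?U \<subseteq> verts Z" using v by blast
  moreover have "?U \<times> ?U \<subseteq> edges Z" using e by blast
  ultimately have "?U \<in> cliques" unfolding clique_poset_def by blast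
  then show ?thesis by simp
qed

lemma T_support:
  assumes "\<zeta> \<in> FZ"
  shows "{z. Tz \<kappa> \<zeta> z \<noteq> 0} = T \<kappa> ` {z. \<zeta> z \<noteq> 0}"
  unfolding push_supportZ[OF assms] by blast

lemma fuzzy_map_T:
  assumes w: "walk M B \<kappa>" and \<zeta>: "fuzzy_map K cliques \<zeta>" and st: "\<And>x. x \<in> topspace K \<Longrightarrow> stage M (\<zeta> x)"
  shows "fuzzy_map K cliques (\<lambda>x. Tz \<kappa> (\<zeta> x))" "\<And>x. x \<in> topspace K \<Longrightarrow> stage B (Tz \<kappa> (\<zeta> x))"
proof -
  \<comment> \<open>A walk is only known to send vertices of stage \<open>M\<close> into
    \<open>Z\<close>, so the push-forward is taken from the family of cliques of that stage.\<close>
  let ?S = "{A \<in> cliques. \<forall>z\<in>A. zvert M z}"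
  have S: "convex_sets ?S"
    unfolding convex_sets_def
  proof (intro conjI ballI allI impI)
    fix A C B assume A: "A \<in> ?S" and C: "C \<in> ?S" and sub: "A \<subseteq> B \<and> B \<subseteq> C"
    have "B \<in> cliques" using convex_setsD[OF clique_convex_sets, of A C B] A C sub by simp
    moreover have "\<forall>z\<in>B. zvert M z" using C sub by blast
    ultimately show "B \<in> ?S" by simp
  next
    fix A assume A: "A \<in> ?S"
    then have "A \<in> cliques" by simp
    then show "finite A" "A \<noteq> {}" by (rule cliqueD)+
  qed
  have "\<zeta> x \<in> fuzzy ?S" if x: "x \<in> topspace K" for x
    using fuzzy_mapD(1)[OF \<zeta> x] st[OF x] by (auto simp: fuzzy_def stage_def)
  then have \<zeta>': "fuzzy_map K ?S \<zeta>" using \<zeta> by (simp add: fuzzy_map_def)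
  show "fuzzy_map K cliques (\<lambda>x. Tz \<kappa> (\<zeta> x))"
  proof (rule fuzzy_map_push[OF S _ \<zeta>'])
    fix A assume "A \<in> ?S"
    then have "T \<kappa> ` A \<union> T \<kappa> ` A \<in> cliques" by (intro clique_T[OF w w walk_adj[OF w]]) auto
    moreover have "(\<Union>z\<in>A. {T \<kappa> z}) = T \<kappa> ` A" by blast
    ultimately show "(\<Union>z\<in>A. {T \<kappa> z}) \<in> cliques" by simp
  qed simp
  show "stage B (Tz \<kappa> (\<zeta> x))" if x: "x \<in> topspace K" for x
    unfolding stage_def
  proof (intro allI impI)
    fix z assume "Tz \<kappa> (\<zeta> x) z \<noteq> 0"
    then have "z \<in> T \<kappa> ` {z. \<zeta> x z \<noteq> 0}" unfolding T_support[OF fuzzy_mapD(1)[OF \<zeta> x], symmetric] by simp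
    then obtain v where "z = T \<kappa> v" "\<zeta> x v \<noteq> 0" by blast
    then show "zvert B z" using zvert_T[OF w] st[OF x] unfolding stage_def by blast
  qed
qed

lemma yof_T:
  assumes \<zeta>: "\<zeta> \<in> FZ"
  shows "yof (Tz \<kappa> \<zeta>) = yof \<zeta>"
proof -
  have "yof (Tz \<kappa> \<zeta>) = push (\<lambda>z. \<Union>u\<in>{T \<kappa> z}. snd u ` {0, 1}) \<zeta>"
    unfolding yof_def by (rule push_push[OF FZ(1,2)[OF \<zeta>]]) simp
  then show ?thesis by (simp add: yof_def T_def)
qed

text \<open>A walk maps edges to edges, so the nodes of the new path are old nodes at adjacent or
  equal places; \<open>interp_between\<close> then identifies the interpolation with the old path at
  \<open>pos\<close>.\<close>

lemma path_of_T:
  assumes w: "walk M B \<kappa>" and \<zeta>: "\<zeta> \<in> FZ"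
  shows "path_of (Tz \<kappa> \<zeta>) t = path_of \<zeta> (pos \<kappa> t)"
proof -
  have "node (Tz \<kappa> \<zeta>) j = node \<zeta> (edge \<kappa> j)" for j
  proof -
    have "node (Tz \<kappa> \<zeta>) j = push (\<lambda>z. \<Union>u\<in>{T \<kappa> z}. fst u ` {j, j + 1}) \<zeta>"
      unfolding node_def by (rule push_push[OF FZ(1,2)[OF \<zeta>]]) simp
    also have "(\<lambda>z. \<Union>u\<in>{T \<kappa> z}. fst u ` {j, j + 1}) = (\<lambda>z. fst z ` {\<kappa> j, \<kappa> (j + 1)})"
      by (rule ext) (auto simp: T_def)
    finally show ?thesis unfolding edge_pair[OF w] node_def .
  qed
  then have n: "node (Tz \<kappa> \<zeta>) = (\<lambda>j. node \<zeta> (edge \<kappa> j))" by (rule ext)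
  show ?thesis
    unfolding path_of_def pos_def
    by (subst interp_between[of "node \<zeta>", OF node_bounds[OF \<zeta>] edge_step[OF w] frac_bounds]) (simp add: interp_def n)
qed

lemma solvable_cong:
  assumes s: "solvable n u v" and eq: "\<And>x. x \<in> disk_boundary n \<Longrightarrow> u x = u' x" "\<And>x. x \<in> topspace (disk n) \<Longrightarrow> v x = v' x"
  shows "solvable n u' v'"
proof -
  from s[unfolded solvable_def]
  obtain l where l: "continuous_map (disk n) W l \<and> (\<forall>x\<in>disk_boundary n. l x = u x) \<and>
     homotopic_with (\<lambda>h. \<forall>x\<in>disk_boundary n. h x = v x) (disk n) Hp (compare \<circ> l) v" by (rule exE)
  let ?Q = "\<lambda>h. \<forall>x\<in>disk_boundary n. h x = v' x"
  have Q: "(\<lambda>h. \<forall>x\<in>disk_boundary n. h x = v x) = ?Q" using eq(2) disk_boundary_subset by (intro ext) (metis subsetD)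
  have h: "homotopic_with ?Q (disk n) Hp (compare \<circ> l) v" using l unfolding Q by blast
  have "homotopic_with ?Q (disk n) Hp v v'"
    using homotopic_with_imp_continuous_maps[OF h] homotopic_with_imp_property[OF h] eq(2)
    by (intro homotopic_with_equal) auto
  then have "homotopic_with ?Q (disk n) Hp (compare \<circ> l) v'" by (rule homotopic_with_trans[OF h])
  then show ?thesis unfolding solvable_def using l eq(1) by (intro exI[of _ l]) auto
qed

lemma continuous_map_pos: "continuous_map K euclideanreal h \<Longrightarrow> continuous_map K euclideanreal (\<lambda>z. pos \<kappa> (h z))"
  using continuous_map_compose[of K euclideanreal h euclideanreal "pos \<kappa>"] continuous_on_pos by (simp add: o_def)

text \<open>On the boundary the two reparametrized families are joined by \<open>hom\<close>, on the
  disk the two positions are joined by a straight line. These are different homotopies, but at every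
  time both live in one star, so \<open>solvable_transfer\<close> applies.\<close>

lemma solvable_adjacent:
  assumes \<zeta>: "fuzzy_map (Sph n) cliques \<zeta>" and st: "\<And>x. x \<in> disk_boundary n \<Longrightarrow> stage (int M) (\<zeta> x)"
    and p: "pdat (disk n) (real M) y V"
    and bd: "\<And>x. x \<in> disk_boundary n \<Longrightarrow> y x = yof (\<zeta> x)" "\<And>x t. x \<in> disk_boundary n \<Longrightarrow> V x t = path_of (\<zeta> x) t"
    and w: "walk (int M) (int B) \<kappa>" "walk (int M) (int B) \<kappa>'" and a: "adj \<kappa> \<kappa>'"
    and sol: "solvable n (\<lambda>x. PZ.uncoord (Tz \<kappa> (\<zeta> x))) (\<lambda>x. mkP (y x) (\<lambda>t. V x (pos \<kappa> t)))"
  shows "solvable n (\<lambda>x. PZ.uncoord (Tz \<kappa>' (\<zeta> x))) (\<lambda>x. mkP (y x) (\<lambda>t. V x (pos \<kappa>' t)))"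
proof -
  have st': "\<And>x. x \<in> topspace (Sph n) \<Longrightarrow> stage (int M) (\<zeta> x)" using st by simp
  note fT = fuzzy_map_T[OF w(1) \<zeta> st'] and fT' = fuzzy_map_T[OF w(2) \<zeta> st']
  have z: "\<zeta> x \<in> FZ" if "x \<in> disk_boundary n" for x using fuzzy_mapD(1)[OF \<zeta>] that disk_boundary_subset by auto
  have zT: "Tz k (\<zeta> x) \<in> FZ" if "x \<in> disk_boundary n" "k \<in> {\<kappa>, \<kappa>'}" for x k
    using fuzzy_mapD(1)[OF fT(1), of x] fuzzy_mapD(1)[OF fT'(1), of x] that disk_boundary_subset by auto
  define G where "G x s = hom s (Tz \<kappa> (\<zeta> x)) (Tz \<kappa>' (\<zeta> x))" for x s
  define \<tau> where "\<tau> s t = (1 - s) * pos \<kappa> t + s * pos \<kappa>' t" for s t :: real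
  have G01: "G x 0 = Tz \<kappa> (\<zeta> x)" "G x 1 = Tz \<kappa>' (\<zeta> x)" if "x \<in> disk_boundary n" for x
    using zT[OF that] FZ(2,3) unfolding G_def by (auto intro!: hom_0 hom_1)
  have \<tau>01: "\<tau> 0 t = pos \<kappa> t" "\<tau> 1 t = pos \<kappa>' t" for t by (simp_all add: \<tau>_def)
  let ?SI = "prod_topology (Sph n) unit_interval" and ?DI = "prod_topology (disk n) unit_interval"
  have c1: "continuous_map ?SI (Sph n) fst" "continuous_map ?SI euclideanreal snd"
    unfolding unit_interval_def using continuous_map_fst continuous_map_snd continuous_map_into_fulltopology by blast+
  have cl: "{z. Tz \<kappa> (\<zeta> x) z \<noteq> 0} \<union> {z. Tz \<kappa>' (\<zeta> x) z \<noteq> 0} \<in> cliques" if x: "x \<in> disk_boundary n" for x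
    unfolding T_support[OF z[OF x]]
    using st[OF x] by (intro clique_T[OF w a FZ(4)[OF z[OF x]]]) (auto simp: stage_def)
  have "fuzzy_map ?SI cliques (\<lambda>z. hom (snd z) (Tz \<kappa> (\<zeta> (fst z))) (Tz \<kappa>' (\<zeta> (fst z))))"
    by (rule fuzzy_map_hom[OF clique_convex_sets fuzzy_map_compose[OF fT(1) c1(1)] fuzzy_map_compose[OF fT'(1) c1(1)] c1(2)])
      (use cl in auto)
  then have fG: "fuzzy_map ?SI cliques (\<lambda>(x, s). G x s)" by (simp add: G_def case_prod_unfold)
  have supG: "{z. G x s z \<noteq> 0} \<subseteq> T \<kappa> ` {z. \<zeta> x z \<noteq> 0} \<union> T \<kappa>' ` {z. \<zeta> x z \<noteq> 0}" if x: "x \<in> disk_boundary n" for x s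
  proof -
    have "{z. G x s z \<noteq> 0} \<subseteq> {z. Tz \<kappa> (\<zeta> x) z \<noteq> 0} \<union> {z. Tz \<kappa>' (\<zeta> x) z \<noteq> 0}"
      unfolding G_def using hom_support[of s "Tz \<kappa> (\<zeta> x)" "Tz \<kappa>' (\<zeta> x)"] FZ(2)[OF zT[OF x]] by blast
    then show ?thesis unfolding T_support[OF z[OF x]] .
  qed
  have supGE: "\<exists>k v. k \<in> {\<kappa>, \<kappa>'} \<and> \<zeta> x v \<noteq> 0 \<and> u = T k v" if x: "x \<in> disk_boundary n" and u: "G x s u \<noteq> 0" for x s u
  proof -
    have "u \<in> {z. G x s z \<noteq> 0}" using u by simp
    from subsetD[OF supG[OF x] this] show ?thesis by blast
  qed
  have GF: "G x s \<in> FZ" if "x \<in> disk_boundary n" "s \<in> {0..1}" for x s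
    using fuzzy_mapD(1)[OF fG, of "(x, s)"] that disk_boundary_subset by auto
  have yG: "yof (G x s) = y x" if x: "x \<in> disk_boundary n" for x s
  proof -
    have "yof (G x s) = hom s (yof (Tz \<kappa> (\<zeta> x))) (yof (Tz \<kappa>' (\<zeta> x)))"
      using FZ(1,2)[OF zT[OF x, of \<kappa>]] FZ(1,2)[OF zT[OF x, of \<kappa>']] unfolding G_def yof_def by (intro push_hom) auto
    also have "\<dots> = yof (\<zeta> x)"
      unfolding yof_T[OF z[OF x]] by (rule hom_same) (rule fuzzy_bounds[OF yof_fuzzy[OF z[OF x]]])
    finally show ?thesis using bd(1)[OF x] by simp
  qed
  have pV: "pdat ?DI (real (B + 1)) (\<lambda>z. y (fst z)) (\<lambda>z t. V (fst z) (\<tau> (snd z) t))"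
  proof (rule pdat_reparam[OF p continuous_map_fst])
    have c: "continuous_map (prod_topology ?DI euclideanreal) euclideanreal (\<lambda>z. snd (fst z))"
    proof (rule continuous_map_compose[OF continuous_map_fst, unfolded o_def])
      show "continuous_map ?DI euclideanreal snd"
        unfolding unit_interval_def using continuous_map_snd continuous_map_into_fulltopology by blast
    qed
    show "continuous_map (prod_topology ?DI euclideanreal) euclideanreal (\<lambda>(z, t). \<tau> (snd z) t)"
      unfolding \<tau>_def case_prod_unfold
      by (intro continuous_map_add continuous_map_real_mult continuous_map_diff continuous_map_pos continuous_map_snd c) auto
    fix z t assume "z \<in> topspace ?DI"
    then have s: "0 \<le> snd z" "snd z \<le> 1" by auto
    show "\<tau> (snd z) t \<le> - real M" if "t \<le> - real (B + 1)"
      unfolding \<tau>_def using pos_ends(1)[OF w(1), of t] pos_ends(1)[OF w(2), of t] that s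
      by (intro convex_bound_le) auto
    have "(1 - snd z) * (- pos \<kappa> t) + snd z * (- pos \<kappa>' t) \<le> - real M" if "t \<ge> real (B + 1)"
      using pos_ends(2)[OF w(1), of t] pos_ends(2)[OF w(2), of t] that s
      by (intro convex_bound_le) auto
    then show "real M \<le> \<tau> (snd z) t" if "t \<ge> real (B + 1)"
      using that by (simp add: \<tau>_def)
  qed
  have "solvable n (\<lambda>x. PZ.uncoord (G x 1)) (\<lambda>x. mkP (y x) (\<lambda>t. V x (\<tau> 1 t)))"
  proof (rule solvable_transfer[OF fG, where M = "B + 1" and y = "\<lambda>x s. y x" and V = "\<lambda>x s t. V x (\<tau> s t)"])
    show "pdat ?DI (real (B + 1)) (\<lambda>(x, s). y x) (\<lambda>(x, s) t. V x (\<tau> s t))"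
      using pV by (simp add: case_prod_unfold)
    show "solvable n (\<lambda>x. PZ.uncoord (G x 0)) (\<lambda>x. mkP (y x) (\<lambda>t. V x (\<tau> 0 t)))"
      by (rule solvable_cong[OF sol]) (simp_all add: G01 \<tau>01)
  next
    fix x s assume x: "x \<in> disk_boundary n" and s: "s \<in> {0..1::real}"
    show "stage (int (B + 1)) (G x s)"
      unfolding stage_def
    proof (intro allI impI)
      fix u assume "G x s u \<noteq> 0"
      from supGE[OF x this] obtain k v where "k \<in> {\<kappa>, \<kappa>'}" "\<zeta> x v \<noteq> 0" "u = T k v" by blast
      then have "zvert (int B) u" using zvert_T w st[OF x] unfolding stage_def by blast
      then show "zvert (int (B + 1)) u" by (rule zvert_mono) simp
    qed
    show "{v. yof (G x s) v \<noteq> 0} \<union> {v. y x v \<noteq> 0} \<in> SY"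
      unfolding yG[OF x] bd(1)[OF x] using fuzzyD(4)[OF yof_fuzzy[OF z[OF x]]] by simp
    fix t :: real
    \<comment> \<open>One window serves both walks near \<open>t\<close>; the boundary family, the
      two positions and all points between these are then carried by the star at
      \<open>j\<close>.\<close>
    obtain j where j: "\<And>l. l \<in> {\<lfloor>t\<rfloor>..\<lfloor>t\<rfloor> + 2} \<Longrightarrow> \<kappa> l \<in> {j..j + 2} \<and> \<kappa>' l \<in> {j..j + 2}"
      using walk_window[OF w a, of "\<lfloor>t\<rfloor>"] by blast
    have pj: "real_of_int j \<le> pos \<kappa> t" "pos \<kappa> t \<le> real_of_int j + 1" "real_of_int j \<le> pos \<kappa>' t" "pos \<kappa>' t \<le> real_of_int j + 1"
      using pos_window[OF w(1), of t j] pos_window[OF w(2), of t j] j by blast+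
    have \<tau>j: "\<tau> s t \<le> real_of_int j + 1" unfolding \<tau>_def using pj s by (intro convex_bound_le) auto
    have "(1 - s) * (- pos \<kappa> t) + s * (- pos \<kappa>' t) \<le> - real_of_int j" using pj s by (intro convex_bound_le) auto
    then have j\<tau>: "real_of_int j \<le> \<tau> s t" by (simp add: \<tau>_def)
    have "fst u ` {\<lfloor>t\<rfloor>..\<lfloor>t\<rfloor> + 2} \<subseteq> star (\<zeta> x) j" if u: "G x s u \<noteq> 0" for u
    proof -
      from supGE[OF x u] obtain k v where k: "k \<in> {\<kappa>, \<kappa>'}" "\<zeta> x v \<noteq> 0" "u = T k v" by blast
      then have "fst u ` {\<lfloor>t\<rfloor>..\<lfloor>t\<rfloor> + 2} = fst v ` k ` {\<lfloor>t\<rfloor>..\<lfloor>t\<rfloor> + 2}" by (simp add: T_def image_comp)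
      moreover have "k ` {\<lfloor>t\<rfloor>..\<lfloor>t\<rfloor> + 2} \<subseteq> {j..j + 2}" using j k(1) by blast
      ultimately show ?thesis using k(2) unfolding star_def by blast
    qed
    then have "{v. path_of (G x s) t v \<noteq> 0} \<subseteq> star (\<zeta> x) j"
      using path_of_support[OF GF[OF x s], of t] by blast
    moreover have "{v. path_of (\<zeta> x) (\<tau> s t) v \<noteq> 0} \<subseteq> star (\<zeta> x) j"
      by (rule path_of_star[OF z[OF x] j\<tau> \<tau>j])
    moreover have "V x (\<tau> s t) \<in> fuzzy SX" using pdatD(6)[OF p] x disk_boundary_subset by blast
    ultimately show "{v. path_of (G x s) t v \<noteq> 0} \<union> {v. V x (\<tau> s t) v \<noteq> 0} \<in> SX"
      unfolding bd(2)[OF x] by (intro star_contiguous[OF z[OF x]])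
  next
    fix x s assume x: "x \<in> disk_boundary n" and s: "s \<in> {0, 1::real}"
    show "yof (G x s) = y x" by (rule yG[OF x])
    show "path_of (G x s) t = V x (\<tau> s t)" for t
      using s G01[OF x] path_of_T[OF w(1) z[OF x]] path_of_T[OF w(2) z[OF x]] bd(2)[OF x] \<tau>01 by auto
  qed
  then show ?thesis by (rule solvable_cong) (simp_all add: G01 \<tau>01)
qed

lemma zvert_Rfold:
  assumes z: "zvert (int M) z"
  shows "fst z (Rfold M i) = fst z i"
proof -
  consider "i \<in> {- int M..int M + 1}" | "i \<ge> int M" | "i \<le> 1 - int M" by fastforce
  then show ?thesis
  proof cases
    case 1
    then show ?thesis by (simp only: Rfold_id)
  next
    case 2
    then have "Rfold M i \<ge> int M" using Rfold_high[of M i] by simp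
    then show ?thesis using z 2 par_Rfold unfolding zvert_def by simp
  next
    case 3
    then have "Rfold M i \<le> 1 - int M" using Rfold_low[of i M] by simp
    then show ?thesis using z 3 par_Rfold unfolding zvert_def by simp
  qed
qed

text \<open>The problem does not change under a reparametrization by a walk. On vertices of stage \<open>M\<close> a walk
  may be folded into \<open>{-M..M + 1}\<close>, after which any two walks differ in finitely many places.\<close>

lemma solvable_walk:
  assumes \<zeta>: "fuzzy_map (Sph n) cliques \<zeta>" and st: "\<And>x. x \<in> disk_boundary n \<Longrightarrow> stage (int M) (\<zeta> x)"
    and p: "pdat (disk n) (real M) y V"
    and bd: "\<And>x. x \<in> disk_boundary n \<Longrightarrow> y x = yof (\<zeta> x)" "\<And>x t. x \<in> disk_boundary n \<Longrightarrow> V x t = path_of (\<zeta> x) t"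
    and w: "walk (int M) (int B) \<kappa>" and MB: "M \<le> B"
    and sol: "solvable n (\<lambda>x. PZ.uncoord (Tz \<kappa> (\<zeta> x))) (\<lambda>x. mkP (y x) (\<lambda>t. V x (pos \<kappa> t)))"
  shows "solvable n (\<lambda>x. PZ.uncoord (\<zeta> x)) (\<lambda>x. mkP (y x) (V x))"
proof -
  let ?P = "\<lambda>k. solvable n (\<lambda>x. PZ.uncoord (Tz k (\<zeta> x))) (\<lambda>x. mkP (y x) (\<lambda>t. V x (pos k t)))"
  have z: "\<zeta> x \<in> FZ" if "x \<in> disk_boundary n" for x using fuzzy_mapD(1)[OF \<zeta>] that disk_boundary_subset by auto
  let ?id = "\<lambda>i::int. i"
  have wid: "walk (int M) (int B) ?id" using MB by (auto simp: walk_def)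
  have TR: "Tz (\<lambda>i. Rfold M (k i)) (\<zeta> x) = Tz k (\<zeta> x)" if x: "x \<in> disk_boundary n" for k x
  proof (rule push_cong[OF FZ(1,2)[OF z[OF x]]])
    fix u assume "\<zeta> x u \<noteq> 0"
    then have "zvert (int M) u" using st[OF x] unfolding stage_def by blast
    then show "{T (\<lambda>i. Rfold M (k i)) u} = {T k u}" using zvert_Rfold by (simp add: T_def fun_eq_iff)
  qed
  \<comment> \<open>Folding clamps the position to \<open>{-M..M}\<close>, outside which
    \<open>V\<close> is constant.\<close>
  have VR: "V x (pos (\<lambda>i. Rfold M (k i)) t) = V x (pos k t)" if k: "walk (int M) (int B) k" and x: "x \<in> topspace (disk n)" for k x t
    unfolding pos_Rfold[OF k] using pdatD(3,4)[OF p x, of "pos k t"] pdatD(3)[OF p x, of "- real M"] pdatD(4)[OF p x, of "real M"]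
    by (auto simp: max_def min_def)
  have "?P (\<lambda>i. Rfold M (\<kappa> i))"
    by (rule solvable_cong[OF sol]) (simp_all add: TR VR[OF w])
  then have "?P (\<lambda>i. Rfold M (?id i))"
  proof (rule walk_induct[where P = ?P and M = "int M" and B = "int B" and C = "int B", rotated -1])
    show "?P k'" if "walk (int M) (int B) k" "walk (int M) (int B) k'" "adj k k'" "?P k" for k k'
      using solvable_adjacent[OF \<zeta> st p bd that] .
    show "walk (int M) (int B) (\<lambda>i. Rfold M (\<kappa> i))" "walk (int M) (int B) (\<lambda>i. Rfold M (?id i))"
      using walk_Rfold[OF w] walk_Rfold[OF wid] by blast+
    show "Rfold M (\<kappa> i) = Rfold M (?id i)" if "i \<notin> {- int B..int B}" for i
      using walk_eq_outside[OF walk_Rfold[OF w] walk_Rfold[OF wid] Rfold_range Rfold_range that] .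
  qed
  then have P: "?P ?id" by (rule solvable_cong) (simp_all add: TR VR[OF wid, simplified])
  have "pos ?id t = t" for t by (simp add: pos_def edge_def algebra_simps)
  moreover have "Tz ?id (\<zeta> x) = \<zeta> x" if x: "x \<in> disk_boundary n" for x
  proof
    fix u
    show "Tz ?id (\<zeta> x) u = \<zeta> x u"
      by (rule eq_if_levels_eq[OF push_nonneg[OF FZ(1)[OF z[OF x]]] FZ(2)[OF z[OF x]]])
        (simp add: push_ge_iff[OF FZ(1)[OF z[OF x]]] T_def o_def)
  qed
  ultimately show ?thesis by (intro solvable_cong[OF P]) simp_all
qed

end

section \<open>Making paths finite and fine\<close>

lemma fuzzy_map_cases_le:
  assumes A: "fuzzy_map K S A" and B: "fuzzy_map K S B" and p: "continuous_map K euclideanreal p"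
    and eq: "\<And>x. x \<in> topspace K \<Longrightarrow> p x = c \<Longrightarrow> A x = B x"
  shows "fuzzy_map K S (\<lambda>x. if p x \<le> c then A x else B x)"
proof -
  obtain U V where U: "finite U" "\<And>x. x \<in> topspace K \<Longrightarrow> {v. A x v \<noteq> 0} \<subseteq> U"
    and V: "finite V" "\<And>x. x \<in> topspace K \<Longrightarrow> {v. B x v \<noteq> 0} \<subseteq> V"
    using fuzzy_map_support A B by metis
  have "continuous_map K euclideanreal (\<lambda>x. if p x \<le> c then A x v else B x v)" for v
    using eq fuzzy_mapD(2)[OF A] fuzzy_mapD(2)[OF B] p
    by (intro continuous_map_cases_le continuous_map_from_subtopology) auto
  then have "continuous_map K euclideanreal (\<lambda>x. (if p x \<le> c then A x else B x) v)" for v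
    by (simp add: if_distribR)
  moreover have "{v. (if p x \<le> c then A x else B x) v \<noteq> 0} \<subseteq> U \<union> V" if "x \<in> topspace K" for x
    using U(2)[OF that] V(2)[OF that] by auto
  moreover have "finite (U \<union> V)" using U V by simp
  moreover have "(if p x \<le> c then A x else B x) \<in> fuzzy S" if "x \<in> topspace K" for x
    using fuzzy_mapD(1)[OF A that] fuzzy_mapD(1)[OF B that] by simp
  ultimately show ?thesis unfolding fuzzy_map_def by blast
qed

text \<open>No metric on \<open>K\<close> is available, so uniform continuity comes from Wallace's
  theorem, applied to the compact space of pairs \<open>(x, t)\<close> with bounded \<open>t\<close>
  and the displacement 0.\<close>

lemma uniformly_fine:
  assumes K: "compact_space K" and h: "continuous_map (prod_topology K euclideanreal) euclideanreal (\<lambda>(x, t). h x t)"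
    and const: "\<And>x t. x \<in> topspace K \<Longrightarrow> t \<le> - M \<Longrightarrow> h x t = h x (- M)" "\<And>x t. x \<in> topspace K \<Longrightarrow> t \<ge> M \<Longrightarrow> h x t = h x M"
    and M: "0 \<le> M" and e: "0 < e"
  obtains d where "d > 0" "\<And>x t t'. x \<in> topspace K \<Longrightarrow> \<bar>t - t'\<bar> < d \<Longrightarrow> \<bar>h x t - h x t'\<bar> < e"
proof -
  let ?J = "top_of_set {- M..M}"
  let ?P = "prod_topology (prod_topology K ?J) euclideanreal"
  have c: "continuous_map ?P euclideanreal (\<lambda>z. h (fst (fst z)) (\<tau> z))" if "continuous_map ?P euclideanreal \<tau>" for \<tau>
  proof -
    have "continuous_map ?P (prod_topology K euclideanreal) (\<lambda>z. (fst (fst z), \<tau> z))"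
      using that continuous_map_compose[OF continuous_map_fst continuous_map_fst, unfolded o_def]
      unfolding continuous_map_pairwise o_def fst_conv snd_conv by blast
    from continuous_map_compose[OF this h] show ?thesis by (simp add: o_def)
  qed
  have s: "continuous_map ?P euclideanreal (\<lambda>z. snd (fst z))"
  proof (rule continuous_map_compose[OF continuous_map_fst, unfolded o_def])
    show "continuous_map (prod_topology K ?J) euclideanreal snd"
      using continuous_map_snd continuous_map_into_fulltopology by blast
  qed
  define k where "k z = \<bar>h (fst (fst z)) (snd (fst z) + snd z) - h (fst (fst z)) (snd (fst z))\<bar>" for z
  have k: "continuous_map ?P euclideanreal k"
    unfolding k_def
    by (intro continuous_map_real_abs continuous_map_diff c continuous_map_add s continuous_map_snd)
  define O' where "O' = {z \<in> topspace ?P. k z \<in> {..<e}}"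
  have O': "openin ?P O'"
    unfolding O'_def by (rule openin_continuous_map_preimage[OF k]) simp
  have "compact_space ?J" by (simp add: compact_space_subtopology)
  then have "compact_space (prod_topology K ?J)" using K by (simp add: compact_space_prod_topology)
  then have "compactin (prod_topology K ?J) (topspace (prod_topology K ?J))" unfolding compact_space_def .
  moreover have "compactin euclideanreal {0}" by simp
  moreover have "topspace (prod_topology K ?J) \<times> {0} \<subseteq> O'" using e by (auto simp: O'_def k_def)
  ultimately obtain A U where "openin euclideanreal U" and AU: "topspace (prod_topology K ?J) \<subseteq> A" "{0} \<subseteq> U" "A \<times> U \<subseteq> O'"
    by (rule Wallace_theorem_prod_topology[OF _ _ O'])
  then have "open U" "0 \<in> U" by auto
  then obtain d where d: "d > 0" "ball 0 d \<subseteq> U" by (meson open_contains_ball)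
  have small: "\<bar>h x (t + r) - h x t\<bar> < e" if "x \<in> topspace K" "t \<in> {- M..M}" "\<bar>r\<bar> < d" for x t r
  proof -
    have "((x, t), r) \<in> A \<times> U" using that AU(1) d(2) by auto
    then have "((x, t), r) \<in> O'" using AU(3) by blast
    then show ?thesis by (simp add: O'_def k_def)
  qed
  show ?thesis
  proof (rule that[OF d(1)])
    fix x t t' assume x: "x \<in> topspace K" and t: "\<bar>t - t'\<bar> < d"
    \<comment> \<open>Clamping does not increase distances and does not change \<open>h\<close>, so
      it is enough to know small displacements from times in \<open>{-M..M}\<close>.\<close>
    let ?c = "\<lambda>t. max (- M) (min M t)"
    have hc: "h x t = h x (?c t)" for t
      using const[OF x, of t] M by (auto simp: max_def min_def)
    have "\<bar>h x (?c t' + (?c t - ?c t')) - h x (?c t')\<bar> < e"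
      by (rule small[OF x]) (use t M in auto)
    then show "\<bar>h x t - h x t'\<bar> < e" using hc[of t] hc[of t'] by simp
  qed
qed

section \<open>Uniform fineness of path families and constancy near their ends\<close>

context bigraph_maps
begin

lemma pdat_fine:
  assumes K: "compact_space K" and p: "pdat K (real M) y V"
  obtains d where "d > 0" "\<And>x t t' v. x \<in> topspace K \<Longrightarrow> \<bar>t - t'\<bar> < d \<Longrightarrow> \<bar>V x t v - V x t' v\<bar> < 1 / 2"
proof -
  note F = pdatD(2)[OF p]
  obtain U where U: "finite U" "\<And>z. z \<in> topspace (prod_topology K euclideanreal) \<Longrightarrow> {v. (\<lambda>(x, t). V x t) z v \<noteq> 0} \<subseteq> U"
    using fuzzy_map_support[OF F] by blast
  have "\<exists>d>0. \<forall>x t t'. x \<in> topspace K \<longrightarrow> \<bar>t - t'\<bar> < d \<longrightarrow> \<bar>V x t v - V x t' v\<bar> < 1 / 2" for v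
  proof -
    have h1: "continuous_map (prod_topology K euclideanreal) euclideanreal (\<lambda>(x, t). V x t v)"
      using fuzzy_mapD(2)[OF F, of v] by (simp add: case_prod_unfold)
    have h2: "V x t v = V x (- real M) v" if "x \<in> topspace K" "t \<le> - real M" for x t
      using pdatD(3)[OF p that] pdatD(3)[OF p that(1), of "- real M"] by simp
    have h3: "V x t v = V x (real M) v" if "x \<in> topspace K" "t \<ge> real M" for x t
      using pdatD(4)[OF p that] pdatD(4)[OF p that(1), of "real M"] by simp
    show ?thesis
    proof (rule uniformly_fine[OF K h1 h2 h3, where e = "1 / 2"])
      fix d :: real
      assume "d > 0" "\<And>x t t'. x \<in> topspace K \<Longrightarrow> \<bar>t - t'\<bar> < d \<Longrightarrow> \<bar>V x t v - V x t' v\<bar> < 1 / 2"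
      then show "\<exists>d>0. \<forall>x t t'. x \<in> topspace K \<longrightarrow> \<bar>t - t'\<bar> < d \<longrightarrow> \<bar>V x t v - V x t' v\<bar> < 1 / 2"
        by blast
    qed simp_all
  qed
  then obtain d where d: "\<And>v. d v > 0" "\<And>v x t t'. x \<in> topspace K \<Longrightarrow> \<bar>t - t'\<bar> < d v \<Longrightarrow> \<bar>V x t v - V x t' v\<bar> < 1 / 2"
    by metis
  define D where "D = Min (insert 1 (d ` U))"
  have "D > 0" using U(1) d(1) by (simp add: D_def)
  moreover have "\<bar>V x t v - V x t' v\<bar> < 1 / 2" if x: "x \<in> topspace K" and t: "\<bar>t - t'\<bar> < D" for x t t' v
  proof (cases "v \<in> U")
    case True
    then have "D \<le> d v" using U(1) by (simp add: D_def)
    then show ?thesis using d(2)[OF x, of t t' v] t by simp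
  next
    case False
    then have "V x t v = 0" "V x t' v = 0" using U(2)[of "(x, t)"] U(2)[of "(x, t')"] x by auto
    then show ?thesis by simp
  qed
  ultimately show ?thesis using that by blast
qed

text \<open>Zero up to \<open>e / 2\<close> and the identity from \<open>e\<close> on. A path
  reparametrized by it is constant near its start, and a path that was already constant up to
  \<open>e\<close> does not change.\<close>

definition squeeze :: "real \<Rightarrow> real \<Rightarrow> real" where
  "squeeze e \<tau> = max 0 (min \<tau> (2 * \<tau> - e))"

lemma squeeze_simps: "\<tau> \<ge> e \<Longrightarrow> 0 \<le> \<tau> \<Longrightarrow> squeeze e \<tau> = \<tau>" "\<tau> \<le> e / 2 \<Longrightarrow> squeeze e \<tau> = 0"
  "0 \<le> \<tau> \<Longrightarrow> 0 \<le> squeeze e \<tau> \<and> squeeze e \<tau> \<le> \<tau>"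
  by (auto simp: squeeze_def)

lemma continuous_map_squeeze: "continuous_map K euclideanreal h \<Longrightarrow> continuous_map K euclideanreal (\<lambda>z. squeeze e (h z))"
  unfolding squeeze_def
  by (intro continuous_map_real_max continuous_map_real_min continuous_map_diff continuous_map_real_mult_left) auto

text \<open>A path in the homotopy pullback reaches its start only in the limit
  \<open>s = 0\<close>, whereas \<open>pdat\<close> wants constancy outside a bounded range of
  times. Squeezing the parameter achieves this by a homotopy that is stationary on the boundary,
  where the paths come from vertices of bounded stage.\<close>

lemma solvable_finite:
  assumes u: "continuous_map (Sph n) W u" and v: "continuous_map (disk n) Hp v"
    and uv: "\<And>x. x \<in> disk_boundary n \<Longrightarrow> v x = compare (u x)"
    and st: "\<And>x. x \<in> disk_boundary n \<Longrightarrow> stage (int M) (PZ.coord (u x))"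
  obtains y V where "pdat (disk n) (real (2 * M + 1)) y V"
    "\<And>x. x \<in> disk_boundary n \<Longrightarrow> y x = yof (PZ.coord (u x))"
    "\<And>x t. x \<in> disk_boundary n \<Longrightarrow> V x t = path_of (PZ.coord (u x)) t"
    "\<And>u'. solvable n u' (\<lambda>x. mkP (y x) (V x)) \<Longrightarrow> solvable n u' v"
proof -
  let ?D = "disk n" and ?DI = "prod_topology (disk n) unit_interval"
  have cDI: "compact_space ?DI" by (simp add: compact_space_prod_topology compact_space_disk)
  define \<gamma> where "\<gamma> x = snd (snd (v x))" for x
  note vv = v[unfolded continuous_map_hpullback_iff]
  have \<gamma>: "continuous_map ?DI (prod_topology BX BX) (\<lambda>(x, \<tau>). \<gamma> x \<tau>)"
    unfolding \<gamma>_def using vv by (intro continuous_map_uncurry) blast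
  have \<gamma>0: "\<gamma> x 0 = ends (fst (v x))" "\<gamma> x 1 = (fst (snd (v x)), fst (snd (v x)))" if "x \<in> topspace ?D" for x
    using vv that unfolding \<gamma>_def by auto
  have \<gamma>pt: "fst (\<gamma> x \<tau>) \<in> realization_points (bip_poset X) bip_le" "snd (\<gamma> x \<tau>) \<in> realization_points (bip_poset X) bip_le"
    if "x \<in> topspace ?D" "\<tau> \<in> {0..1}" for x \<tau>
    using continuous_map_funspace[OF \<gamma>] that by (auto simp: Pi_iff mem_Times_iff)
  have ypt: "fst (v x) \<in> realization_points (bip_poset Y) bip_le" if "x \<in> topspace ?D" for x
    using vv that continuous_map_funspace[of ?D BY "\<lambda>x. fst (v x)"] by auto
  define y where "y x = PY.coord (fst (v x))" for x
  have fy: "fuzzy_map ?D SY y"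
    unfolding y_def using vv by (intro coordY compact_space_disk) blast
  have uy: "PY.uncoord (y x) = fst (v x)" if "x \<in> topspace ?D" for x
    unfolding y_def by (rule PY.uncoord_coord[OF ypt[OF that]])
  define \<Gamma> where "\<Gamma> pr x \<tau> = PX.coord (pr (\<gamma> x \<tau>))" for pr :: "_ \<times> _ \<Rightarrow> _" and x \<tau>
  have f\<Gamma>: "fuzzy_map ?DI SX (\<lambda>(x, \<tau>). \<Gamma> fst x \<tau>)" "fuzzy_map ?DI SX (\<lambda>(x, \<tau>). \<Gamma> snd x \<tau>)"
    unfolding \<Gamma>_def case_prod_unfold
    using continuous_map_compose[OF \<gamma> continuous_map_fst] continuous_map_compose[OF \<gamma> continuous_map_snd]
    by (auto intro!: coordX[OF cDI] simp: o_def case_prod_unfold)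
  have u\<Gamma>: "PX.uncoord (\<Gamma> fst x \<tau>) = fst (\<gamma> x \<tau>)" "PX.uncoord (\<Gamma> snd x \<tau>) = snd (\<gamma> x \<tau>)"
    if "x \<in> topspace ?D" "\<tau> \<in> {0..1}" for x \<tau>
    unfolding \<Gamma>_def by (rule PX.uncoord_coord[OF \<gamma>pt(1)[OF that]], rule PX.uncoord_coord[OF \<gamma>pt(2)[OF that]])
  have yF: "y x \<in> fuzzy SY" if "x \<in> topspace ?D" for x using fuzzy_mapD(1)[OF fy that] .
  have \<gamma>ends: "\<gamma> x 0 = (PX.uncoord (pushv f (y x)), PX.uncoord (pushv g (y x)))" if x: "x \<in> topspace ?D" for x
    unfolding \<gamma>0(1)[OF x] realization_map_uncoord[OF f yF[OF x], symmetric] realization_map_uncoord[OF g yF[OF x], symmetric] uy[OF x] ..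
  have \<Gamma>0: "\<Gamma> fst x 0 = pushv f (y x)" "\<Gamma> snd x 0 = pushv g (y x)" if x: "x \<in> topspace ?D" for x
    unfolding \<Gamma>_def \<gamma>ends[OF x] fst_conv snd_conv
    by (rule coord_uncoordX[OF pushv_fuzzy[OF f yF[OF x]]], rule coord_uncoordX[OF pushv_fuzzy[OF g yF[OF x]]])
  \<comment> \<open>The parameter belonging to the times \<open>-M\<close> and \<open>M\<close>:
    below it the boundary paths are constant, and so they are not affected by
    \<open>squeeze e\<close>.\<close>
  define e where "e = 1 / (real M + 1)"
  have e0: "0 < e" "e \<le> 1" by (simp_all add: e_def)
  \<comment> \<open>The two components of the path in the product become the halves of one path over
    the real line. They meet at \<open>t = 0\<close>, which is the parameter 1, where the path is on
    the diagonal.\<close>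
  define V where "V x t = (if t \<le> 0 then \<Gamma> fst x (squeeze e (1 / (1 - t))) else \<Gamma> snd x (squeeze e (1 / (1 + t))))" for x t
  let ?DR = "prod_topology (disk n) euclideanreal"
  have arg: "continuous_map ?DR ?DI (\<lambda>z. (fst z, squeeze e (1 / (1 + \<tau> z))))"
    if \<tau>: "continuous_map ?DR euclideanreal \<tau>" "\<And>z. 0 \<le> \<tau> z" for \<tau>
  proof -
    have nz: "1 + \<tau> z \<noteq> 0" for z using \<tau>(2)[of z] by linarith
    have "continuous_map ?DR euclideanreal (\<lambda>z. squeeze e (1 / (1 + \<tau> z)))"
      by (intro continuous_map_squeeze continuous_map_real_divide continuous_map_add \<tau>(1)) (use nz in auto)
    moreover have "squeeze e (1 / (1 + \<tau> z)) \<in> {0..1}" for z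
    proof -
      have "0 \<le> 1 / (1 + \<tau> z)" "1 / (1 + \<tau> z) \<le> 1" using \<tau>(2)[of z] by simp_all
      then show ?thesis using squeeze_simps(3)[of "1 / (1 + \<tau> z)" e] by auto
    qed
    ultimately show ?thesis
      unfolding continuous_map_pairwise unit_interval_def continuous_map_in_subtopology o_def fst_conv snd_conv
      using continuous_map_fst by blast
  qed
  have fV: "fuzzy_map ?DR SX (\<lambda>(x, t). V x t)"
  proof -
    have a: "continuous_map ?DR euclideanreal (\<lambda>z. max 0 (- snd z))" "continuous_map ?DR euclideanreal (\<lambda>z. max 0 (snd z))"
      by (intro continuous_map_real_max continuous_map_minus continuous_map_snd; simp)+
    note A = fuzzy_map_compose[OF f\<Gamma>(1) arg[OF a(1)]] and B = fuzzy_map_compose[OF f\<Gamma>(2) arg[OF a(2)]]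
    have "fuzzy_map ?DR SX (\<lambda>z. if snd z \<le> 0 then \<Gamma> fst (fst z) (squeeze e (1 / (1 + max 0 (- snd z))))
        else \<Gamma> snd (fst z) (squeeze e (1 / (1 + max 0 (snd z)))))"
    proof (rule fuzzy_map_cases_le)
      fix z assume z: "z \<in> topspace ?DR" "snd z = 0"
      then have "\<Gamma> fst (fst z) 1 = \<Gamma> snd (fst z) 1" using \<gamma>0(2)[of "fst z"] by (auto simp: \<Gamma>_def)
      then show "\<Gamma> fst (fst z) (squeeze e (1 / (1 + max 0 (- snd z)))) = \<Gamma> snd (fst z) (squeeze e (1 / (1 + max 0 (snd z))))"
        using z e0 squeeze_simps(1)[of e 1] by simp
    qed (use A B in \<open>auto intro: continuous_map_snd\<close>)
    then show ?thesis by (rule fuzzy_map_cong) (auto simp: V_def)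
  qed
  \<comment> \<open>The constant \<open>2 * M + 1\<close> is the time at which the parameter drops
    to \<open>e / 2\<close>, where \<open>squeeze\<close> becomes 0.\<close>
  have small: "1 / (1 + t) \<le> e / 2" if "t \<ge> real (2 * M + 1)" for t :: real
    using that by (simp add: e_def field_simps)
  have p: "pdat ?D (real (2 * M + 1)) y V"
    unfolding pdat_def
  proof (intro conjI fy fV ballI allI impI)
    fix x assume x: "x \<in> topspace ?D"
    show "V x t = pushv f (y x)" if "t \<le> - real (2 * M + 1)" for t
      using small[of "- t"] that squeeze_simps(2) \<Gamma>0[OF x] by (simp add: V_def)
    show "V x t = pushv g (y x)" if "t \<ge> real (2 * M + 1)" for t
      using small[of t] that squeeze_simps(2) \<Gamma>0[OF x] by (simp add: V_def)
  qed
  have \<zeta>: "fuzzy_map (Sph n) cliques (\<lambda>x. PZ.coord (u x))" by (rule coordZ[OF compact_space_disk_boundary u])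
  have z: "PZ.coord (u x) \<in> FZ" if "x \<in> disk_boundary n" for x
    using fuzzy_mapD(1)[OF \<zeta>] that disk_boundary_subset by auto
  have pb: "pdat (Sph n) (real M) (\<lambda>x. yof (PZ.coord (u x))) (\<lambda>x. path_of (PZ.coord (u x)))"
    by (rule pdat_path_of[OF \<zeta>]) (use st in simp)
  have yb: "y x = yof (PZ.coord (u x))" if x: "x \<in> disk_boundary n" for x
    unfolding y_def uv[OF x] compare_def mkP_def fst_conv by (rule coord_uncoordY[OF yof_fuzzy[OF z[OF x]]])
  define L where "L x s = (if s = 0 then pushv f (y x) else path_of (PZ.coord (u x)) (1 - 1 / s))" for x s
  define R where "R x s = (if s = 0 then pushv g (y x) else path_of (PZ.coord (u x)) (1 / s - 1))" for x s
  have path_ends: "path_of (PZ.coord (u x)) t = pushv f (y x)" if "x \<in> disk_boundary n" "t \<le> - real M" for x t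
    using pdatD(3)[OF pb, of x t] that yb disk_boundary_subset by auto
  have path_ends': "path_of (PZ.coord (u x)) t = pushv g (y x)" if "x \<in> disk_boundary n" "t \<ge> real M" for x t
    using pdatD(4)[OF pb, of x t] that yb disk_boundary_subset by auto
  have pathF: "path_of (PZ.coord (u x)) t \<in> fuzzy SX" if "x \<in> disk_boundary n" for x t
    using pdatD(6)[OF pb, of x t] that disk_boundary_subset by auto
  have \<gamma>b: "\<gamma> x s = (PX.uncoord (L x s), PX.uncoord (R x s))" if "x \<in> disk_boundary n" "s \<in> {0..1}" for x s
    using that yb[OF that(1)] by (simp add: \<gamma>_def uv compare_def mkP_def L_def R_def)
  have LR: "L x s = pushv f (y x)" "R x s = pushv g (y x)" if x: "x \<in> disk_boundary n" and s: "0 \<le> s" "s \<le> e" for x s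
  proof -
    have "1 / s \<ge> real M + 1" if "s \<noteq> 0"
    proof -
      have "s > 0" using s that by simp
      then show ?thesis using s(2) by (simp add: e_def field_simps)
    qed
    then show "L x s = pushv f (y x)" "R x s = pushv g (y x)"
      using path_ends[OF x, of "1 - 1 / s"] path_ends'[OF x, of "1 / s - 1"] by (auto simp: L_def R_def)
  qed
  \<comment> \<open>Squeezing moves only parameters below \<open>e\<close>, and there the boundary
    paths are constant. The second claim, for all stages between squeezing and the identity, makes
    the homotopy \<open>h\<close> relative to the boundary.\<close>
  have \<gamma>c: "\<gamma> x (squeeze e s) = \<gamma> x s" "\<gamma> x ((1 - r) * squeeze e s + r * s) = \<gamma> x s"
    if x: "x \<in> disk_boundary n" and s: "s \<in> {0..1}" and r: "r \<in> {0..1}" for x s r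
  proof -
    have main: "\<gamma> x s' = \<gamma> x s" if "0 \<le> s'" "s' \<le> s" "s \<ge> e \<Longrightarrow> s' = s" for s'
    proof (cases "s \<ge> e")
      case False
      have "s' \<in> {0..1}" using that s by auto
      then show ?thesis unfolding \<gamma>b[OF x s] \<gamma>b[OF x \<open>s' \<in> {0..1}\<close>]
        using LR[OF x, of s] LR[OF x, of s'] that False s by simp
    qed (use that in simp)
    have q: "0 \<le> squeeze e s" "squeeze e s \<le> s" using squeeze_simps(3)[of s e] s by auto
    show "\<gamma> x (squeeze e s) = \<gamma> x s" by (rule main) (use q s squeeze_simps(1)[of e s] in auto)
    show "\<gamma> x ((1 - r) * squeeze e s + r * s) = \<gamma> x s"
    proof (rule main)
      show "0 \<le> (1 - r) * squeeze e s + r * s" using q s r by simp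
      show "(1 - r) * squeeze e s + r * s \<le> s" using q r by (intro convex_bound_le) auto
      show "(1 - r) * squeeze e s + r * s = s" if "s \<ge> e"
        using squeeze_simps(1)[OF that] s by (simp add: algebra_simps)
    qed
  qed
  have Vb: "V x t = path_of (PZ.coord (u x)) t" if x: "x \<in> disk_boundary n" for x t
  proof (cases "t \<le> 0")
    case True
    let ?s = "1 / (1 - t)"
    have s: "?s \<in> {0..1}" "?s \<noteq> 0" "1 - 1 / ?s = t" using True by auto
    have "V x t = PX.coord (fst (\<gamma> x ?s))" using True \<gamma>c(1)[OF x s(1), of 0] by (simp add: V_def \<Gamma>_def)
    also have "\<dots> = path_of (PZ.coord (u x)) (1 - 1 / ?s)"
      unfolding \<gamma>b[OF x s(1)] L_def fst_conv using s(2) coord_uncoordX[OF pathF[OF x]] by simp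
    finally show ?thesis unfolding s(3) .
  next
    case False
    let ?s = "1 / (1 + t)"
    have s: "?s \<in> {0..1}" "?s \<noteq> 0" "1 / ?s - 1 = t" using False by auto
    have "V x t = PX.coord (snd (\<gamma> x ?s))" using False \<gamma>c(1)[OF x s(1), of 0] by (simp add: V_def \<Gamma>_def)
    also have "\<dots> = path_of (PZ.coord (u x)) (1 / ?s - 1)"
      unfolding \<gamma>b[OF x s(1)] R_def snd_conv using s(2) coord_uncoordX[OF pathF[OF x]] by simp
    finally show ?thesis unfolding s(3) .
  qed
  let ?Q = "\<lambda>h. \<forall>x\<in>disk_boundary n. h x = v x"
  let ?ID = "prod_topology unit_interval (disk n)"
  define c where "c r s = (1 - r) * squeeze e s + r * s" for r s :: real
  have cI: "c r s \<in> {0..1}" if "r \<in> {0..1}" "s \<in> {0..1}" for r s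
  proof -
    have q: "0 \<le> squeeze e s" "squeeze e s \<le> 1" using squeeze_simps(3)[of s e] that by auto
    have "0 \<le> c r s" using q that by (simp add: c_def)
    moreover have "c r s \<le> 1" unfolding c_def using q that by (intro convex_bound_le) auto
    ultimately show ?thesis by simp
  qed
  have c01: "c r 0 = 0" "c r 1 = 1" "c 1 s = s" "c 0 s = squeeze e s" for r s
    using squeeze_simps(1)[of e 1] squeeze_simps(2)[of 0 e] e0 by (simp_all add: c_def)
  define h where "h z = (fst (v (snd z)), fst (snd (v (snd z))), restrict (\<lambda>s. \<gamma> (snd z) (c (fst z) s)) {0..1})" for z
  have ch: "continuous_map ?ID Hp h"
    unfolding continuous_map_hpullback_iff
  proof (intro conjI ballI)
    show "continuous_map ?ID BY (\<lambda>z. fst (h z))" "continuous_map ?ID BX (\<lambda>z. fst (snd (h z)))"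
      using vv continuous_map_compose[OF continuous_map_snd, of ?D BY "\<lambda>x. fst (v x)" unit_interval]
        continuous_map_compose[OF continuous_map_snd, of ?D BX "\<lambda>x. fst (snd (v x))" unit_interval]
      by (simp_all add: h_def o_def)
    let ?IDI = "prod_topology ?ID unit_interval"
    have s: "continuous_map ?IDI euclideanreal snd"
      unfolding unit_interval_def using continuous_map_snd continuous_map_into_fulltopology by blast
    have r: "continuous_map ?IDI euclideanreal (\<lambda>z. fst (fst z))"
    proof (rule continuous_map_compose[OF continuous_map_fst, unfolded o_def])
      show "continuous_map ?ID euclideanreal fst"
        unfolding unit_interval_def using continuous_map_fst continuous_map_into_fulltopology by blast
    qed
    have "continuous_map ?IDI euclideanreal (\<lambda>z. c (fst (fst z)) (snd z))"
      unfolding c_def by (intro continuous_map_add continuous_map_real_mult continuous_map_diff continuous_map_squeeze s r) auto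
    moreover have "continuous_map ?IDI ?D (\<lambda>z. snd (fst z))"
      by (rule continuous_map_compose[OF continuous_map_fst continuous_map_snd, unfolded o_def])
    moreover have "(\<lambda>z. c (fst (fst z)) (snd z)) \<in> topspace ?IDI \<rightarrow> {0..1}"
      using cI by auto
    ultimately have "continuous_map ?IDI ?DI (\<lambda>z. (snd (fst z), c (fst (fst z)) (snd z)))"
      unfolding continuous_map_pairwise unit_interval_def continuous_map_in_subtopology o_def fst_conv snd_conv by blast
    from continuous_map_compose[OF this \<gamma>]
    have "continuous_map ?IDI (prod_topology BX BX) (\<lambda>(z, s). \<gamma> (snd z) (c (fst z) s))"
      by (simp add: o_def case_prod_unfold)
    from continuous_map_curry[OF this]
    show "continuous_map ?ID (compact_open unit_interval (prod_topology BX BX)) (\<lambda>z. snd (snd (h z)))"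
      by (simp add: h_def)
    fix z assume "z \<in> topspace ?ID"
    then have x: "snd z \<in> topspace ?D" by auto
    show "snd (snd (h z)) 0 = ends (fst (h z))" "snd (snd (h z)) 1 = (fst (snd (h z)), fst (snd (h z)))"
      using \<gamma>0[OF x] by (simp_all add: h_def c01)
  qed
  have ext: "restrict (\<gamma> x) {0..1} = \<gamma> x" if x: "x \<in> topspace ?D" for x
  proof -
    have "continuous_map ?D (compact_open unit_interval (prod_topology BX BX)) \<gamma>" using vv unfolding \<gamma>_def by blast
    then have "\<gamma> x \<in> cmaps unit_interval (prod_topology BX BX)" using continuous_map_funspace x by fastforce
    then show ?thesis by (auto simp: cmaps_def restrict_def fun_eq_iff)
  qed
  have h0: "h (0, x) = mkP (y x) (V x)" if x: "x \<in> topspace ?D" for x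
  proof -
    have V0: "PX.uncoord (V x 0) = fst (snd (v x))"
      using u\<Gamma>(1)[OF x, of 1] \<gamma>0(2)[OF x] squeeze_simps(1)[of e 1] e0 by (simp add: V_def)
    have "\<gamma> x (squeeze e s) = (if s = 0 then (PX.uncoord (pushv f (y x)), PX.uncoord (pushv g (y x)))
       else (PX.uncoord (V x (1 - 1 / s)), PX.uncoord (V x (1 / s - 1))))" if s: "s \<in> {0..1}" for s
    proof (cases "s = 0")
      case True
      then show ?thesis using \<gamma>ends[OF x] squeeze_simps(2)[of 0 e] e0 by simp
    next
      case False
      then have s': "0 < s" "s \<le> 1" using s by auto
      have q: "squeeze e s \<in> {0..1}" using squeeze_simps(3)[of s e] s by auto
      have "1 - 1 / s \<le> 0" using s' by simp
      then have l: "V x (1 - 1 / s) = \<Gamma> fst x (squeeze e s)" by (simp add: V_def)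
      have r: "PX.uncoord (V x (1 / s - 1)) = snd (\<gamma> x (squeeze e s))"
      proof (cases "s = 1")
        case True
        then show ?thesis using V0 \<gamma>0(2)[OF x] squeeze_simps(1)[of e 1] e0 by simp
      next
        case False
        then have "\<not> 1 / s - 1 \<le> 0" using s' by simp
        then have "V x (1 / s - 1) = \<Gamma> snd x (squeeze e s)" by (simp add: V_def)
        then show ?thesis using u\<Gamma>(2)[OF x q] by simp
      qed
      show ?thesis using False u\<Gamma>(1)[OF x q] by (simp add: l r)
    qed
    then have "restrict (\<lambda>s. \<gamma> x (squeeze e s)) {0..1} = snd (snd (mkP (y x) (V x)))"
      unfolding mkP_def snd_conv by (intro restrict_ext) blast
    then show ?thesis using V0 uy[OF x] by (simp add: h_def c01 mkP_def)
  qed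
  have "homotopic_with ?Q ?D Hp (\<lambda>x. mkP (y x) (V x)) v"
  proof (subst homotopic_with)
    show "?Q h = ?Q k" if "\<And>x. x \<in> topspace ?D \<Longrightarrow> h x = k x" for h k
      using that disk_boundary_subset by (metis subsetD)
    show "\<exists>h. continuous_map (prod_topology (top_of_set {0..1::real}) ?D) Hp h \<and>
       (\<forall>x\<in>topspace ?D. h (0, x) = mkP (y x) (V x)) \<and> (\<forall>x\<in>topspace ?D. h (1, x) = v x) \<and> (\<forall>t\<in>{0..1}. ?Q (\<lambda>x. h (t, x)))"
    proof (intro exI[of _ h] conjI ballI)
      show "continuous_map (prod_topology (top_of_set {0..1::real}) ?D) Hp h" using ch by (simp add: unit_interval_def)
      show "h (0, x) = mkP (y x) (V x)" if "x \<in> topspace ?D" for x by (rule h0[OF that])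
      show "h (1, x) = v x" if x: "x \<in> topspace ?D" for x
        using ext[OF x] by (simp add: h_def c01 \<gamma>_def)
      show "h (t, x) = v x" if t: "t \<in> {0..1}" and x: "x \<in> disk_boundary n" for t x
      proof -
        have xD: "x \<in> topspace ?D" using x disk_boundary_subset by blast
        have "restrict (\<lambda>s. \<gamma> x (c t s)) {0..1} = restrict (\<gamma> x) {0..1}"
          using \<gamma>c(2)[OF x _ t] unfolding c_def by (intro restrict_ext) blast
        then show ?thesis using ext[OF xD] by (simp add: h_def \<gamma>_def)
      qed
    qed
  qed
  note hV = this
  have "solvable n u' v" if s: "solvable n u' (\<lambda>x. mkP (y x) (V x))" for u'
  proof -
    from s[unfolded solvable_def]
    obtain l where l: "continuous_map ?D W l \<and> (\<forall>x\<in>disk_boundary n. l x = u' x) \<and>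
      homotopic_with (\<lambda>h. \<forall>x\<in>disk_boundary n. h x = mkP (y x) (V x)) ?D Hp (compare \<circ> l) (\<lambda>x. mkP (y x) (V x))" by (rule exE)
    have mv: "mkP (y x) (V x) = v x" if "x \<in> disk_boundary n" for x
      using homotopic_with_imp_property[OF hV] that by blast
    have "(\<lambda>h. \<forall>x\<in>disk_boundary n. h x = mkP (y x) (V x)) = ?Q"
      by (rule HOL.ext, rule ball_cong[OF refl]) (simp add: mv)
    then have "homotopic_with ?Q ?D Hp (compare \<circ> l) (\<lambda>x. mkP (y x) (V x))" using l by simp
    then have "homotopic_with ?Q ?D Hp (compare \<circ> l) v" using hV by (rule homotopic_with_trans)
    then show ?thesis unfolding solvable_def using l by blast
  qed
  then show ?thesis using that p yb Vb by blast
qed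

end

section \<open>Sampling a fine path\<close>

text \<open>During the block of \<open>N\<close> arguments with quotient \<open>j\<close> the walk
  alternates between \<open>j\<close> and \<open>j + 1\<close>, beginning at \<open>j\<close>. As
  \<open>N\<close> is odd it also finishes the block at \<open>j\<close>, so the first value
  \<open>j + 1\<close> of the next block is again one step away.\<close>

definition slow :: "int \<Rightarrow> int \<Rightarrow> int" where
  "slow N i = i div N + (i mod N) mod 2"

context
  fixes N :: int
  assumes N: "3 \<le> N" "odd N"
begin

lemma div_unique:
  assumes "N * j \<le> i" "i < N * (j + 1)"
  shows "i div N = j" "i mod N = i - N * j"
proof -
  have "i = N * j + (i - N * j)" "0 \<le> i - N * j" "i - N * j < N" using assms by (auto simp: algebra_simps)
  then show "i div N = j" "i mod N = i - N * j"
    by (metis int_div_pos_eq, metis int_mod_pos_eq)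
qed

lemma div_bounds: "N * (i div N) \<le> i" "i < N * (i div N + 1)"
proof -
  have "N * (i div N) + i mod N = i" by simp
  moreover have "0 \<le> i mod N" "i mod N < N" using N by auto
  ultimately show "N * (i div N) \<le> i" "i < N * (i div N + 1)" unfolding distrib_left by linarith+
qed

lemma parity_flip: "(r + 1) mod 2 = 1 - r mod (2 :: int)" "r mod 2 = 0 \<or> r mod (2 :: int) = 1"
  by presburger+

lemma slow_Suc:
  "(i + 1) div N = i div N \<and> slow N (i + 1) = i div N + (1 - (i mod N) mod 2) \<or>
   (i + 1) div N = i div N + 1 \<and> slow N i = i div N \<and> slow N (i + 1) = i div N + 1"
proof (cases "i + 1 < N * (i div N + 1)")
  case True
  then have d: "(i + 1) div N = i div N" "(i + 1) mod N = i + 1 - N * (i div N)"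
    using div_unique[of "i div N" "i + 1"] div_bounds(1)[of i] by auto
  moreover have "i mod N = i - N * (i div N)" by (simp add: minus_mult_div_eq_mod)
  ultimately have "(i + 1) mod N = i mod N + 1" by simp
  then have "((i + 1) mod N) mod 2 = 1 - (i mod N) mod 2" by (simp only: parity_flip)
  then show ?thesis using d(1) by (simp add: slow_def)
next
  case False
  then have e: "i + 1 = N * (i div N + 1)" using div_bounds(2)[of i] by simp
  then have "(i + 1) div N = i div N + 1" "(i + 1) mod N = 0" using N(1) by auto
  moreover have "i mod N = N - 1"
  proof -
    have "i mod N = i - N * (i div N)" by (simp add: minus_mult_div_eq_mod)
    then show ?thesis using e unfolding distrib_left by linarith
  qed
  then have "(i mod N) mod 2 = 0" using N(2) by simp
  ultimately show ?thesis by (simp add: slow_def)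
qed

lemma slow_div: "slow N i = i div N \<or> slow N i = i div N + 1"
  unfolding slow_def using parity_flip(2)[of "i mod N"] by auto

text \<open>Only a block border inside the window matters. The first two values stay in
  \<open>{j, j + 1}\<close>; the third can be \<open>j + 2\<close> if the second argument opens the
  next block.\<close>

lemma slow_window:
  assumes "j = i div N" "l \<in> {i..i + 2}"
  shows "slow N l \<in> {j..j + 2}"
proof -
  have "l = i \<or> l = i + 1 \<or> l = i + 1 + 1" using assms(2) by auto
  moreover have "slow N i \<in> {j..j + 1}" using slow_div[of i] assms(1) by auto
  moreover have "slow N (i + 1) \<in> {j..j + 1}"
    using slow_Suc[of i] parity_flip(2)[of "i mod N"] assms(1) by auto
  moreover have "slow N (i + 1 + 1) \<in> {j..j + 2}"
    using slow_Suc[of i] slow_Suc[of "i + 1"] slow_div[of "i + 1 + 1"] assms(1) by auto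
  ultimately show ?thesis by auto
qed

lemma walk_slow: "0 \<le> M \<Longrightarrow> walk M (N * (M + 1)) (slow N)"
  unfolding walk_def
proof (intro conjI allI impI)
  assume M: "0 \<le> M"
  fix i
  show "\<bar>slow N (i + 1) - slow N i\<bar> = 1"
    using slow_Suc[of i] parity_flip(2)[of "i mod N"] unfolding slow_def by auto
  \<comment> \<open>With quotient \<open>j\<close> and remainder \<open>r\<close>, the difference
    consists of a multiple of \<open>N - 1\<close>, even because \<open>N\<close> is odd, and of
    \<open>r - r mod 2\<close>.\<close>
  have "slow N i - i = - (N * (i div N) - i div N) - (i mod N - i mod N mod 2)"
    unfolding slow_def using mult_div_mod_eq[of N i] by linarith
  moreover have "even (N * (i div N) - i div N)" using N(2) by simp
  moreover have "even (r - r mod 2)" for r :: int by presburger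
  ultimately show "even (slow N i - i)" by (simp only: dvd_diff dvd_minus_iff)
  show "slow N i \<le> 1 - M" if "i \<le> 1 - N * (M + 1)"
  proof -
    have "i < N * (- M)" using that N(1) by (simp add: algebra_simps)
    then have "i div N < - M" using div_bounds(1)[of i] N(1) by (metis mult_less_cancel_left_pos le_less_trans less_le_trans zero_less_numeral)
    then show ?thesis using slow_div[of i] by auto
  qed
  show "M \<le> slow N i" if "N * (M + 1) \<le> i"
  proof -
    have "N * (M + 1) < N * (i div N + 1)" using that div_bounds(2)[of i] by linarith
    then have "M + 1 < i div N + 1" using N(1) by (simp add: mult_less_cancel_left_pos)
    then show ?thesis using slow_div[of i] by auto
  qed
qed

text \<open>The slow walk at time \<open>t\<close> and the rescaled time \<open>t / N\<close> lie in
  the same unit interval, so sliding one into the other stays in one star.\<close>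

lemma pos_slow:
  assumes j: "j = \<lfloor>t / real_of_int N\<rfloor>"
  shows "real_of_int j \<le> pos (slow N) t" "pos (slow N) t \<le> real_of_int j + 1" "\<lfloor>t\<rfloor> div N = j"
proof -
  have f: "\<lfloor>t\<rfloor> div N = j" using N(1) j by (simp add: floor_divide_real_eq_div)
  then show "\<lfloor>t\<rfloor> div N = j" .
  have w: "\<And>l. l \<in> {\<lfloor>t\<rfloor>..\<lfloor>t\<rfloor> + 2} \<Longrightarrow> slow N l \<in> {j..j + 2}" using slow_window f by blast
  show "real_of_int j \<le> pos (slow N) t" "pos (slow N) t \<le> real_of_int j + 1"
    using pos_window[OF walk_slow[of 0] w] by auto
qed

end

text \<open>The cut at 1/2, rescaled to reach 1 again. Weights up to 1/2 are discarded; weight 1 is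
  kept, as a fuzzy clique needs points of value 1.\<close>

definition shrink :: "real \<Rightarrow> real" where
  "shrink c = max 0 (2 * c - 1)"

lemma shrink: "shrink c \<noteq> 0 \<longleftrightarrow> 1 / 2 < c" "0 \<le> shrink c" "c \<le> 1 \<Longrightarrow> shrink c \<le> 1" "shrink c = 1 \<longleftrightarrow> c = 1"
  by (auto simp: shrink_def)

section \<open>Fuzzy cliques sampled from a path\<close>

context bigraph_maps
begin

lemma bip_setsD:
  assumes "L \<in> bip_sets G" "u \<in> L" "v \<in> L" "col G u \<noteq> col G v"
  shows "(u, v) \<in> edges G"
  using assms unfolding bip_sets_def by blast

lemma bip_sets_member:
  assumes "L \<in> bip_sets G" "c = 0 \<or> c = 1"
  shows "\<exists>v. v \<in> verts G \<and> v \<in> L \<and> col G v = c"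
  using assms unfolding bip_sets_def by blast

lemma edges_Z_sym:
  assumes "z \<in> verts Z" "z' \<in> verts Z" "(z, z') \<in> edges Z"
  shows "(z', z) \<in> edges Z"
proof -
  note e = assms(3)[unfolded edges_Z[OF assms(1,2)]]
  have "(fst z' i, fst z j) \<in> edges X" if "\<bar>i - j\<bar> = 1" for i j
  proof -
    have "\<bar>j - i\<bar> = 1" using that by linarith
    then show ?thesis using e is_bigraphD(2)[OF X] by blast
  qed
  then show ?thesis unfolding edges_Z[OF assms(2,1)] using e is_bigraphD(2)[OF Y] by blast
qed

text \<open>A vertex of stage \<open>B\<close> is determined by its pair in \<open>Y\<close> and its
  values on \<open>{-B..B}\<close>, since outside both ends are images of the pair.\<close>

lemma finite_zvert:
  assumes "finite U" "finite U'"
  shows "finite {z. zvert B z \<and> (\<forall>i\<in>{- B..B}. fst z i \<in> U) \<and> (\<forall>c\<in>{0, 1}. snd z c \<in> U')}" (is "finite ?S")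
proof -
  let ?r = "\<lambda>z. (restrict (fst z) {- B..B}, snd z)"
  have ex: "snd z \<in> extensional {0, 1}" if "zvert B z" for z
    using that unfolding zvert_def verts_exp_K2 by (elim conjE)
  have "inj_on ?r ?S"
  proof (rule inj_onI)
    fix z z' assume z: "z \<in> ?S" "z' \<in> ?S" and eq: "?r z = ?r z'"
    have s: "snd z = snd z'" and r: "restrict (fst z) {- B..B} = restrict (fst z') {- B..B}" using eq by simp_all
    have v: "zvert B z" "zvert B z'" using z by blast+
    have "fst z i = fst z' i" for i
    proof -
      consider "i \<in> {- B..B}" | "i \<le> 1 - B" | "i \<ge> B" by fastforce
      then show ?thesis
      proof cases
        case 1
        then show ?thesis using fun_cong[OF r, of i] by simp
      next
        case 2
        then show ?thesis using v s unfolding zvert_def by simp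
      next
        case 3
        then show ?thesis using v s unfolding zvert_def by simp
      qed
    qed
    then show "z = z'" using s by (intro prod_eqI) auto
  qed
  moreover have "?r ` ?S \<subseteq> (PiE {- B..B} (\<lambda>_. U)) \<times> (PiE {0, 1} (\<lambda>_. U'))"
  proof (rule image_subsetI)
    fix z assume "z \<in> ?S"
    then have "zvert B z" and z: "\<forall>i\<in>{- B..B}. fst z i \<in> U" "\<forall>c\<in>{0, 1}. snd z c \<in> U'" by blast+
    then have "snd z \<in> extensional {0, 1}" using ex by blast
    then have "snd z \<in> PiE {0, 1} (\<lambda>_. U')" using z(2) by (intro PiE_I) (auto simp: extensional_def)
    moreover have "restrict (fst z) {- B..B} \<in> PiE {- B..B} (\<lambda>_. U)" using z(1) by auto
    ultimately show "?r z \<in> (PiE {- B..B} (\<lambda>_. U)) \<times> (PiE {0, 1} (\<lambda>_. U'))" by simp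
  qed
  ultimately show ?thesis
    using assms by (meson finite_PiE finite_SigmaI finite_atLeastAtMost_int finite.intros finite_imageD finite_subset)
qed

text \<open>The fuzzy set of vertices of stage \<open>B\<close> sampled from the path \<open>V\<close> at the times \<open>i / N\<close>. Cutting
  weights at \<open>1/2\<close> makes samples at nearby times adjacent if \<open>V\<close> varies slowly.\<close>

definition sample :: "int \<Rightarrow> int \<Rightarrow> ('y \<Rightarrow> real) \<Rightarrow> (real \<Rightarrow> 'x \<Rightarrow> real) \<Rightarrow> (int \<Rightarrow> 'x) \<times> (nat \<Rightarrow> 'y) \<Rightarrow> real" where
  "sample N B y V z = (if zvert B z then
     shrink (min (min (y (snd z 0)) (y (snd z 1))) (Min ((\<lambda>i. V (real_of_int i / real_of_int N) (fst z i)) ` {- B..B}))) else 0)"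

end

locale sampled_path = bigraph_maps X Y f g
  for X :: "'x bigraph" and Y :: "'y bigraph" and f g :: "'y \<Rightarrow> 'x" +
  fixes N :: int and M B :: nat and K :: "'k topology" and y :: "'k \<Rightarrow> 'y \<Rightarrow> real" and V :: "'k \<Rightarrow> real \<Rightarrow> 'x \<Rightarrow> real"
  assumes N: "3 \<le> N" "odd N" and B: "int B = N * (int M + 1)" and p: "pdat K (real M) y V"
    and fine: "\<And>x t t' v. x \<in> topspace K \<Longrightarrow> \<bar>t - t'\<bar> \<le> 2 / real_of_int N \<Longrightarrow> \<bar>V x t v - V x t' v\<bar> < 1 / 2"
begin

lemma outer_times: "i \<le> 1 - int B \<Longrightarrow> real_of_int i / N \<le> - real M" "i \<ge> int B \<Longrightarrow> real_of_int i / N \<ge> real M"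
proof -
  have N0: "0 < real_of_int N" using N by simp
  assume "i \<le> 1 - int B"
  then have "i \<le> N * (- int M)" using B N(1) by (simp add: algebra_simps)
  then have "real_of_int i \<le> real_of_int (N * (- int M))" by linarith
  then show "real_of_int i / N \<le> - real M" using N0 by (simp add: divide_le_eq algebra_simps)
next
  have N0: "0 < real_of_int N" using N by simp
  assume "i \<ge> int B"
  then have "i \<ge> N * int M" using B N(1) by (simp add: algebra_simps)
  then have "real_of_int i \<ge> real_of_int (N * int M)" by linarith
  then show "real_of_int i / N \<ge> real M" using N0 by (simp add: le_divide_eq algebra_simps)
qed

text \<open>Beyond \<open>B\<close> the sampling times are past \<open>-M\<close> or
  \<open>M\<close>, where the path is the image of \<open>y\<close> and the vertex is the image of
  its pair. Weights there are bounded below by those of the pair, so the finite minimum in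
  \<open>sample\<close> controls all integers.\<close>

lemma V_outer:
  assumes x: "x \<in> topspace K" and z: "zvert (int B) z" and i: "i \<notin> {- int B..int B}"
    and c: "\<And>c. c \<in> {0, 1} \<Longrightarrow> t \<le> y x (snd z c)" "0 < t"
  shows "t \<le> V x (real_of_int i / real_of_int N) (fst z i)"
proof -
  have fin: "finite {v. y x v \<noteq> 0}" by (rule fuzzy_finite_support'[OF convSY pdatD(5)[OF p x]])
  have t: "t \<le> y x (snd z (par i))" using c(1) par_cases[of i] by auto
  consider "i \<le> 1 - int B" | "i \<ge> int B" using i by fastforce
  then show ?thesis
  proof cases
    case 1
    have "fst z i = f (snd z (par i))" using z 1 by (simp add: zvert_def)
    then show ?thesis
      unfolding pdatD(3)[OF p x outer_times(1)[OF 1]] push_ge_iff[OF fin c(2)] using t by blast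
  next
    case 2
    have "fst z i = g (snd z (par i))" using z 2 by (simp add: zvert_def)
    then show ?thesis
      unfolding pdatD(4)[OF p x outer_times(2)[OF 2]] push_ge_iff[OF fin c(2)] using t by blast
  qed
qed

text \<open>The last claim is where fineness enters: a weight above 1/2 stays nonzero under a
  variation below 1/2. The tolerance \<open>2 / N\<close> is needed because the path of a vertex at
  time \<open>t\<close> reads the integers from \<open>\<lfloor>t\<rfloor>\<close> to
  \<open>\<lfloor>t\<rfloor> + 2\<close>.\<close>

lemma sample_pos:
  assumes x: "x \<in> topspace K" and s: "sample N (int B) (y x) (V x) z \<noteq> 0"
  shows "zvert (int B) z" "c \<in> {0, 1} \<Longrightarrow> 1 / 2 < y x (snd z c)" "1 / 2 < V x (real_of_int i / real_of_int N) (fst z i)"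
    "\<bar>t - real_of_int i / real_of_int N\<bar> \<le> 2 / N \<Longrightarrow> V x t (fst z i) \<noteq> 0"
proof -
  show z: "zvert (int B) z" using s by (auto simp: sample_def split: if_splits)
  let ?m = "Min ((\<lambda>i. V x (real_of_int i / real_of_int N) (fst z i)) ` {- int B..int B})"
  have h: "1 / 2 < y x (snd z 0)" "1 / 2 < y x (snd z 1)" "1 / 2 < ?m"
    using s z by (simp_all add: sample_def shrink)
  then show c: "c \<in> {0, 1} \<Longrightarrow> 1 / 2 < y x (snd z c)" for c by auto
  show 3: "1 / 2 < V x (real_of_int i / real_of_int N) (fst z i)"
  proof (cases "i \<in> {- int B..int B}")
    case True
    then have "?m \<le> V x (real_of_int i / real_of_int N) (fst z i)" by (intro Min_le) auto
    then show ?thesis using h(3) by simp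
  next
    case False
    define t where "t = min (y x (snd z 0)) (y x (snd z 1))"
    have "1 / 2 < t" using h by (simp add: t_def)
    moreover have "t \<le> V x (real_of_int i / real_of_int N) (fst z i)"
      using \<open>1 / 2 < t\<close> by (intro V_outer[OF x z False]) (auto simp: t_def)
    ultimately show ?thesis by simp
  qed
  show "V x t (fst z i) \<noteq> 0" if "\<bar>t - real_of_int i / real_of_int N\<bar> \<le> 2 / N"
    using fine[OF x that, of "fst z i"] 3 by auto
qed

text \<open>The second vertex need not be sampled. The criterion serves for two samples, and later
  for a sample and a slowed down boundary vertex; only the common carriers \<open>L\<close>
  differ.\<close>

lemma sample_edges:
  assumes x: "x \<in> topspace K" and s: "sample N (int B) (y x) (V x) z \<noteq> 0" and z': "z' \<in> verts Z"
    and y': "\<And>c. c \<in> {0, 1} \<Longrightarrow> y x (snd z' c) \<noteq> 0 \<and> col Y (snd z' c) = c"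
    and V': "\<And>i j. \<bar>i - j\<bar> = 1 \<Longrightarrow> \<exists>L\<in>SX. fst z i \<in> L \<and> fst z' j \<in> L"
  shows "(z, z') \<in> edges Z"
proof -
  have z: "z \<in> verts Z" using sample_pos(1)[OF x s] verts_Z by blast
  have col: "col Y (snd z c) = c" if "c \<in> {0, 1}" for c
  proof -
    have "\<forall>i\<in>{0, 1}. snd z i \<in> verts Y \<and> col Y (snd z i) = i"
      using sample_pos(1)[OF x s] unfolding zvert_def verts_exp_K2 by (elim conjE)
    from bspec[OF this that] show ?thesis by (rule conjunct2)
  qed
  have Ye: "(snd z a, snd z' b) \<in> edges Y" if ab: "a \<in> {0, 1}" "b \<in> {0, 1}" "a \<noteq> b" for a b
  proof (rule bip_setsD[OF fuzzyD(4)[OF pdatD(5)[OF p x]]])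
    show "snd z a \<in> {v. y x v \<noteq> 0}" using sample_pos(2)[OF x s ab(1)] by auto
    show "snd z' b \<in> {v. y x v \<noteq> 0}" using y'[OF ab(2)] by simp
    show "col Y (snd z a) \<noteq> col Y (snd z' b)" using col[OF ab(1)] y'[OF ab(2)] ab(3) by simp
  qed
  have Xe: "(fst z i, fst z' j) \<in> edges X" if ij: "\<bar>i - j\<bar> = 1" for i j
  proof -
    obtain L where L: "L \<in> SX" "fst z i \<in> L" "fst z' j \<in> L" using V'[OF ij] by blast
    have "odd (i - j)" using ij by presburger
    then have "col X (fst z i) \<noteq> col X (fst z' j)"
      using Z_colour[OF z, of i] Z_colour[OF z', of j] by (simp add: par_eq_iff)
    then show ?thesis using bip_setsD[OF L] by blast
  qed
  show ?thesis unfolding edges_Z[OF z z'] using Xe Ye by simp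
qed

lemma N_real: "0 < real_of_int N" using N by simp

lemma time_step: "\<bar>i - j\<bar> \<le> 2 \<Longrightarrow> \<bar>real_of_int j / N - real_of_int i / N\<bar> \<le> 2 / N"
proof -
  assume "\<bar>i - j\<bar> \<le> 2"
  then have "\<bar>real_of_int j - real_of_int i\<bar> \<le> 2" by linarith
  then have "\<bar>real_of_int j - real_of_int i\<bar> / N \<le> 2 / N" using N_real by (intro divide_right_mono) auto
  then show ?thesis using N_real by (simp add: abs_divide flip: diff_divide_distrib)
qed

lemma sample_clique_subset:
  assumes x: "x \<in> topspace K" and A: "A \<subseteq> {z. sample N (int B) (y x) (V x) z \<noteq> 0}" "A \<noteq> {}" "finite A"
  shows "A \<in> cliques"
proof -
  have s: "sample N (int B) (y x) (V x) z \<noteq> 0" if "z \<in> A" for z using A(1) that by blast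
  have v: "z \<in> verts Z" if "z \<in> A" for z using sample_pos(1)[OF x s[OF that]] verts_Z by blast
  have "(z, z') \<in> edges Z" if zz: "z \<in> A" "z' \<in> A" for z z'
  proof (rule sample_edges[OF x s[OF zz(1)] v[OF zz(2)]])
    fix c :: nat assume c: "c \<in> {0, 1}"
    have "\<forall>i\<in>{0, 1}. snd z' i \<in> verts Y \<and> col Y (snd z' i) = i"
      using sample_pos(1)[OF x s[OF zz(2)]] unfolding zvert_def verts_exp_K2 by (elim conjE)
    from bspec[OF this c] show "y x (snd z' c) \<noteq> 0 \<and> col Y (snd z' c) = c"
      using sample_pos(2)[OF x s[OF zz(2)] c] by auto
  next
    fix i j :: int assume ij: "\<bar>i - j\<bar> = 1"
    have "V x (real_of_int j / real_of_int N) (fst z i) \<noteq> 0" using time_step[of i j] ij by (intro sample_pos(4)[OF x s[OF zz(1)]]) auto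
    moreover have "V x (real_of_int j / real_of_int N) (fst z' j) \<noteq> 0" using sample_pos(3)[OF x s[OF zz(2)], of j] by auto
    ultimately show "\<exists>L\<in>SX. fst z i \<in> L \<and> fst z' j \<in> L"
      by (intro bexI[OF _ fuzzyD(4)[OF pdatD(6)[OF p x, of "real_of_int j / real_of_int N"]]]) simp
  qed
  then show ?thesis using A(2,3) v unfolding clique_poset_def by blast
qed

text \<open>Nonemptiness of the set of value 1 is the one point of the fuzzy clique condition that
  cutting cannot give. At each time the path has points of weight 1 in both colours, and these are
  assembled into a vertex.\<close>

lemma sample_full:
  assumes x: "x \<in> topspace K"
  shows "\<exists>z. sample N (int B) (y x) (V x) z = 1"
proof -
  have yF: "y x \<in> fuzzy SY" by (rule pdatD(5)[OF p x])
  have "\<exists>v. v \<in> verts Y \<and> y x v = 1 \<and> col Y v = c" if "c \<in> {0, 1}" for c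
    using bip_sets_member[OF fuzzyD(3)[OF yF]] that by simp
  then obtain k0 where k0: "\<And>c. c \<in> {0, 1} \<Longrightarrow> k0 c \<in> verts Y \<and> y x (k0 c) = 1 \<and> col Y (k0 c) = c" by metis
  define k where "k = restrict k0 {0, 1}"
  have k: "k c \<in> verts Y" "y x (k c) = 1" "col Y (k c) = c" if "c \<in> {0, 1}" for c
    using k0[OF that] that by (simp_all add: k_def)
  have kv: "k \<in> verts (exp_graph Y K2)" unfolding verts_exp_K2 using k by (simp add: k_def)
  have "\<exists>v. v \<in> verts X \<and> V x t v = 1 \<and> col X v = par i" for i t
    using bip_sets_member[OF fuzzyD(3)[OF pdatD(6)[OF p x, of t]]] par_cases[of i] by simp
  then obtain H0 where H0: "\<And>t i. H0 t i \<in> verts X \<and> V x t (H0 t i) = 1 \<and> col X (H0 t i) = par i" by metis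
  \<comment> \<open>Inside, any choice of weight 1 and the right colour will do, since being a
    vertex involves no adjacency between consecutive values; outside, the choice is forced by the
    pair.\<close>
  define H where "H i = (if i \<le> 1 - int B then f (k (par i)) else if i \<ge> int B then g (k (par i)) else H0 (real_of_int i / real_of_int N) i)" for i
  have B0: "int B > 0" using B N(1) by (simp add: pos_add_strict)
  have kp: "k (par i) \<in> verts Y" "col Y (k (par i)) = par i" "y x (k (par i)) = 1" for i
    using k[of "par i"] par_cases[of i] by auto
  have zv: "zvert (int B) (H, k)"
    unfolding zvert_def fst_conv snd_conv
  proof (intro conjI allI impI kv)
    fix i
    show "H i \<in> verts X" "col X (H i) = par i"
      using homD(1,2)[OF f kp(1)[of i]] homD(1,2)[OF g kp(1)[of i]] kp(2)[of i] H0[of "real_of_int i / real_of_int N" i] by (auto simp: H_def)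
    show "i \<le> 1 - int B \<Longrightarrow> H i = f (k (par i))" by (simp add: H_def)
    show "int B \<le> i \<Longrightarrow> H i = g (k (par i))" using B0 by (simp add: H_def)
  qed
  have fin: "finite {v. y x v \<noteq> 0}" by (rule fuzzy_finite_support'[OF convSY yF])
  have one: "V x (real_of_int i / real_of_int N) (H i) = 1" for i
  proof -
    have "1 \<le> V x (real_of_int i / real_of_int N) (H i)"
    proof -
      consider "i \<le> 1 - int B" | "i \<ge> int B" "\<not> i \<le> 1 - int B" | "\<not> i \<le> 1 - int B" "\<not> i \<ge> int B" by linarith
      then show ?thesis
      proof cases
        case 1
        show ?thesis unfolding pdatD(3)[OF p x outer_times(1)[OF 1]]
          using 1 kp(3)[of i] by (subst push_ge_iff[OF fin]) (auto simp: H_def intro!: exI[of _ "k (par i)"])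
      next
        case 2
        show ?thesis unfolding pdatD(4)[OF p x outer_times(2)[OF 2(1)]]
          using 2 kp(3)[of i] by (subst push_ge_iff[OF fin]) (auto simp: H_def intro!: exI[of _ "k (par i)"])
      next
        case 3
        then show ?thesis using H0[of "real_of_int i / real_of_int N" i] by (simp add: H_def)
      qed
    qed
    moreover have "V x (real_of_int i / real_of_int N) (H i) \<le> 1" by (rule fuzzyD(2)[OF pdatD(6)[OF p x]])
    ultimately show ?thesis by simp
  qed
  have "(\<lambda>i. V x (real_of_int i / real_of_int N) (H i)) ` {- int B..int B} = {1}" using one by auto
  then have "sample N (int B) (y x) (V x) (H, k) = 1"
    using zv k(2)[of 0] k(2)[of 1] by (simp add: sample_def shrink)
  then show ?thesis by blast
qed

lemma sample_bounds: "x \<in> topspace K \<Longrightarrow> 0 \<le> sample N (int B) (y x) (V x) z \<and> sample N (int B) (y x) (V x) z \<le> 1"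
proof -
  assume x: "x \<in> topspace K"
  have "min (min (y x (snd z 0)) (y x (snd z 1))) m \<le> 1" for m
    using fuzzyD(2)[OF pdatD(5)[OF p x], of "snd z 0"] by (simp add: min_le_iff_disj)
  then show ?thesis unfolding sample_def by (simp add: shrink)
qed

lemma fuzzy_map_sample: "fuzzy_map K cliques (\<lambda>x. sample N (int B) (y x) (V x))"
proof -
  obtain U' where U': "finite U'" "\<And>x. x \<in> topspace K \<Longrightarrow> {v. y x v \<noteq> 0} \<subseteq> U'"
    using fuzzy_map_support[OF pdatD(1)[OF p]] by blast
  obtain U where U: "finite U" "\<And>z. z \<in> topspace (prod_topology K euclideanreal) \<Longrightarrow> {v. (\<lambda>(x, t). V x t) z v \<noteq> 0} \<subseteq> U"
    using fuzzy_map_support[OF pdatD(2)[OF p]] by blast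
  let ?S = "{z. zvert (int B) z \<and> (\<forall>i\<in>{- int B..int B}. fst z i \<in> U) \<and> (\<forall>c\<in>{0, 1}. snd z c \<in> U')}"
  have S: "finite ?S" by (rule finite_zvert[OF U(1) U'(1)])
  have sub: "{z. sample N (int B) (y x) (V x) z \<noteq> 0} \<subseteq> ?S" if x: "x \<in> topspace K" for x
  proof
    fix z assume "z \<in> {z. sample N (int B) (y x) (V x) z \<noteq> 0}"
    then have s: "sample N (int B) (y x) (V x) z \<noteq> 0" by simp
    have "fst z i \<in> U" for i
      using sample_pos(3)[OF x s, of i] U(2)[of "(x, real_of_int i / real_of_int N)"] x by auto
    moreover have "snd z c \<in> U'" if "c \<in> {0, 1}" for c
      using sample_pos(2)[OF x s that] U'(2)[OF x] by auto
    ultimately show "z \<in> ?S" using sample_pos(1)[OF x s] by blast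
  qed
  have inFZ: "sample N (int B) (y x) (V x) \<in> FZ" if x: "x \<in> topspace K" for x
  proof -
    let ?s = "sample N (int B) (y x) (V x)"
    have fin: "finite {z. ?s z \<noteq> 0}" using sub[OF x] S finite_subset by blast
    have le: "{z. ?s z = 1} \<subseteq> {z. ?s z \<noteq> 0}" by auto
    have ne: "{z. ?s z = 1} \<noteq> {}" using sample_full[OF x] by simp
    have "{z. ?s z = 1} \<in> cliques"
      by (rule sample_clique_subset[OF x le ne finite_subset[OF le fin]])
    moreover have "{z. ?s z \<noteq> 0} \<in> cliques"
      by (rule sample_clique_subset[OF x subset_refl _ fin]) (use le ne in blast)
    ultimately show ?thesis unfolding fuzzy_def using sample_bounds[OF x] by blast
  qed
  have "continuous_map K euclideanreal (\<lambda>x. sample N (int B) (y x) (V x) z)" for z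
  proof (cases "zvert (int B) z")
    case True
    have "continuous_map K euclideanreal (\<lambda>x. V x t v)" for t v
    proof -
      have "continuous_map K (prod_topology K euclideanreal) (\<lambda>x. (x, t))" by (simp add: continuous_map_pairwise o_def)
      from fuzzy_mapD(2)[OF fuzzy_map_compose[OF pdatD(2)[OF p] this], of v] show ?thesis by simp
    qed
    then show ?thesis
      unfolding sample_def shrink_def using True fuzzy_mapD(2)[OF pdatD(1)[OF p]]
      by (simp, intro continuous_map_real_max continuous_map_diff continuous_map_real_mult_left continuous_map_real_min continuous_map_Min) auto
  qed (simp add: sample_def)
  note cont = this
  show ?thesis
    unfolding fuzzy_map_def
  proof (intro conjI ballI allI exI[of _ ?S])
    show "sample N (int B) (y x) (V x) \<in> FZ" if "x \<in> topspace K" for x by (rule inFZ[OF that])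
    show "finite ?S" by (rule S)
    show "{z. sample N (int B) (y x) (V x) z \<noteq> 0} \<subseteq> ?S" if "x \<in> topspace K" for x by (rule sub[OF that])
    show "continuous_map K euclideanreal (\<lambda>x. sample N (int B) (y x) (V x) z)" for z by (rule cont)
  qed
qed

lemma stage_sample: "x \<in> topspace K \<Longrightarrow> stage (int B) (sample N (int B) (y x) (V x))"
  unfolding stage_def using sample_pos(1) by blast

lemma sample_near:
  assumes x: "x \<in> topspace K" and z: "sample N (int B) (y x) (V x) z \<noteq> 0" and i: "i \<in> {\<lfloor>t\<rfloor>..\<lfloor>t\<rfloor> + 2}"
  shows "V x (t / real_of_int N) (fst z i) \<noteq> 0"
proof -
  have "real_of_int \<lfloor>t\<rfloor> \<le> real_of_int i" "real_of_int i \<le> real_of_int \<lfloor>t\<rfloor> + 2" using i by auto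
  then have "\<bar>t - real_of_int i\<bar> \<le> 2" using frac_bounds[of t] by linarith
  then have "\<bar>t - real_of_int i\<bar> / N \<le> 2 / N" using N_real by (intro divide_right_mono) auto
  then have "\<bar>t / N - real_of_int i / N\<bar> \<le> 2 / N" using N_real by (simp add: abs_divide flip: diff_divide_distrib)
  then show ?thesis by (rule sample_pos(4)[OF x z])
qed

lemma path_of_sample_support:
  assumes x: "x \<in> topspace K"
  shows "{v. path_of (sample N (int B) (y x) (V x)) t v \<noteq> 0} \<subseteq> {v. V x (t / real_of_int N) v \<noteq> 0}"
proof
  fix v assume "v \<in> {v. path_of (sample N (int B) (y x) (V x)) t v \<noteq> 0}"
  then obtain z i where z: "sample N (int B) (y x) (V x) z \<noteq> 0" and i: "i \<in> {\<lfloor>t\<rfloor>..\<lfloor>t\<rfloor> + 2}" "v = fst z i"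
    using path_of_support[OF fuzzy_mapD(1)[OF fuzzy_map_sample x], of t] by blast
  show "v \<in> {v. V x (t / real_of_int N) v \<noteq> 0}" unfolding i(2) using sample_near[OF x z i(1)] by simp
qed

lemma yof_sample_support:
  assumes x: "x \<in> topspace K"
  shows "{v. yof (sample N (int B) (y x) (V x)) v \<noteq> 0} \<subseteq> {v. y x v \<noteq> 0}"
  unfolding yof_def push_supportZ[OF fuzzy_mapD(1)[OF fuzzy_map_sample x]]
proof clarify
  fix z c assume z: "sample N (int B) (y x) (V x) z \<noteq> 0" and c: "c \<in> {0, 1::nat}" "y x (snd z c) = 0"
  show False using sample_pos(2)[OF x z c(1)] c(2) by simp
qed

end

section \<open>Solution of fine lifting problems and of the general one\<close>

context bigraph_maps
begin

text \<open>The homotopy from the sampled path to \<open>V\<close> first joins the sampled path to \<open>V (t / N)\<close>, to which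
  it is contiguous, and then slides the time \<open>t / N\<close> to the position of the slow walk.\<close>

lemma solvable_fine:
  assumes \<zeta>: "fuzzy_map (Sph n) cliques \<zeta>" and st: "\<And>x. x \<in> disk_boundary n \<Longrightarrow> stage (int M) (\<zeta> x)"
    and p: "pdat (disk n) (real M) y V"
    and bd: "\<And>x. x \<in> disk_boundary n \<Longrightarrow> y x = yof (\<zeta> x)" "\<And>x t. x \<in> disk_boundary n \<Longrightarrow> V x t = path_of (\<zeta> x) t"
    and N: "3 \<le> N" "odd N" and B: "int B = N * (int M + 1)"
    and fine: "\<And>x t t' v. x \<in> topspace (disk n) \<Longrightarrow> \<bar>t - t'\<bar> \<le> 2 / real_of_int N \<Longrightarrow> \<bar>V x t v - V x t' v\<bar> < 1 / 2"
  shows "solvable n (\<lambda>x. PZ.uncoord (Tz (slow N) (\<zeta> x))) (\<lambda>x. mkP (y x) (\<lambda>t. V x (pos (slow N) t)))"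
proof -
  interpret S: sampled_path X Y f g N M B "disk n" y V
    by unfold_locales (rule N B p fine; assumption?)+
  let ?\<kappa> = "slow N" and ?SI = "prod_topology (Sph n) unit_interval" and ?DI = "prod_topology (disk n) unit_interval"
  define \<psi> where "\<psi> x = sample N (int B) (y x) (V x)" for x
  have D: "x \<in> topspace (disk n)" if "x \<in> disk_boundary n" for x using that disk_boundary_subset by blast
  have f\<psi>: "fuzzy_map (disk n) cliques \<psi>" using S.fuzzy_map_sample by (simp add: \<psi>_def[abs_def])
  have \<psi>F: "\<psi> x \<in> FZ" if "x \<in> topspace (disk n)" for x by (rule fuzzy_mapD(1)[OF f\<psi> that])
  have w: "walk (int M) (int B) ?\<kappa>" using walk_slow[OF N, of "int M"] by (simp add: B)
  have st': "\<And>x. x \<in> topspace (Sph n) \<Longrightarrow> stage (int M) (\<zeta> x)" using st by simp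
  note fT = fuzzy_map_T[OF w \<zeta> st']
  have z: "\<zeta> x \<in> FZ" if "x \<in> disk_boundary n" for x using fuzzy_mapD(1)[OF \<zeta>] that D by simp
  have zT: "Tz ?\<kappa> (\<zeta> x) \<in> FZ" if "x \<in> disk_boundary n" for x using fuzzy_mapD(1)[OF fT(1), of x] that D by simp
  have p\<psi>: "pdat (disk n) (real B) (\<lambda>x. yof (\<psi> x)) (\<lambda>x. path_of (\<psi> x))"
    by (rule pdat_path_of[OF f\<psi>]) (simp add: \<psi>_def S.stage_sample)
  define G where "G x s = hom s (\<psi> x) (Tz ?\<kappa> (\<zeta> x))" for x s
  \<comment> \<open>\<open>r\<close> is finished at \<open>s = 1/2\<close>, exactly when
    \<open>c\<close> begins to grow.\<close>
  define r where "r s = min 1 (2 * s)" for s :: real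
  define c where "c s = max 0 (2 * s - 1)" for s :: real
  define \<rho> where "\<rho> s t = (1 - c s) * (t / real_of_int N) + c s * pos ?\<kappa> t" for s t
  define yF where "yF x s = hom (r s) (yof (\<psi> x)) (y x)" for x s
  define VF where "VF x s t = hom (r s) (path_of (\<psi> x) t) (V x (\<rho> s t))" for x s t
  have c01: "0 \<le> c s" "c s \<le> 1" if "s \<in> {0..1}" for s using that by (auto simp: c_def)
  have N0: "0 < real_of_int N" using N by simp
  have cs: "continuous_map ?DI euclideanreal snd"
    unfolding unit_interval_def using continuous_map_snd continuous_map_into_fulltopology by blast
  have p\<rho>: "pdat ?DI (real (B + 1)) (\<lambda>z. y (fst z)) (\<lambda>z t. V (fst z) (\<rho> (snd z) t))"
  proof (rule pdat_reparam[OF p continuous_map_fst])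
    have cc: "continuous_map (prod_topology ?DI euclideanreal) euclideanreal (\<lambda>z. c (snd (fst z)))"
      unfolding c_def
      by (intro continuous_map_real_max continuous_map_diff continuous_map_real_mult_left
          continuous_map_compose[OF continuous_map_fst cs, unfolded o_def]) auto
    show "continuous_map (prod_topology ?DI euclideanreal) euclideanreal (\<lambda>(z, t). \<rho> (snd z) t)"
      unfolding \<rho>_def case_prod_unfold using N0
      by (intro continuous_map_add continuous_map_real_mult continuous_map_diff continuous_map_pos continuous_map_real_divide continuous_map_snd cc) auto
    fix z and t :: real assume "z \<in> topspace ?DI"
    then have s: "0 \<le> c (snd z)" "c (snd z) \<le> 1" using c01[of "snd z"] by auto
    have BN: "real (B + 1) / N \<ge> real M"
    proof -
      have "int M * N \<le> int (B + 1)" using B N(1) by (simp add: algebra_simps)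
      then have "real_of_int (int M * N) \<le> real_of_int (int (B + 1))" by linarith
      then show ?thesis using N0 by (simp add: le_divide_eq)
    qed
    show "\<rho> (snd z) t \<le> - real M" if t: "t \<le> - real (B + 1)"
    proof -
      have "t / N \<le> - real (B + 1) / N" using t N0 by (intro divide_right_mono) auto
      then have "t / N \<le> - real M" using BN by linarith
      moreover have "pos ?\<kappa> t \<le> - real M" using pos_ends(1)[OF w, of t] t by simp
      ultimately show ?thesis unfolding \<rho>_def using s by (intro convex_bound_le) auto
    qed
    show "real M \<le> \<rho> (snd z) t" if t: "t \<ge> real (B + 1)"
    proof -
      have "real (B + 1) / N \<le> t / N" using t N0 by (intro divide_right_mono) auto
      then have "- (t / N) \<le> - real M" using BN by linarith
      moreover have "- pos ?\<kappa> t \<le> - real M" using pos_ends(2)[OF w, of t] t by simp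
      ultimately have "(1 - c (snd z)) * (- (t / N)) + c (snd z) * (- pos ?\<kappa> t) \<le> - real M"
        using s by (intro convex_bound_le) auto
      then show ?thesis by (simp add: \<rho>_def)
    qed
  qed
  have y\<psi>: "{v. yof (\<psi> x) v \<noteq> 0} \<subseteq> {v. y x v \<noteq> 0}" if "x \<in> topspace (disk n)" for x
    unfolding \<psi>_def by (rule S.yof_sample_support[OF that])
  have V\<psi>: "{v. path_of (\<psi> x) t v \<noteq> 0} \<subseteq> {v. V x (t / real_of_int N) v \<noteq> 0}" if "x \<in> topspace (disk n)" for x t
    unfolding \<psi>_def by (rule S.path_of_sample_support[OF that])
  have pF: "pdat ?DI (real (B + 1)) (\<lambda>(x, s). yF x s) (\<lambda>(x, s). VF x s)"
  proof -
    have "pdat ?DI (real (B + 1)) (\<lambda>z. hom (r (snd z)) (yof (\<psi> (fst z))) (y (fst z)))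
      (\<lambda>z t. hom (r (snd z)) (path_of (\<psi> (fst z)) t) (V (fst z) (\<rho> (snd z) t)))"
    proof (rule pdat_hom[OF pdat_mono[OF pdat_compose[OF p\<psi> continuous_map_fst]] p\<rho>])
      show "continuous_map ?DI euclideanreal (\<lambda>z. r (snd z))"
        unfolding r_def by (intro continuous_map_real_min continuous_map_real_mult_left cs) auto
      fix z assume "z \<in> topspace ?DI"
      then have x: "fst z \<in> topspace (disk n)" by auto
      have "{v. yof (\<psi> (fst z)) v \<noteq> 0} \<union> {v. y (fst z) v \<noteq> 0} = {v. y (fst z) v \<noteq> 0}" using y\<psi>[OF x] by blast
      then show "r (snd z) = 0 \<or> r (snd z) = 1 \<or> {v. yof (\<psi> (fst z)) v \<noteq> 0} \<union> {v. y (fst z) v \<noteq> 0} \<in> SY"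
        using fuzzyD(4)[OF pdatD(5)[OF p x]] by simp
      fix t
      show "r (snd z) = 0 \<or> r (snd z) = 1 \<or> {v. path_of (\<psi> (fst z)) t v \<noteq> 0} \<union> {v. V (fst z) (\<rho> (snd z) t) v \<noteq> 0} \<in> SX"
      proof (cases "snd z \<ge> 1 / 2")
        case False
        then have "\<rho> (snd z) t = t / N" by (simp add: \<rho>_def c_def)
        then have "{v. path_of (\<psi> (fst z)) t v \<noteq> 0} \<union> {v. V (fst z) (\<rho> (snd z) t) v \<noteq> 0} = {v. V (fst z) (t / N) v \<noteq> 0}"
          using V\<psi>[OF x, of t] by auto
        then show ?thesis using fuzzyD(4)[OF pdatD(6)[OF p x, of "t / N"]] by simp
      qed (simp add: r_def)
    qed simp
    then show ?thesis by (simp add: yF_def VF_def[abs_def] case_prod_unfold)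
  qed
  have Ty: "snd u c = snd u' c" if "u = T ?\<kappa> u'" for u u' c using that by (simp add: T_def)
  have supp_y: "y x (snd u c) \<noteq> 0" if x: "x \<in> disk_boundary n" and u: "\<zeta> x u \<noteq> 0" and c: "c \<in> {0, 1}" for x u c
  proof -
    have "snd u c \<in> {v. yof (\<zeta> x) v \<noteq> 0}"
      unfolding yof_def push_supportZ[OF z[OF x]] using u c by blast
    then show ?thesis using bd(1)[OF x] by simp
  qed
  have in_star: "fst u l \<in> star (\<zeta> x) j" if "\<zeta> x u \<noteq> 0" "l \<in> {j..j + 2}" for x u l j
    unfolding star_def using that by blast
  have V_star: "v \<in> star (\<zeta> x) j" if x: "x \<in> disk_boundary n" and "real_of_int j \<le> t" "t \<le> real_of_int j + 1" "V x t v \<noteq> 0" for x t j v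
    using path_of_star[OF z[OF x] that(2,3)] that(4) bd(2)[OF x] by auto
  have cl: "{u. \<psi> x u \<noteq> 0} \<union> {u. Tz ?\<kappa> (\<zeta> x) u \<noteq> 0} \<in> cliques" if x: "x \<in> disk_boundary n" for x
  proof -
    let ?A = "{u. \<psi> x u \<noteq> 0}" and ?C = "{u. Tz ?\<kappa> (\<zeta> x) u \<noteq> 0}"
    have A: "?A \<in> cliques" by (rule FZ(4)[OF \<psi>F[OF D[OF x]]])
    have C: "?C \<in> cliques" by (rule FZ(4)[OF zT[OF x]])
    have e: "(a, b) \<in> edges Z" if a: "a \<in> ?A" and b: "b \<in> ?C" for a b
    proof -
      have sa: "sample N (int B) (y x) (V x) a \<noteq> 0" using a by (simp add: \<psi>_def)
      obtain u where u: "\<zeta> x u \<noteq> 0" "b = T ?\<kappa> u" using b unfolding T_support[OF z[OF x]] by blast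
      have bv: "b \<in> verts Z" by (rule cliqueD(3)[OF C b])
      show ?thesis
      proof (rule S.sample_edges[OF D[OF x] sa bv])
        fix c :: nat assume c: "c \<in> {0, 1}"
        obtain L where "zvert L b" using bv verts_Z by blast
        then have "\<forall>i\<in>{0, 1}. snd b i \<in> verts Y \<and> col Y (snd b i) = i" unfolding zvert_def verts_exp_K2 by (elim conjE)
        from bspec[OF this c] show "y x (snd b c) \<noteq> 0 \<and> col Y (snd b c) = c"
          using supp_y[OF x u(1) c] Ty[OF u(2), of c] by simp
      next
        fix i j :: int assume ij: "\<bar>i - j\<bar> = 1"
        let ?j = "j div N"
        have fl: "?j = \<lfloor>real_of_int j / real_of_int N\<rfloor>" by (simp add: floor_divide_of_int_eq)
        \<comment> \<open>The sampled value at \<open>i\<close> still has nonzero weight at the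
          neighbouring time \<open>j / N\<close>, which lies in the unit interval of position
          \<open>j div N\<close>. The slow walk at \<open>j\<close> is at \<open>j div N\<close> or
          one further, so both values lie in the same star.\<close>
        have "fst a i \<in> star (\<zeta> x) ?j"
        proof (rule V_star[OF x, of _ "real_of_int j / real_of_int N"])
          show "V x (real_of_int j / real_of_int N) (fst a i) \<noteq> 0"
            using S.time_step[of i j] ij by (intro S.sample_pos(4)[OF D[OF x] sa]) auto
        qed (use fl in linarith)+
        moreover have "fst b j \<in> star (\<zeta> x) ?j"
          using in_star[OF u(1), of "?\<kappa> j" ?j] slow_div[OF N, of j] by (auto simp: u(2) T_def)
        ultimately show "\<exists>L\<in>SX. fst a i \<in> L \<and> fst b j \<in> L" using star_in[OF z[OF x]] by blast
      qed
    qed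
    have v: "?A \<subseteq> verts Z" "?C \<subseteq> verts Z" using cliqueD(3)[OF A] cliqueD(3)[OF C] by blast+
    have e': "(b, a) \<in> edges Z" if "a \<in> ?A" "b \<in> ?C" for a b
      by (rule edges_Z_sym[OF _ _ e[OF that]]) (use v that in blast)+
    have AA: "?A \<times> ?A \<subseteq> edges Z" "?C \<times> ?C \<subseteq> edges Z" using A C unfolding clique_poset_def by blast+
    have "(?A \<union> ?C) \<times> (?A \<union> ?C) = ?A \<times> ?A \<union> ?C \<times> ?C \<union> ?A \<times> ?C \<union> ?C \<times> ?A" by blast
    moreover have "?A \<times> ?C \<subseteq> edges Z" "?C \<times> ?A \<subseteq> edges Z" using e e' by blast+
    ultimately have "(?A \<union> ?C) \<times> (?A \<union> ?C) \<subseteq> edges Z" using AA by simp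
    moreover have "finite (?A \<union> ?C)" "?A \<union> ?C \<noteq> {}" using cliqueD(1,2)[OF A] cliqueD(1)[OF C] by blast+
    ultimately show ?thesis using v unfolding clique_poset_def by blast
  qed
  have c1: "continuous_map ?SI (Sph n) fst" "continuous_map ?SI euclideanreal snd"
    unfolding unit_interval_def using continuous_map_fst continuous_map_snd continuous_map_into_fulltopology by blast+
  have f\<psi>S: "fuzzy_map (Sph n) cliques \<psi>"
    using fuzzy_map_compose[OF f\<psi>, of "Sph n" "\<lambda>x. x"] by (simp add: continuous_map_from_subtopology)
  have "fuzzy_map ?SI cliques (\<lambda>z. hom (snd z) (\<psi> (fst z)) (Tz ?\<kappa> (\<zeta> (fst z))))"
    by (rule fuzzy_map_hom[OF clique_convex_sets fuzzy_map_compose[OF f\<psi>S c1(1)] fuzzy_map_compose[OF fT(1) c1(1)] c1(2)])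
      (use cl in auto)
  then have fG: "fuzzy_map ?SI cliques (\<lambda>(x, s). G x s)" by (simp add: G_def case_prod_unfold)
  have GF: "G x s \<in> FZ" if "x \<in> disk_boundary n" "s \<in> {0..1}" for x s
    using fuzzy_mapD(1)[OF fG, of "(x, s)"] that D by auto
  have supG: "\<psi> x u \<noteq> 0 \<or> (\<exists>u'. \<zeta> x u' \<noteq> 0 \<and> u = T ?\<kappa> u')" if x: "x \<in> disk_boundary n" and u: "G x s u \<noteq> 0" for x s u
  proof -
    have "\<psi> x u \<noteq> 0 \<or> Tz ?\<kappa> (\<zeta> x) u \<noteq> 0"
      by (rule hom_support[OF u[unfolded G_def] FZ(2)[OF \<psi>F[OF D[OF x]]] FZ(2)[OF zT[OF x]]])
    moreover have "Tz ?\<kappa> (\<zeta> x) u \<noteq> 0 \<Longrightarrow> u \<in> T ?\<kappa> ` {u. \<zeta> x u \<noteq> 0}" using T_support[OF z[OF x], of ?\<kappa>] by blast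
    ultimately show ?thesis by blast
  qed
  have G01: "G x 0 = \<psi> x" "G x 1 = Tz ?\<kappa> (\<zeta> x)" if x: "x \<in> disk_boundary n" for x
    using FZ(2,3)[OF zT[OF x]] FZ(2,3)[OF \<psi>F[OF D[OF x]]] unfolding G_def by (auto intro!: hom_0 hom_1)
  have yb: "0 \<le> yof (\<psi> x) v \<and> yof (\<psi> x) v \<le> 1" "0 \<le> y x v \<and> y x v \<le> 1"
    "0 \<le> path_of (\<psi> x) t v' \<and> path_of (\<psi> x) t v' \<le> 1" "0 \<le> V x t v' \<and> V x t v' \<le> 1" if x: "x \<in> topspace (disk n)" for x v t v'
    using fuzzy_bounds[OF pdatD(5)[OF p\<psi> x]] fuzzy_bounds[OF pdatD(5)[OF p x]] fuzzy_bounds[OF pdatD(6)[OF p\<psi> x]] fuzzy_bounds[OF pdatD(6)[OF p x]]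
    by simp_all
  have F0: "yF x 0 = yof (\<psi> x)" "VF x 0 = path_of (\<psi> x)" if x: "x \<in> topspace (disk n)" for x
    using yb[OF x] by (auto simp: yF_def VF_def r_def hom_0)
  have F1: "yF x 1 = y x" "VF x 1 = (\<lambda>t. V x (pos ?\<kappa> t))" if x: "x \<in> topspace (disk n)" for x
    using yb[OF x] by (auto simp: yF_def VF_def r_def \<rho>_def c_def hom_1)
  have "solvable n (\<lambda>x. PZ.uncoord (G x 1)) (\<lambda>x. mkP (yF x 1) (VF x 1))"
  proof (rule solvable_transfer[OF fG _ pF])
    \<comment> \<open>The starting problem solves itself: the samples are defined on the whole disk,
      and the prescribed map is their image under \<open>compare\<close>.\<close>
    have "continuous_map (disk n) W (\<lambda>x. PZ.uncoord (\<psi> x))" by (rule uncoordZ[OF f\<psi>])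
    then have "solvable n (\<lambda>x. PZ.uncoord (\<psi> x)) (compare \<circ> (\<lambda>x. PZ.uncoord (\<psi> x)))"
      unfolding solvable_def
      by (intro exI[of _ "\<lambda>x. PZ.uncoord (\<psi> x)"]) (auto intro: continuous_map_compose[OF _ continuous_map_compare])
    then show "solvable n (\<lambda>x. PZ.uncoord (G x 0)) (\<lambda>x. mkP (yF x 0) (VF x 0))"
      by (rule solvable_cong) (simp_all add: G01 F0 compare_uncoord[OF \<psi>F])
  next
    fix x s assume x: "x \<in> disk_boundary n" and s: "s \<in> {0, 1::real}"
    show "yof (G x s) = yF x s"
      using s G01[OF x] F0(1)[OF D[OF x]] F1(1)[OF D[OF x]] yof_T[OF z[OF x]] bd(1)[OF x] by auto
    show "path_of (G x s) t = VF x s t" for t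
      using s G01[OF x] F0(2)[OF D[OF x]] F1(2)[OF D[OF x]] path_of_T[OF w z[OF x]] bd(2)[OF x] by auto
  next
    fix x s assume x: "x \<in> disk_boundary n" and s: "s \<in> {0..1::real}"
    show "stage (int (B + 1)) (G x s)"
      unfolding stage_def
    proof (intro allI impI)
      fix u assume "G x s u \<noteq> 0"
      from supG[OF x this] have "zvert (int B) u"
      proof
        assume "\<psi> x u \<noteq> 0"
        then show ?thesis using S.sample_pos(1)[OF D[OF x], of u] by (simp add: \<psi>_def)
      next
        assume "\<exists>u'. \<zeta> x u' \<noteq> 0 \<and> u = T ?\<kappa> u'"
        then show ?thesis using zvert_T[OF w] st[OF x] unfolding stage_def by blast
      qed
      then show "zvert (int (B + 1)) u" by (rule zvert_mono) simp
    qed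
    have sy: "{v. yof (G x s) v \<noteq> 0} \<subseteq> {v. y x v \<noteq> 0}"
      unfolding yof_def push_supportZ[OF GF[OF x s]]
    proof clarify
      fix u and c :: nat assume u: "G x s u \<noteq> 0" and c: "c \<in> {0, 1}" and y0: "y x (snd u c) = 0"
      from supG[OF x u] show False
      proof
        assume "\<psi> x u \<noteq> 0"
        then show False using S.sample_pos(2)[OF D[OF x] _ c, of u] y0 by (simp add: \<psi>_def)
      next
        assume "\<exists>u'. \<zeta> x u' \<noteq> 0 \<and> u = T ?\<kappa> u'"
        then show False using supp_y[OF x _ c] y0 Ty by metis
      qed
    qed
    have "{v. yF x s v \<noteq> 0} \<subseteq> {v. y x v \<noteq> 0}"
      using hom_support[of "r s" "yof (\<psi> x)" "y x"] yb[OF D[OF x]] y\<psi>[OF D[OF x]] unfolding yF_def by blast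
    then show "{v. yof (G x s) v \<noteq> 0} \<union> {v. yF x s v \<noteq> 0} \<in> SY"
      using sy by (intro bip_sets_convex[OF fuzzyD(4)[OF yof_fuzzy[OF GF[OF x s]]] fuzzyD(4)[OF pdatD(5)[OF p D[OF x]]]]) auto
    fix t :: real
    let ?j = "\<lfloor>t / real_of_int N\<rfloor>"
    have tj: "real_of_int ?j \<le> t / N" "t / N \<le> real_of_int ?j + 1" by linarith+
    note pj = pos_slow[OF N, of ?j t, OF refl]
    have \<rho>j: "\<rho> s t \<le> real_of_int ?j + 1" unfolding \<rho>_def using tj pj c01[OF s] by (intro convex_bound_le) auto
    have "(1 - c s) * (- (t / N)) + c s * (- pos ?\<kappa> t) \<le> - real_of_int ?j"
      using tj pj c01[OF s] by (intro convex_bound_le) auto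
    then have j\<rho>: "real_of_int ?j \<le> \<rho> s t" by (simp add: \<rho>_def)
    have "fst u i \<in> star (\<zeta> x) ?j" if u: "G x s u \<noteq> 0" and i: "i \<in> {\<lfloor>t\<rfloor>..\<lfloor>t\<rfloor> + 2}" for u i
      using supG[OF x u]
    proof
      assume "\<psi> x u \<noteq> 0"
      then have "V x (t / real_of_int N) (fst u i) \<noteq> 0" using S.sample_near[OF D[OF x] _ i, of u] by (simp add: \<psi>_def)
      then show ?thesis by (rule V_star[OF x tj])
    next
      assume "\<exists>u'. \<zeta> x u' \<noteq> 0 \<and> u = T ?\<kappa> u'"
      then obtain u' where u': "\<zeta> x u' \<noteq> 0" "u = T ?\<kappa> u'" by blast
      have "?\<kappa> i \<in> {?j..?j + 2}" using slow_window[OF N pj(3)[symmetric] i] .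
      from in_star[OF u'(1) this] show ?thesis by (simp add: u'(2) T_def)
    qed
    then have "{v. path_of (G x s) t v \<noteq> 0} \<subseteq> star (\<zeta> x) ?j"
      using path_of_support[OF GF[OF x s], of t] by blast
    moreover have "{v. VF x s t v \<noteq> 0} \<subseteq> star (\<zeta> x) ?j"
    proof clarify
      fix v assume "VF x s t v \<noteq> 0"
      then have "path_of (\<psi> x) t v \<noteq> 0 \<or> V x (\<rho> s t) v \<noteq> 0"
        unfolding VF_def using yb[OF D[OF x]] by (intro hom_support) auto
      then show "v \<in> star (\<zeta> x) ?j"
      proof
        assume "path_of (\<psi> x) t v \<noteq> 0"
        then have "V x (t / real_of_int N) v \<noteq> 0" using V\<psi>[OF D[OF x], of t] by blast
        then show ?thesis by (rule V_star[OF x tj])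
      qed (rule V_star[OF x j\<rho> \<rho>j])
    qed
    moreover have "VF x s t \<in> fuzzy SX" using pdatD(6)[OF pF, of "(x, s)" t] D[OF x] s by simp
    ultimately show "{v. path_of (G x s) t v \<noteq> 0} \<union> {v. VF x s t v \<noteq> 0} \<in> SX"
      by (intro star_contiguous[OF z[OF x]])
  qed
  then show ?thesis by (rule solvable_cong) (simp_all add: G01 F1)
qed

text \<open>The order of choices matters: the stage of the boundary data fixes the range of
  constancy \<open>M\<close>, the resulting path family has a modulus \<open>d\<close>, this
  determines \<open>N\<close>, and \<open>B\<close> is the stage to which the slow walk raises
  \<open>M\<close>.\<close>

lemma weak_homotopy_equivalence_compare: "weak_homotopy_equivalence W Hp compare"
  unfolding weak_homotopy_equivalence_def
proof (intro conjI continuous_map_compare allI impI)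
  fix n u v
  assume "continuous_map (Sph n) W u \<and> continuous_map (disk n) Hp v \<and> (\<forall>x\<in>disk_boundary n. v x = compare (u x))"
  then have u: "continuous_map (Sph n) W u" and v: "continuous_map (disk n) Hp v"
    and uv: "\<And>x. x \<in> disk_boundary n \<Longrightarrow> v x = compare (u x)" by blast+
  let ?\<zeta> = "\<lambda>x. PZ.coord (u x)"
  have \<zeta>: "fuzzy_map (Sph n) cliques ?\<zeta>" by (rule coordZ[OF compact_space_disk_boundary u])
  obtain m :: nat where m: "\<And>x. x \<in> topspace (Sph n) \<Longrightarrow> stage (int m) (?\<zeta> x)" using stage_exists[OF \<zeta>] by blast
  then have st0: "\<And>x. x \<in> disk_boundary n \<Longrightarrow> stage (int m) (?\<zeta> x)" using disk_boundary_subset by auto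
  obtain y V where p: "pdat (disk n) (real (2 * m + 1)) y V"
    and bd: "\<And>x. x \<in> disk_boundary n \<Longrightarrow> y x = yof (?\<zeta> x)" "\<And>x t. x \<in> disk_boundary n \<Longrightarrow> V x t = path_of (?\<zeta> x) t"
    and fin: "\<And>u'. solvable n u' (\<lambda>x. mkP (y x) (V x)) \<Longrightarrow> solvable n u' v"
    using solvable_finite[OF u v uv st0] by blast
  \<comment> \<open>The range of constancy of the path family; stages may be enlarged, so the same
    number bounds the boundary vertices.\<close>
  define M where "M = 2 * m + 1"
  have st: "stage (int M) (?\<zeta> x)" if "x \<in> disk_boundary n" for x
    using st0[OF that] zvert_mono[of "int m" _ "int M"] unfolding stage_def M_def by force
  obtain d where d: "d > 0" "\<And>x t t' v. x \<in> topspace (disk n) \<Longrightarrow> \<bar>t - t'\<bar> < d \<Longrightarrow> \<bar>V x t v - V x t' v\<bar> < 1 / 2"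
    using pdat_fine[OF compact_space_disk p] by blast
  obtain k :: nat where k: "2 / d < real k" using reals_Archimedean2 by blast
  \<comment> \<open>Odd, at least 3 and larger than \<open>2 / d\<close>, so that times within
    \<open>2 / N\<close> are closer than \<open>d\<close>.\<close>
  define N where "N = 2 * int k + 3"
  have N: "3 \<le> N" "odd N" by (simp_all add: N_def)
  have "2 / real_of_int N < d"
  proof -
    have "real k < real_of_int N" by (simp add: N_def)
    then have "2 / d < real_of_int N" using k by linarith
    then show ?thesis using d(1) N(1) by (simp add: divide_less_eq mult.commute)
  qed
  then have fine: "\<bar>V x t v - V x t' v\<bar> < 1 / 2" if "x \<in> topspace (disk n)" "\<bar>t - t'\<bar> \<le> 2 / real_of_int N" for x t t' v
    using d(2)[OF that(1), of t t' v] that(2) by linarith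
  define B where "B = nat (N * (int M + 1))"
  have B: "int B = N * (int M + 1)" using N(1) by (simp add: B_def)
  have MB: "M \<le> B"
  proof -
    have "1 * (int M + 1) \<le> N * (int M + 1)" using N(1) by (intro mult_right_mono) auto
    then have "int M + 1 \<le> int B" unfolding B by simp
    then show ?thesis by linarith
  qed
  have w: "walk (int M) (int B) (slow N)" using walk_slow[OF N, of "int M"] by (simp add: B)
  have p': "pdat (disk n) (real M) y V" using p by (simp add: M_def)
  have "solvable n (\<lambda>x. PZ.uncoord (?\<zeta> x)) (\<lambda>x. mkP (y x) (V x))"
    by (rule solvable_walk[OF \<zeta> st p' bd w MB solvable_fine[OF \<zeta> st p' bd N B fine]])
  then have "solvable n (\<lambda>x. PZ.uncoord (?\<zeta> x)) v" by (rule fin)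
  moreover have "PZ.uncoord (?\<zeta> x) = u x" if "x \<in> disk_boundary n" for x
  proof (rule PZ.uncoord_coord)
    have "x \<in> topspace (Sph n)" using that disk_boundary_subset by auto
    from funcset_mem[OF continuous_map_funspace[OF u] this]
    show "u x \<in> realization_points cliques (\<subseteq>)" by simp
  qed
  ultimately have "solvable n u v" by (rule solvable_cong) simp_all
  then show "\<exists>l. continuous_map (disk n) W l \<and> (\<forall>x\<in>disk_boundary n. l x = u x) \<and>
     homotopic_with (\<lambda>h. \<forall>x\<in>disk_boundary n. h x = v x) (disk n) Hp (compare \<circ> l) v"
    unfolding solvable_def .
qed

end

theorem theorem5p5:
  fixes X :: "'x bigraph" and Y :: "'y bigraph" and f g :: "'y \<Rightarrow> 'x"
  assumes "is_bigraph X" and "is_bigraph Y"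
    and "bigraph_hom Y X f" and "bigraph_hom Y X g"
    and "inj_on f (verts Y) \<or> inj_on g (verts Y)"
  shows "is_homotopy_pullback
           (realization (clique_poset (Zgraph X Y f g)) (\<subseteq>))
           (realization (bip_poset Y) bip_le)
           (realization (bip_poset X) bip_le)
           (prod_topology (realization (bip_poset X) bip_le) (realization (bip_poset X) bip_le))
           (\<lambda>\<alpha>. (realization_map (bip_map f) \<alpha>, realization_map (bip_map g) \<alpha>))
           (\<lambda>\<beta>. (\<beta>, \<beta>))"
proof -
  interpret bigraph_maps X Y f g using assms by unfold_locales
  show ?thesis
    by (rule is_homotopy_pullbackI)
      (rule weak_homotopy_equivalence_compare[unfolded compare_def[abs_def] mkP_def])
qed

end
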